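(* Let $X$, $\mathcal{X}$, $\mathcal{U}$, $f$, $g$, $\sigma$, $h$, $\mathcal{C}$, $\mathcal{C}^\circ$ and the operators $\mathcal{A}^u$ be as described in the context. Suppose $h$ is a stochastic control barrier function, with corresponding control strategy $$\upsilon(x):=\{u\in\mathcal{U}:\ \mathcal{A}^u h(x)\ge0\},$$ and let $\mathbf{u}_\upsilon$ be the set of control signals that conform to $\upsilon$. Let $c=\sup_{x\in\mathcal{C}}h(x)$ and $X_0=\xi\in\mathcal{C}^\circ$. Then for every $u\in\mathbf{u}_\upsilon$, the strong solution $X$ with input $u$ satisfies $$\mathbb{P}_\xi\left[X_t\in\mathcal{C}^\circ,\ 0\le t<\infty\right]\ \ge\ \frac{h(\xi)}{c}.$$
   Context: Let $(\Omega,\mathscr{F},\{\mathscr{F}_t\}_{t\ge0},\mathbb{P})$ be a filtered probability space carrying a $d$-dimensional standard $\{\mathscr{F}_t\}$-Brownian motion $W$. Let $\mathcal{X}\subseteq\mathbb{R}^n$ be a state space and $\mathcal{U}\subset\mathbb{R}^p$ a compact set of control values. Consider the $\mathcal{X}$-valued process $X$ that is a strong solution (driven by the given $W$) of $$dX_t=(f(X_t)+g(X_t)u(t))\,dt+\sigma(X_t)\,dW_t,\qquad X_0=\xi \text{ a.s.},$$ where $f:\mathcal{X}\to\mathbb{R}^n$ is a vector field, $g:\mathcal{X}\to\mathbb{R}^{n\times p}$ and $\sigma:\mathcal{X}\to\mathbb{R}^{n\times d}$ are smooth, $f,g,\sigma$ are locally Lipschitz and satisfy a linear growth condition, and the control signal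 $u$ is a $\mathcal{U}$-valued bounded progressively measurable process on $[0,\infty)$. $\mathbb{P}_\xi$ denotes the probability law when $X_0=\xi$ a.s. Generator: for $u\in\mathcal{U}$ and a $C^2$ function $\varphi$, $$\mathcal{A}^u\varphi(x)=\frac{\partial\varphi}{\partial x}(x)\,(f(x)+g(x)u)+\frac12\sum_{i,j}(\sigma\sigma^T)_{i,j}(x)\frac{\partial^2\varphi}{\partial x_i\partial x_j}(x).$$ Safe set: $h:\mathcal{X}\to\mathbb{R}$ is twice continuously differentiable, $\mathcal{C}=\{x\in\mathcal{X}:h(x)\ge0\}$ and $\mathcal{C}^\circ=\{x\in\mathcal{X}:h(x)>0\}$. Stochastic control barrier function (SCBF): a $C^2$ function $B$ on $\mathcal{X}$ such that (i) $B(x)\ge0$ for all $x\in\mathcal{C}$; (ii) $B(x)<0$ for all $x\notin\mathcal{C}$; (iii) $\sup_{u\in\mathcal{U}}\mathcal{A}^uB(x)\ge0$ for all $x\in\mathcal{X}$. Control strategy: a set-valued map $\kappa:\mathcal{X}\to2^{\mathcal{U}}$. A control signal $u$ conforms to $\kappa$, written $u\in\mathbf{u}_\kappa$, if $u(t)\in\kappa(X_t)$ for all $t\ge0$ (almost surely), where $X$ is the solution with input $u$. Convention: if $c=\infty$, the quotient $h(\xi)/c$ is read as $0$. *)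

theory Defs
  imports "HOL-Probability.Probability"
begin

section \<open>Differentiability classes and regularity of coefficients\<close>

definition partial_deriv :: "'n::finite \<Rightarrow> (real^'n \<Rightarrow> 'b::real_normed_vector) \<Rightarrow> real^'n \<Rightarrow> 'b"
  where "partial_deriv i \<phi> x = frechet_derivative \<phi> (at x) (axis i 1)"

primrec C_k_open :: "nat \<Rightarrow> (real^'n::finite \<Rightarrow> 'b::real_normed_vector) \<Rightarrow> (real^'n) set \<Rightarrow> bool"
  where
    "C_k_open 0 \<phi> O' \<longleftrightarrow> continuous_on O' \<phi>"
  | "C_k_open (Suc k) \<phi> O' \<longleftrightarrow>
       (\<forall>x\<in>O'. \<phi> differentiable (at x)) \<and> (\<forall>i. C_k_open k (partial_deriv i \<phi>) O')"

text \<open>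
  The state space is an arbitrary subset \<open>S\<close> of Euclidean space. As usual, being of class
  \<open>C\<^sup>k\<close> on \<open>S\<close> means being of class \<open>C\<^sup>k\<close> on some open neighbourhood of \<open>S\<close>; for open \<open>S\<close> the
  neighbourhood may be taken to be \<open>S\<close> itself.
\<close>

definition C_k_on :: "nat \<Rightarrow> (real^'n::finite \<Rightarrow> 'b::real_normed_vector) \<Rightarrow> (real^'n) set \<Rightarrow> bool"
  where "C_k_on k \<phi> S \<longleftrightarrow> (\<exists>O'. open O' \<and> S \<subseteq> O' \<and> C_k_open k \<phi> O')"

definition smooth_on :: "(real^'n::finite \<Rightarrow> 'b::real_normed_vector) \<Rightarrow> (real^'n) set \<Rightarrow> bool"
  where "smooth_on \<phi> S \<longleftrightarrow> (\<exists>O'. open O' \<and> S \<subseteq> O' \<and> (\<forall>k. C_k_open k \<phi> O'))"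

definition locally_lipschitz_on :: "('a::metric_space \<Rightarrow> 'b::metric_space) \<Rightarrow> 'a set \<Rightarrow> bool"
  where "locally_lipschitz_on \<phi> S \<longleftrightarrow>
    (\<forall>x\<in>S. \<exists>\<epsilon>>0. \<exists>L. L-lipschitz_on (cball x \<epsilon> \<inter> S) \<phi>)"

definition linear_growth_on :: "('a::real_normed_vector \<Rightarrow> 'b::real_normed_vector) \<Rightarrow> 'a set \<Rightarrow> bool"
  where "linear_growth_on \<phi> S \<longleftrightarrow> (\<exists>K. \<forall>x\<in>S. norm (\<phi> x) \<le> K * (1 + norm x))"


section \<open>Filtrations, progressive measurability, Brownian motion\<close>

text \<open>
  Time is \<open>[0,\<infinity>)\<close>: processes and filtrations are indexed by \<^typ>\<open>real\<close>, but only their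
  values at nonnegative times are ever constrained or used.
\<close>

definition filtration_of :: "'w measure \<Rightarrow> (real \<Rightarrow> 'w measure) \<Rightarrow> bool"
  where "filtration_of M F \<longleftrightarrow>
    (\<forall>t\<ge>0. subalgebra M (F t)) \<and> (\<forall>s\<ge>0. \<forall>t\<ge>s. sets (F s) \<subseteq> sets (F t))"

definition progressively_measurable ::
    "(real \<Rightarrow> 'w measure) \<Rightarrow> (real \<Rightarrow> 'w \<Rightarrow> 'b::topological_space) \<Rightarrow> bool"
  where "progressively_measurable F Y \<longleftrightarrow>
    (\<forall>t\<ge>0. (\<lambda>(s, \<omega>). Y s \<omega>) \<in> borel_measurable (restrict_space borel {0..t} \<Otimes>\<^sub>M F t))"

text \<open>
  The product form of the density makes the increment over \<open>[s,t]\<close> a centred Gaussian vector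
  with covariance matrix \<open>(t - s) I\<close>; recall that \<^const>\<open>normal_density\<close> takes the standard
  deviation.
\<close>

definition brownian_motion ::
    "'w measure \<Rightarrow> (real \<Rightarrow> 'w measure) \<Rightarrow> (real \<Rightarrow> 'w \<Rightarrow> real^'d::finite) \<Rightarrow> bool"
  where "brownian_motion M F W \<longleftrightarrow>
    (\<forall>t\<ge>0. W t \<in> borel_measurable (F t)) \<and>
    (\<forall>\<omega>\<in>space M. continuous_on {0..} (\<lambda>t. W t \<omega>)) \<and>
    (AE \<omega> in M. W 0 \<omega> = 0) \<and>
    (\<forall>s\<ge>0. \<forall>t>s.
       distributed M lborel (\<lambda>\<omega>. W t \<omega> - W s \<omega>)
         (\<lambda>x. ennreal (\<Prod>j\<in>UNIV. normal_density 0 (sqrt (t - s)) (x $ j))) \<and>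
       prob_space.indep_set M (sets (F s))
         {(\<lambda>\<omega>. W t \<omega> - W s \<omega>) -` A \<inter> space M | A. A \<in> sets borel})"


section \<open>The It\^o integral\<close>

text \<open>
  A simple process is \<open>\<Sum>k<m. A\<^sub>k 1\<^bsub>(\<tau>\<^sub>k, \<tau>\<^sub>k\<^sub>+\<^sub>1]\<^esub>\<close> with deterministic times
  \<open>0 \<le> \<tau>\<^sub>0 \<le> \<dots> \<le> \<tau>\<^sub>m\<close> and bounded \<open>F\<^bsub>\<tau>\<^sub>k\<^esub>\<close>-measurable matrices \<open>A\<^sub>k\<close>.
\<close>

definition simple_integrand ::
    "'w measure \<Rightarrow> (real \<Rightarrow> 'w measure) \<Rightarrow> nat \<Rightarrow> (nat \<Rightarrow> real) \<Rightarrow>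
     (nat \<Rightarrow> 'w \<Rightarrow> real^'d::finite^'n::finite) \<Rightarrow> bool"
  where "simple_integrand M F m \<tau> A \<longleftrightarrow>
    0 \<le> \<tau> 0 \<and> (\<forall>k<m. \<tau> k \<le> \<tau> (Suc k)) \<and>
    (\<forall>k<m. A k \<in> borel_measurable (F (\<tau> k))) \<and>
    (\<exists>K. \<forall>k<m. \<forall>\<omega>\<in>space M. norm (A k \<omega>) \<le> K)"

definition simple_process ::
    "nat \<Rightarrow> (nat \<Rightarrow> real) \<Rightarrow> (nat \<Rightarrow> 'w \<Rightarrow> real^'d::finite^'n::finite) \<Rightarrow>
     real \<Rightarrow> 'w \<Rightarrow> real^'d^'n"
  where "simple_process m \<tau> A s \<omega> = (\<Sum>k<m. indicator {\<tau> k<..\<tau> (Suc k)} s *\<^sub>R A k \<omega>)"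

definition simple_ito_integral ::
    "(real \<Rightarrow> 'w \<Rightarrow> real^'d::finite) \<Rightarrow> nat \<Rightarrow> (nat \<Rightarrow> real) \<Rightarrow>
     (nat \<Rightarrow> 'w \<Rightarrow> real^'d^'n::finite) \<Rightarrow> real \<Rightarrow> 'w \<Rightarrow> real^'n"
  where "simple_ito_integral W m \<tau> A t \<omega> =
    (\<Sum>k<m. A k \<omega> *v (W (min (\<tau> (Suc k)) t) \<omega> - W (min (\<tau> k) t) \<omega>))"

text \<open>
  \<open>I\<close> is (a version of) \<open>\<integral>\<^sub>0\<^sup>t H\<^sub>s dW\<^sub>s\<close>: the limit in probability of the integrals of simple
  processes converging to \<open>H\<close> in the sense that \<open>\<integral>\<^sub>0\<^sup>t \<parallel>H\<^sup>N\<^sub>s - H\<^sub>s\<parallel>\<^sup>2 ds \<longrightarrow> 0\<close> in probability.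
  The norm on matrices is the Frobenius norm. The limit is almost surely unique and independent
  of the approximating sequence.
\<close>

definition has_ito_integral ::
    "'w measure \<Rightarrow> (real \<Rightarrow> 'w measure) \<Rightarrow> (real \<Rightarrow> 'w \<Rightarrow> real^'d::finite) \<Rightarrow>
     (real \<Rightarrow> 'w \<Rightarrow> real^'d^'n::finite) \<Rightarrow> real \<Rightarrow> ('w \<Rightarrow> real^'n) \<Rightarrow> bool"
  where "has_ito_integral M F W H t I \<longleftrightarrow>
    progressively_measurable F H \<and>
    (AE \<omega> in M. (\<integral>\<^sup>+s\<in>{0..t}. ennreal ((norm (H s \<omega>))\<^sup>2) \<partial>lborel) < \<infinity>) \<and>
    I \<in> borel_measurable M \<and>
    (\<exists>m \<tau> A.
       (\<forall>N::nat. simple_integrand M F (m N) (\<tau> N) (A N)) \<and>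
       (\<forall>\<epsilon>>0. (\<lambda>N. measure M {\<omega>\<in>space M.
          (\<integral>\<^sup>+s\<in>{0..t}. ennreal ((norm (simple_process (m N) (\<tau> N) (A N) s \<omega> - H s \<omega>))\<^sup>2)
             \<partial>lborel) > ennreal \<epsilon>}) \<longlonglongrightarrow> 0) \<and>
       (\<forall>\<epsilon>>0. (\<lambda>N. measure M {\<omega>\<in>space M.
          norm (simple_ito_integral W (m N) (\<tau> N) (A N) t \<omega> - I \<omega>) > \<epsilon>}) \<longlonglongrightarrow> 0))"


section \<open>Controlled stochastic differential equations\<close>

definition control_signal ::
    "'w measure \<Rightarrow> (real \<Rightarrow> 'w measure) \<Rightarrow> (real^'p::finite) set \<Rightarrow>
     (real \<Rightarrow> 'w \<Rightarrow> real^'p) \<Rightarrow> bool"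
  where "control_signal M F U u \<longleftrightarrow>
    (\<forall>t\<ge>0. \<forall>\<omega>\<in>space M. u t \<omega> \<in> U) \<and>
    (\<exists>K. \<forall>t\<ge>0. \<forall>\<omega>\<in>space M. norm (u t \<omega>) \<le> K) \<and>
    progressively_measurable F u"

text \<open>
  \<open>X\<close> lives on the given space and is driven by the given \<open>W\<close>. It is only required to be
  adapted to \<open>F\<close>, not to the filtration generated by \<open>W\<close>, since the control may depend on all
  of \<open>F\<close>.
\<close>

definition strong_solution ::
    "'w measure \<Rightarrow> (real \<Rightarrow> 'w measure) \<Rightarrow> (real \<Rightarrow> 'w \<Rightarrow> real^'d::finite) \<Rightarrow>
     (real^'n::finite) set \<Rightarrow> (real^'n \<Rightarrow> real^'n) \<Rightarrow> (real^'n \<Rightarrow> real^'p::finite^'n) \<Rightarrow>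
     (real^'n \<Rightarrow> real^'d^'n) \<Rightarrow> (real \<Rightarrow> 'w \<Rightarrow> real^'p) \<Rightarrow> real^'n \<Rightarrow>
     (real \<Rightarrow> 'w \<Rightarrow> real^'n) \<Rightarrow> bool"
  where "strong_solution M F W S f g \<sigma> u \<xi> X \<longleftrightarrow>
    (\<forall>t\<ge>0. X t \<in> borel_measurable (F t)) \<and>
    (\<forall>t\<ge>0. \<forall>\<omega>\<in>space M. X t \<omega> \<in> S) \<and>
    (\<forall>\<omega>\<in>space M. continuous_on {0..} (\<lambda>t. X t \<omega>)) \<and>
    (AE \<omega> in M. X 0 \<omega> = \<xi>) \<and>
    (\<forall>t\<ge>0. (AE \<omega> in M. set_integrable lborel {0..t} (\<lambda>s. f (X s \<omega>) + g (X s \<omega>) *v u s \<omega>)) \<and>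
       (\<exists>I. has_ito_integral M F W (\<lambda>s \<omega>. \<sigma> (X s \<omega>)) t I \<and>
          (AE \<omega> in M. X t \<omega> =
             X 0 \<omega> + (LINT s:{0..t}|lborel. f (X s \<omega>) + g (X s \<omega>) *v u s \<omega>) + I \<omega>)))"

definition generator ::
    "(real^'n::finite \<Rightarrow> real^'n) \<Rightarrow> (real^'n \<Rightarrow> real^'p::finite^'n) \<Rightarrow>
     (real^'n \<Rightarrow> real^'d::finite^'n) \<Rightarrow> real^'p \<Rightarrow> (real^'n \<Rightarrow> real) \<Rightarrow> real^'n \<Rightarrow> real"
  where "generator f g \<sigma> v \<phi> x =
    (\<Sum>i\<in>UNIV. partial_deriv i \<phi> x * (f x + g x *v v) $ i) +
    1/2 * (\<Sum>i\<in>UNIV. \<Sum>j\<in>UNIV.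
       (\<sigma> x ** transpose (\<sigma> x)) $ i $ j * partial_deriv i (partial_deriv j \<phi>) x)"


section \<open>Stochastic control barrier functions and control strategies\<close>

definition safe_set :: "'a set \<Rightarrow> ('a \<Rightarrow> real) \<Rightarrow> 'a set"
  where "safe_set S h = {x\<in>S. h x \<ge> 0}"

definition safe_interior :: "'a set \<Rightarrow> ('a \<Rightarrow> real) \<Rightarrow> 'a set"
  where "safe_interior S h = {x\<in>S. h x > 0}"

text \<open>The supremum over controls is taken in the extended reals, so it is \<open>-\<infinity>\<close> for empty \<open>U\<close>.\<close>

definition scbf ::
    "(real^'n::finite) set \<Rightarrow> (real^'p::finite) set \<Rightarrow> (real^'n \<Rightarrow> real^'n) \<Rightarrow>
     (real^'n \<Rightarrow> real^'p^'n) \<Rightarrow> (real^'n \<Rightarrow> real^'d::finite^'n) \<Rightarrow> (real^'n) set \<Rightarrow>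
     (real^'n \<Rightarrow> real) \<Rightarrow> bool"
  where "scbf S U f g \<sigma> C B \<longleftrightarrow>
    C_k_on 2 B S \<and>
    (\<forall>x\<in>C. B x \<ge> 0) \<and>
    (\<forall>x\<in>S - C. B x < 0) \<and>
    (\<forall>x\<in>S. (SUP v\<in>U. ereal (generator f g \<sigma> v B x)) \<ge> 0)"

definition scbf_strategy ::
    "(real^'p::finite) set \<Rightarrow> (real^'n::finite \<Rightarrow> real^'n) \<Rightarrow> (real^'n \<Rightarrow> real^'p^'n) \<Rightarrow>
     (real^'n \<Rightarrow> real^'d::finite^'n) \<Rightarrow> (real^'n \<Rightarrow> real) \<Rightarrow> real^'n \<Rightarrow> (real^'p) set"
  where "scbf_strategy U f g \<sigma> B x = {v\<in>U. generator f g \<sigma> v B x \<ge> 0}"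

definition conforms_to ::
    "'w measure \<Rightarrow> ('a \<Rightarrow> 'b set) \<Rightarrow> (real \<Rightarrow> 'w \<Rightarrow> 'b) \<Rightarrow> (real \<Rightarrow> 'w \<Rightarrow> 'a) \<Rightarrow> bool"
  where "conforms_to M \<kappa> u X \<longleftrightarrow> (AE \<omega> in M. \<forall>t\<ge>0. u t \<omega> \<in> \<kappa> (X t \<omega>))"

end

theory Submission
  imports Defs
begin

text \<open>
  If the process \<open>h(X)\<close> is stopped when it becomes small, the condition on the generator makes it a
  submartingale bounded by \<open>c\<close>, whence \<open>h(\<xi>) \<le> c P(h(X) stays positive) + o(1)\<close>. The Ito formula is
  replaced by an argument on a uniform grid: \<open>X\<close> is compared with Euler sums \<open>Y\<close>, whose noise increments
  are Gaussian given the past, and \<open>h\<close> is expanded to second order along \<open>Y\<close>, up to the first grid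
  point at which \<open>h(X)\<close> is small, \<open>X\<close> has left a large compact set or \<open>Y\<close> is far from \<open>X\<close>. The errors
  vanish with the mesh. That \<open>Y\<close> stays close to \<open>X\<close> uniformly on the grid follows from a maximal
  inequality for discrete stochastic integrals, applied on a common refinement of the grid and of the
  partitions of the simple processes that define the Ito integral.
\<close>

section \<open>Moments of Brownian increments\<close>

text \<open>What shapes the argument is how little \<open>has_ito_integral\<close> provides: an
  integral for each time separately, up to null sets, with no martingale property and no continuity
  in time. So everything is reduced to sums over grid cells, where an increment of \<open>W\<close>
  is independent of the past and has known moments. The increments of \<open>X\<close> have no such
  law, hence the detour through \<open>Y\<close>. The control is merely progressively measurable, so
  \<open>Y\<close> freezes only the state and integrates the control over each cell; the generator
  is affine in the control, so its sign survives the averaging. Coefficients are evaluated at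
  \<open>X\<close>, which stays in the state space, and \<open>h\<close> at \<open>Y\<close>, which
  is only near it. A Gaussian step can be arbitrarily long, so \<open>h\<close> is cut off outside a
  compact set, and fourth moments pay for the long steps. Two kinds of exceptional event are kept
  apart: the first fixes the compact set and with it all constants, and only then is the mesh made
  so fine that failure of the approximation is improbable even when multiplied by these
  constants.\<close>

lemma lborel_prod_components:
  fixes f :: "'d::finite \<Rightarrow> real \<Rightarrow> real"
  assumes f: "\<And>j. integrable lborel (f j)"
  shows "integrable lborel (\<lambda>x::real^'d. \<Prod>j\<in>UNIV. f j (x $ j))"
    and "integral\<^sup>L lborel (\<lambda>x::real^'d. \<Prod>j\<in>UNIV. f j (x $ j)) = (\<Prod>j\<in>UNIV. integral\<^sup>L lborel (f j))"
proof -
  \<comment> \<open>The product representation \<open>lborel_eq\<close> of Lebesgue measure is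
    indexed by \<open>Basis\<close>; \<open>ax\<close> carries it over to the coordinates of a
    vector.\<close>
  define ax where "ax = (\<lambda>j::'d. axis j (1::real))"
  have bij: "bij_betw ax UNIV (Basis :: (real^'d) set)"
    by (auto simp: bij_betw_def ax_def Basis_vec_def inj_on_def axis_eq_axis)
  define g where "g = (\<lambda>b. f (the_inv_into UNIV ax b))"
  have inv: "the_inv_into UNIV ax (ax j) = j" for j
    using bij by (auto simp: bij_betw_def intro!: the_inv_into_f_f)
  have gi: "integrable lborel (g b)" for b
    unfolding g_def by (rule f)
  have fm[measurable]: "f j \<in> borel_measurable borel" for j
    using borel_measurable_integrable[OF f[of j]] by simp
  have gm[measurable]: "g b \<in> borel_measurable borel" for b
    unfolding g_def by simp
  have eq: "(\<Prod>j\<in>UNIV. f j (x $ j)) = (\<Prod>b\<in>Basis. g b (x \<bullet> b))" for x :: "real^'d"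
  proof -
    have "(\<Prod>b\<in>Basis. g b (x \<bullet> b)) = (\<Prod>j\<in>UNIV. g (ax j) (x \<bullet> ax j))"
      by (rule prod.reindex_bij_betw[OF bij, symmetric])
    also have "\<dots> = (\<Prod>j\<in>UNIV. f j (x $ j))"
      by (simp add: g_def inv) (simp add: ax_def inner_axis)
    finally show ?thesis by simp
  qed
  have eqp: "(\<Prod>b\<in>Basis. g b ((\<Sum>c\<in>Basis. y c *\<^sub>R c) \<bullet> b)) = (\<Prod>b\<in>Basis. g b (y b))" for y :: "real^'d \<Rightarrow> real"
    by (intro prod.cong refl) (simp add: inner_sum_left inner_Basis if_distrib cong: if_cong)
  interpret product_sigma_finite "\<lambda>_::real^'d. lborel :: real measure" ..
  have "integrable (\<Pi>\<^sub>M b\<in>(Basis::(real^'d) set). lborel) (\<lambda>y. \<Prod>b\<in>Basis. g b (y b))"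
    by (rule product_integrable_prod) (auto simp: gi)
  then show "integrable lborel (\<lambda>x::real^'d. \<Prod>j\<in>UNIV. f j (x $ j))"
    unfolding eq by (subst lborel_eq) (simp add: integrable_distr_eq eqp)
  have "integral\<^sup>L lborel (\<lambda>x::real^'d. \<Prod>j\<in>UNIV. f j (x $ j)) = (\<integral>y. (\<Prod>b\<in>(Basis::(real^'d) set). g b (y b)) \<partial>(\<Pi>\<^sub>M b\<in>(Basis::(real^'d) set). lborel))"
    unfolding eq by (subst lborel_eq) (simp add: integral_distr eqp)
  also have "\<dots> = (\<Prod>b\<in>(Basis::(real^'d) set). integral\<^sup>L lborel (g b))"
    by (rule product_integral_prod) (auto simp: gi)
  also have "\<dots> = (\<Prod>j\<in>UNIV. integral\<^sup>L lborel (g (ax j)))"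
    by (rule prod.reindex_bij_betw[OF bij, symmetric])
  finally show "integral\<^sup>L lborel (\<lambda>x::real^'d. \<Prod>j\<in>UNIV. f j (x $ j)) = (\<Prod>j\<in>UNIV. integral\<^sup>L lborel (f j))"
    by (simp add: g_def inv)
qed

lemma gaussian_moments:
  assumes "0 < v"
  shows "(\<integral>x. normal_density 0 (sqrt v) x \<partial>lborel) = 1"
    and "(\<integral>x. normal_density 0 (sqrt v) x * x \<partial>lborel) = 0"
    and "(\<integral>x. normal_density 0 (sqrt v) x * x\<^sup>2 \<partial>lborel) = v"
    and "(\<integral>x. normal_density 0 (sqrt v) x * x^4 \<partial>lborel) = 3 * v\<^sup>2"
proof -
  have p: "0 < sqrt v" using assms by simp
  show "(\<integral>x. normal_density 0 (sqrt v) x \<partial>lborel) = 1"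
    using has_bochner_integral_integral_eq[OF normal_moment_even[OF p, of 0 0]] by simp
  show "(\<integral>x. normal_density 0 (sqrt v) x * x \<partial>lborel) = 0"
    using has_bochner_integral_integral_eq[OF normal_moment_odd[OF p, of 0 0]] by simp
  show "(\<integral>x. normal_density 0 (sqrt v) x * x\<^sup>2 \<partial>lborel) = v"
    using has_bochner_integral_integral_eq[OF normal_moment_even[OF p, of 0 1]] assms by simp
  show "(\<integral>x. normal_density 0 (sqrt v) x * x^4 \<partial>lborel) = 3 * v\<^sup>2"
    using has_bochner_integral_integral_eq[OF normal_moment_even[OF p, of 0 2]] assms
    by (simp add: fact_numeral power2_eq_square field_simps)
qed

lemma prod_single_power: "(\<Prod>j\<in>UNIV. (x j :: real) ^ (if j = i then n else 0)) = x i ^ n" for i :: "'d::finite"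
  by (subst prod.remove[of _ i]) auto

locale filtered_bm = prob_space M
  for M :: "'w measure" +
  fixes F :: "real \<Rightarrow> 'w measure" and W :: "real \<Rightarrow> 'w \<Rightarrow> real^'d::finite"
  assumes filtration: "filtration_of M F" and brownian: "brownian_motion M F W"
begin

lemma F_subalg: "0 \<le> t \<Longrightarrow> subalgebra M (F t)"
  and F_mono: "0 \<le> s \<Longrightarrow> s \<le> t \<Longrightarrow> sets (F s) \<subseteq> sets (F t)"
  using filtration by (auto simp: filtration_of_def)

lemma space_F: "0 \<le> t \<Longrightarrow> space (F t) = space M"
  using F_subalg[of t] by (simp add: subalgebra_def)

lemma measurable_F_M: "0 \<le> t \<Longrightarrow> Y \<in> measurable (F t) N \<Longrightarrow> Y \<in> measurable M N"
  using F_subalg measurable_from_subalg by blast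

lemma measurable_F_mono: "0 \<le> s \<Longrightarrow> s \<le> t \<Longrightarrow> Y \<in> measurable (F s) N \<Longrightarrow> Y \<in> measurable (F t) N"
  using F_mono[of s t] space_F[of s] space_F[of t] by (auto simp: measurable_def)

lemma W_adapted: "0 \<le> t \<Longrightarrow> W t \<in> borel_measurable (F t)"
  using brownian by (auto simp: brownian_motion_def)

lemma W_measurable[measurable]: "0 \<le> t \<Longrightarrow> W t \<in> borel_measurable M"
  using W_adapted measurable_F_M by blast

text \<open>The density is a product, so a monomial moment factors into one-dimensional Gaussian
  moments. Suitable exponent vectors then give every moment used: means, covariances and fourth
  powers of coordinates.\<close>

lemma increment_monomial:
  assumes "0 \<le> s" "s < t"
  shows "integrable M (\<lambda>\<omega>. \<Prod>j\<in>UNIV. ((W t \<omega> - W s \<omega>) $ j) ^ e j)"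
    and "expectation (\<lambda>\<omega>. \<Prod>j\<in>UNIV. ((W t \<omega> - W s \<omega>) $ j) ^ e j) =
      (\<Prod>j\<in>UNIV. \<integral>x. normal_density 0 (sqrt (t - s)) x * x ^ e j \<partial>lborel)"
proof -
  define nd where "nd = (\<lambda>x::real^'d. \<Prod>j\<in>UNIV. normal_density 0 (sqrt (t - s)) (x $ j))"
  have D: "distributed M lborel (\<lambda>\<omega>. W t \<omega> - W s \<omega>) (\<lambda>x. ennreal (nd x))"
    using brownian assms by (auto simp: brownian_motion_def nd_def)
  have nn: "0 \<le> nd x" for x unfolding nd_def by (intro prod_nonneg) auto
  have "(\<lambda>x::real^'d. \<Prod>j\<in>UNIV. (x $ j) ^ e j) \<in> borel_measurable borel"
    by (intro borel_measurable_continuous_onI continuous_intros)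
  then have gm: "(\<lambda>x::real^'d. \<Prod>j\<in>UNIV. (x $ j) ^ e j) \<in> borel_measurable lborel"
    by simp
  have mom: "integrable lborel (\<lambda>x. normal_density 0 (sqrt (t - s)) x * x ^ k)" for k
    using integrable_normal_moment[of "sqrt (t-s)" 0 k] assms by simp
  have eq: "nd x * (\<Prod>j\<in>UNIV. (x $ j) ^ e j) = (\<Prod>j\<in>UNIV. normal_density 0 (sqrt (t - s)) (x $ j) * (x $ j) ^ e j)" for x
    by (simp add: nd_def prod.distrib)
  show "integrable M (\<lambda>\<omega>. \<Prod>j\<in>UNIV. ((W t \<omega> - W s \<omega>) $ j) ^ e j)"
    using lborel_prod_components(1)[of "\<lambda>j x. normal_density 0 (sqrt (t - s)) x * x ^ e j", OF mom]
    by (subst distributed_integrable[OF D gm nn, symmetric]) (simp add: eq)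
  show "expectation (\<lambda>\<omega>. \<Prod>j\<in>UNIV. ((W t \<omega> - W s \<omega>) $ j) ^ e j) =
      (\<Prod>j\<in>UNIV. \<integral>x. normal_density 0 (sqrt (t - s)) x * x ^ e j \<partial>lborel)"
    using lborel_prod_components(2)[of "\<lambda>j x. normal_density 0 (sqrt (t - s)) x * x ^ e j", OF mom]
    by (subst distributed_integral[OF D gm nn, symmetric]) (simp add: eq)
qed

lemma increment_coordinate:
  assumes "0 \<le> s" "s < t"
  shows "integrable M (\<lambda>\<omega>. (W t \<omega> - W s \<omega>) $ i)" 
    and "expectation (\<lambda>\<omega>. (W t \<omega> - W s \<omega>) $ i) = 0"
    and "integrable M (\<lambda>\<omega>. ((W t \<omega> - W s \<omega>) $ i) ^ 4)" 
    and "expectation (\<lambda>\<omega>. ((W t \<omega> - W s \<omega>) $ i) ^ 4) = 3 * (t - s)\<^sup>2"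
proof -
  note P = increment_monomial[OF assms, of "\<lambda>j. if j = i then n else 0" for n, unfolded prod_single_power]
  have gm: "(\<Prod>j\<in>UNIV. \<integral>x. normal_density 0 (sqrt (t - s)) x * x ^ (if j = i then n else 0) \<partial>lborel)
     = (\<integral>x. normal_density 0 (sqrt (t - s)) x * x ^ n \<partial>lborel)" for n
    by (subst prod.remove[of _ i]) (use assms in \<open>auto simp: gaussian_moments intro!: prod.neutral\<close>)
  note P = P[unfolded gm]
  show "integrable M (\<lambda>\<omega>. (W t \<omega> - W s \<omega>) $ i)" 
    using P(1)[of 1] by simp
  show "expectation (\<lambda>\<omega>. (W t \<omega> - W s \<omega>) $ i) = 0"
    using P(2)[of 1] assms by (simp add: gaussian_moments)
  show "integrable M (\<lambda>\<omega>. ((W t \<omega> - W s \<omega>) $ i) ^ 4)" 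
    using P(1)[of 4] by simp
  show "expectation (\<lambda>\<omega>. ((W t \<omega> - W s \<omega>) $ i) ^ 4) = 3 * (t - s)\<^sup>2"
    using P(2)[of 4] assms by (simp add: gaussian_moments)
qed

lemma increment_covariance:
  assumes "0 \<le> s" "s < t"
  shows "integrable M (\<lambda>\<omega>. (W t \<omega> - W s \<omega>) $ i * (W t \<omega> - W s \<omega>) $ j)" 
    and "expectation (\<lambda>\<omega>. (W t \<omega> - W s \<omega>) $ i * (W t \<omega> - W s \<omega>) $ j) = (if i = j then t - s else 0)"
proof -
  \<comment> \<open>The exponent vector of \<open>x i * x j\<close>: it has the value 2 at
    \<open>i\<close> if \<open>i = j\<close>, and otherwise the value 1 at two places, where a
    vanishing first moment kills the product.\<close>
  define e where "e = (\<lambda>k. (if k = i then 1 else 0) + (if k = j then 1 else (0::nat)))"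
  have eq: "(\<Prod>k\<in>UNIV. (x k :: real) ^ e k) = x i * x j" for x
    unfolding e_def power_add prod.distrib by (simp add: prod_single_power)
  note P = increment_monomial[OF assms, of e, unfolded eq]
  show "integrable M (\<lambda>\<omega>. (W t \<omega> - W s \<omega>) $ i * (W t \<omega> - W s \<omega>) $ j)"
    by (rule P)
  have "(\<Prod>k\<in>UNIV. \<integral>x. normal_density 0 (sqrt (t - s)) x * x ^ e k \<partial>lborel) = (if i = j then t - s else 0)"
  proof (cases "i = j")
    case True
    then show ?thesis using assms
      by (subst prod.remove[of _ i]) (auto simp: e_def gaussian_moments power2_eq_square[symmetric] intro!: prod.neutral)
  next
    case False
    then show ?thesis using assms
      by (subst prod.remove[of _ i]) (auto simp: e_def gaussian_moments)
  qed
  with P(2) show "expectation (\<lambda>\<omega>. (W t \<omega> - W s \<omega>) $ i * (W t \<omega> - W s \<omega>) $ j) = (if i = j then t - s else 0)"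
    by simp
qed

text \<open>\<open>q\<close> depends on the past and \<open>\<psi>\<close> sees the increment alone,
  so the expectation of the product factors. Independence of the noise from the past enters the
  proof only here.\<close>

lemma increment_indep:
  fixes q :: "'w \<Rightarrow> real" and \<psi> :: "real^'d \<Rightarrow> real"
  assumes st: "0 \<le> s" "s < t" and q: "q \<in> borel_measurable (F s)" "integrable M q"
    and psi: "\<psi> \<in> borel_measurable borel" "integrable M (\<lambda>\<omega>. \<psi> (W t \<omega> - W s \<omega>))"
  shows "integrable M (\<lambda>\<omega>. q \<omega> * \<psi> (W t \<omega> - W s \<omega>))"
    and "expectation (\<lambda>\<omega>. q \<omega> * \<psi> (W t \<omega> - W s \<omega>)) = expectation q * expectation (\<lambda>\<omega>. \<psi> (W t \<omega> - W s \<omega>))"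
proof -
  define D where "D = (\<lambda>\<omega>. W t \<omega> - W s \<omega>)"
  have Dm: "D \<in> borel_measurable M" unfolding D_def using st by simp
  have ind: "indep_set (sets (F s)) {D -` A \<inter> space M | A. A \<in> sets borel}"
    using brownian st by (auto simp: brownian_motion_def D_def)
  \<comment> \<open>Preimages of Borel sets are closed under intersection, so independence extends
    to the generated \<sigma>-algebras, which is the form that \<open>indep_var_eq\<close> asks
    for.\<close>
  have stable: "Int_stable {f -` A \<inter> space M | A. A \<in> sets borel}" for f :: "'w \<Rightarrow> real"
  proof (rule Int_stableI)
    fix a b assume "a \<in> {f -` A \<inter> space M | A. A \<in> sets borel}" "b \<in> {f -` A \<inter> space M | A. A \<in> sets borel}"
    then obtain A B where "a = f -` A \<inter> space M" "A \<in> sets borel" "b = f -` B \<inter> space M" "B \<in> sets borel" by auto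
    then show "a \<inter> b \<in> {f -` A \<inter> space M | A. A \<in> sets borel}" by (auto intro!: exI[of _ "A \<inter> B"])
  qed
  have sub1: "{q -` A \<inter> space M | A. A \<in> sets borel} \<subseteq> sets (F s)"
    using measurable_sets[OF q(1)] space_F[OF st(1)] by auto
  have sub2: "{(\<lambda>\<omega>. \<psi> (D \<omega>)) -` A \<inter> space M | A. A \<in> sets borel} \<subseteq> {D -` A \<inter> space M | A. A \<in> sets borel}"
  proof
    fix B assume "B \<in> {(\<lambda>\<omega>. \<psi> (D \<omega>)) -` A \<inter> space M | A. A \<in> sets borel}"
    then obtain A where A: "A \<in> sets borel" "B = (\<lambda>\<omega>. \<psi> (D \<omega>)) -` A \<inter> space M" by auto
    then have "B = D -` (\<psi> -` A) \<inter> space M" "\<psi> -` A \<in> sets borel"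
      using measurable_sets[OF psi(1), of A] by auto
    then show "B \<in> {D -` A \<inter> space M | A. A \<in> sets borel}" by blast
  qed
  have "indep_set {q -` A \<inter> space M | A. A \<in> sets borel} {(\<lambda>\<omega>. \<psi> (D \<omega>)) -` A \<inter> space M | A. A \<in> sets borel}"
    using ind sub1 sub2 unfolding indep_sets2_eq by (meson subset_iff)
  from indep_set_sigma_sets[OF this stable stable]
  have iv': "indep_var borel q borel (\<lambda>\<omega>. \<psi> (D \<omega>))"
    unfolding indep_var_eq using measurable_F_M[OF st(1) q(1)] measurable_compose[OF Dm psi(1)] by simp
  show "integrable M (\<lambda>\<omega>. q \<omega> * \<psi> (W t \<omega> - W s \<omega>))"
    using indep_var_integrable[OF iv' q(2)] psi(2) by (simp add: D_def)
  show "expectation (\<lambda>\<omega>. q \<omega> * \<psi> (W t \<omega> - W s \<omega>)) = expectation q * expectation (\<lambda>\<omega>. \<psi> (W t \<omega> - W s \<omega>))"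
    using indep_var_lebesgue_integral[OF iv' q(2)] psi(2) by (simp add: D_def)
qed

end

section \<open>A maximal inequality for discrete stochastic integrals\<close>

text \<open>
  Bounding the probability of an exceptional event outside of which \<open>P\<close> holds avoids having to prove
  that \<open>P\<close> is measurable.
\<close>

definition (in prob_space) mostly :: "real \<Rightarrow> ('a \<Rightarrow> bool) \<Rightarrow> bool"
  where "mostly e P \<longleftrightarrow> (\<exists>E\<in>events. prob E \<le> e \<and> (\<forall>\<omega>\<in>space M - E. P \<omega>))"

context prob_space
begin

lemma mostlyE:
  assumes "mostly e P"
  obtains E where "E \<in> events" "prob E \<le> e" "\<And>\<omega>. \<omega> \<in> space M \<Longrightarrow> \<omega> \<notin> E \<Longrightarrow> P \<omega>"
  using assms by (auto simp: mostly_def)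

lemma mostly_mono:
  assumes "mostly e P" "\<And>\<omega>. \<omega> \<in> space M \<Longrightarrow> P \<omega> \<Longrightarrow> Q \<omega>" "e \<le> e'"
  shows "mostly e' Q"
  using assms unfolding mostly_def by (meson DiffD1 order_trans)

lemma mostly_conj:
  assumes "mostly e P" "mostly e' Q"
  shows "mostly (e + e') (\<lambda>\<omega>. P \<omega> \<and> Q \<omega>)"
proof -
  obtain E where E: "E \<in> events" "prob E \<le> e" "\<And>\<omega>. \<omega> \<in> space M \<Longrightarrow> \<omega> \<notin> E \<Longrightarrow> P \<omega>"
    using mostlyE[OF assms(1)] by blast
  obtain E' where E': "E' \<in> events" "prob E' \<le> e'" "\<And>\<omega>. \<omega> \<in> space M \<Longrightarrow> \<omega> \<notin> E' \<Longrightarrow> Q \<omega>"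
    using mostlyE[OF assms(2)] by blast
  have "prob (E \<union> E') \<le> e + e'"
    using measure_Un_le[OF E(1) E'(1)] E(2) E'(2) by linarith
  then show ?thesis
    unfolding mostly_def using E E' by (intro bexI[of _ "E \<union> E'"]) auto
qed

lemma mostly_ball:
  assumes "finite I" "\<And>i. i \<in> I \<Longrightarrow> mostly e (P i)"
  shows "mostly (real (card I) * e) (\<lambda>\<omega>. \<forall>i\<in>I. P i \<omega>)"
  using assms
proof (induction I rule: finite_induct)
  case empty
  then show ?case by (auto simp: mostly_def intro!: bexI[of _ "{}"])
next
  case (insert i I)
  then have "mostly (e + real (card I) * e) (\<lambda>\<omega>. P i \<omega> \<and> (\<forall>i\<in>I. P i \<omega>))"
    by (intro mostly_conj) auto
  then show ?case
    using insert by (auto simp: algebra_simps)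
qed

lemma mostly_AE:
  assumes "AE \<omega> in M. P \<omega>" "0 \<le> e"
  shows "mostly e P"
proof -
  obtain N where "{\<omega>\<in>space M. \<not> P \<omega>} \<subseteq> N" "emeasure M N = 0" "N \<in> events"
    using AE_E[OF assms(1)] by auto
  then show ?thesis
    unfolding mostly_def using assms(2) by (intro bexI[of _ N]) (auto simp: measure_def)
qed

lemma mostly_event:
  assumes "{\<omega>\<in>space M. \<not> P \<omega>} \<in> events" "prob {\<omega>\<in>space M. \<not> P \<omega>} \<le> e"
  shows "mostly e P"
  unfolding mostly_def using assms by (intro bexI[of _ "{\<omega>\<in>space M. \<not> P \<omega>}"]) auto

text \<open>The events that \<open>P\<close> fails at some index from \<open>N\<close> on decrease
  to the empty set, so their probabilities tend to 0. An eventuality whose threshold depends on the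
  path thereby becomes one with a common threshold.\<close>

lemma mostly_eventually:
  fixes P :: "nat \<Rightarrow> 'a \<Rightarrow> bool"
  assumes meas: "\<And>N. {\<omega>\<in>space M. P N \<omega>} \<in> events"
    and ev: "\<And>\<omega>. \<omega> \<in> space M \<Longrightarrow> eventually (\<lambda>N. P N \<omega>) sequentially" and "0 < e"
  shows "eventually (\<lambda>N. mostly e (P N)) sequentially"
proof -
  define A where "A = (\<lambda>N. \<Union>n\<in>{N..}. space M - {\<omega>\<in>space M. P n \<omega>})"
  have Am: "A N \<in> events" for N
    unfolding A_def using meas by auto
  have "decseq A"
    unfolding A_def decseq_def by auto
  moreover have "(\<Inter>N. A N) = {}"
    using ev unfolding A_def eventually_sequentially by fastforce
  ultimately have "(\<lambda>N. prob (A N)) \<longlonglongrightarrow> 0"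
    using finite_Lim_measure_decseq[of A] Am by auto
  then have "eventually (\<lambda>N. prob (A N) < e) sequentially"
    using \<open>0 < e\<close> by (auto dest: order_tendstoD)
  then show ?thesis
  proof (rule eventually_mono)
    fix N assume "prob (A N) < e"
    then show "mostly e (P N)"
      unfolding mostly_def using Am[of N] by (intro bexI[of _ "A N"]) (auto simp: A_def)
  qed
qed

end

section \<open>Frobenius norm and measurability of matrix-vector products\<close>

lemma norm_sq_vec: "(norm (x :: real^'n::finite))\<^sup>2 = (\<Sum>i\<in>UNIV. (x $ i)\<^sup>2)"
  unfolding power2_norm_eq_inner by (simp add: inner_vec_def power2_eq_square)

lemma norm_sq_mat: "(norm (A :: real^'d::finite^'n::finite))\<^sup>2 = (\<Sum>i\<in>UNIV. \<Sum>j\<in>UNIV. (A $ i $ j)\<^sup>2)"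
  unfolding power2_norm_eq_inner by (simp add: inner_vec_def power2_eq_square)

lemma measurable_vec_nth_comp:
  "f \<in> borel_measurable N \<Longrightarrow> (\<lambda>x. (f x :: 'b::{second_countable_topology,real_normed_vector}^'n::finite) $ i) \<in> borel_measurable N"
  by (rule measurable_compose[where g="\<lambda>v. v $ i"])
    (auto intro!: borel_measurable_continuous_onI continuous_intros)

lemma measurable_norm_comp:
  "f \<in> borel_measurable N \<Longrightarrow> (\<lambda>x. norm (f x :: 'b::{second_countable_topology,real_normed_vector})) \<in> borel_measurable N"
  by measurable

lemma measurable_matrix_vector:
  fixes A :: "'w \<Rightarrow> real^'d::finite^'n::finite"
  assumes "A \<in> borel_measurable N" "v \<in> borel_measurable N"
  shows "(\<lambda>\<omega>. A \<omega> *v v \<omega>) \<in> borel_measurable N"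
proof -
  have "continuous_on UNIV (\<lambda>p::(real^'d^'n) \<times> (real^'d). fst p *v snd p)"
    unfolding matrix_vector_mult_def by (intro continuous_intros)
  then have "(\<lambda>\<omega>. fst (A \<omega>, v \<omega>) *v snd (A \<omega>, v \<omega>)) \<in> borel_measurable N"
    by (intro borel_measurable_continuous_on[where f="\<lambda>p. fst p *v snd p"] borel_measurable_Pair assms)
  then show ?thesis by simp
qed

context filtered_bm
begin

lemma has_integral_weighted_increment:
  assumes "0 \<le> s" "s < t" "q \<in> borel_measurable (F s)" "integrable M q"
  shows "has_bochner_integral M (\<lambda>\<omega>. q \<omega> * (W t \<omega> - W s \<omega>) $ i) 0"
    and "has_bochner_integral M (\<lambda>\<omega>. q \<omega> * ((W t \<omega> - W s \<omega>) $ i * (W t \<omega> - W s \<omega>) $ j))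
      ((if i = j then t - s else 0) * expectation q)"
  using increment_indep[OF assms, of "\<lambda>x. x $ i"] increment_indep[OF assms, of "\<lambda>x. x $ i * x $ j"]
    increment_coordinate[OF assms(1,2), of i] increment_covariance[OF assms(1,2), of i j]
  by (auto simp: has_bochner_integral_iff borel_measurable_continuous_onI continuous_intros)

text \<open>One step of the discrete Ito isometry. The cross term has mean 0 because the increment
  is centred and independent of what is known at time \<open>s\<close>; the covariance
  \<open>(t - s) I\<close> leaves the Frobenius norm of \<open>D\<close>.\<close>

lemma isometry_step:
  fixes S :: "'w \<Rightarrow> real^'n::finite" and D :: "'w \<Rightarrow> real^'d^'n"
  assumes st: "0 \<le> s" "s < t" and S: "S \<in> borel_measurable (F s)" "integrable M (\<lambda>\<omega>. (norm (S \<omega>))\<^sup>2)"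
    and D: "D \<in> borel_measurable (F s)" "\<And>\<omega>. \<omega> \<in> space M \<Longrightarrow> norm (D \<omega>) \<le> K"
  shows "has_bochner_integral M (\<lambda>\<omega>. (norm (S \<omega> + D \<omega> *v (W t \<omega> - W s \<omega>)))\<^sup>2)
      (expectation (\<lambda>\<omega>. (norm (S \<omega>))\<^sup>2) + (t - s) * expectation (\<lambda>\<omega>. (norm (D \<omega>))\<^sup>2))"
proof -
  define dW where "dW = (\<lambda>\<omega>. W t \<omega> - W s \<omega>)"
  have Sm: "(\<lambda>\<omega>. S \<omega> $ i) \<in> borel_measurable (F s)" for i
    using S(1) by (rule measurable_vec_nth_comp)
  have Dm: "(\<lambda>\<omega>. D \<omega> $ i $ j) \<in> borel_measurable (F s)" for i j
    by (intro measurable_vec_nth_comp D)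
  have Db: "\<bar>D \<omega> $ i $ j\<bar> \<le> K" if "\<omega> \<in> space M" for i j \<omega>
    using D(2)[OF that] Finite_Cartesian_Product.norm_nth_le[of "D \<omega>" i] Finite_Cartesian_Product.norm_nth_le[of "D \<omega> $ i" j]
    by simp
  note m = measurable_F_M[OF st(1)]
  \<comment> \<open>Square integrability gives integrability on a probability space, since a norm is
    at most 1 plus its square.\<close>
  have Si: "integrable M (\<lambda>\<omega>. S \<omega> $ i)" for i
  proof (rule Bochner_Integration.integrable_bound)
    show "integrable M (\<lambda>\<omega>. 1 + (norm (S \<omega>))\<^sup>2)" using S(2) by simp
    have "\<bar>x $ i\<bar> \<le> 1 + (norm x)\<^sup>2" for x :: "real^'n"
    proof -
      have "\<bar>x $ i\<bar> \<le> norm x" using Finite_Cartesian_Product.norm_nth_le[of x i] by simp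
      also have "\<dots> \<le> 1 + (norm x)\<^sup>2"
        using sum_squares_ge_zero[of "norm x - 1/2" 0] by (simp add: power2_eq_square algebra_simps)
      finally show ?thesis .
    qed
    then show "AE \<omega> in M. norm (S \<omega> $ i) \<le> norm (1 + (norm (S \<omega>))\<^sup>2)" by auto
  qed (use m[OF Sm] in auto)
  have bnd: "integrable M (\<lambda>\<omega>. f \<omega> * D \<omega> $ i $ j)" if "integrable M f" for f i j
  proof (rule Bochner_Integration.integrable_bound)
    show "integrable M (\<lambda>\<omega>. K * f \<omega>)" using that by simp
    show "AE \<omega> in M. norm (f \<omega> * D \<omega> $ i $ j) \<le> norm (K * f \<omega>)"
    proof (rule AE_I2)
      fix \<omega> assume "\<omega> \<in> space M"
      then have "\<bar>D \<omega> $ i $ j\<bar> * \<bar>f \<omega>\<bar> \<le> K * \<bar>f \<omega>\<bar>" "0 \<le> K"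
        using Db by (auto intro!: mult_right_mono intro: order_trans[OF abs_ge_zero Db])
      then show "norm (f \<omega> * D \<omega> $ i $ j) \<le> norm (K * f \<omega>)" by (simp add: abs_mult mult.commute)
    qed
  qed (use that m[OF Dm] in auto)
  have DDi: "integrable M (\<lambda>\<omega>. D \<omega> $ i $ j * D \<omega> $ i $ k)" for i j k
    using bnd[of "\<lambda>\<omega>. 1 * D \<omega> $ i $ j", OF bnd] by simp
  have eq: "(norm (S \<omega> + D \<omega> *v dW \<omega>))\<^sup>2 = (norm (S \<omega>))\<^sup>2
      + 2 * (\<Sum>i\<in>UNIV. \<Sum>j\<in>UNIV. (S \<omega> $ i * D \<omega> $ i $ j) * dW \<omega> $ j)
      + (\<Sum>i\<in>UNIV. \<Sum>j\<in>UNIV. \<Sum>k\<in>UNIV. (D \<omega> $ i $ j * D \<omega> $ i $ k) * (dW \<omega> $ j * dW \<omega> $ k))" for \<omega>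
  proof -
    have "((S \<omega> + D \<omega> *v dW \<omega>) $ i)\<^sup>2 = (S \<omega> $ i)\<^sup>2 + 2 * (\<Sum>j\<in>UNIV. (S \<omega> $ i * D \<omega> $ i $ j) * dW \<omega> $ j)
        + (\<Sum>j\<in>UNIV. \<Sum>k\<in>UNIV. (D \<omega> $ i $ j * D \<omega> $ i $ k) * (dW \<omega> $ j * dW \<omega> $ k))" for i
    proof -
      have "(\<Sum>j\<in>UNIV. D \<omega> $ i $ j * dW \<omega> $ j)\<^sup>2
          = (\<Sum>j\<in>UNIV. \<Sum>k\<in>UNIV. (D \<omega> $ i $ j * D \<omega> $ i $ k) * (dW \<omega> $ j * dW \<omega> $ k))"
        unfolding power2_eq_square sum_product by (intro sum.cong refl) (simp add: mult_ac)
      moreover have "S \<omega> $ i * (\<Sum>j\<in>UNIV. D \<omega> $ i $ j * dW \<omega> $ j) = (\<Sum>j\<in>UNIV. (S \<omega> $ i * D \<omega> $ i $ j) * dW \<omega> $ j)"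
        unfolding sum_distrib_left by (intro sum.cong refl) (simp add: mult_ac)
      ultimately show ?thesis
        by (simp add: matrix_vector_mult_def power2_sum)
    qed
    then show ?thesis
      by (simp only: norm_sq_vec sum.distrib sum_distrib_left)
  qed
  have 1: "has_bochner_integral M (\<lambda>\<omega>. 2 * (\<Sum>i\<in>UNIV. \<Sum>j\<in>UNIV. (S \<omega> $ i * D \<omega> $ i $ j) * dW \<omega> $ j))
      (2 * (\<Sum>i\<in>(UNIV::'n set). \<Sum>j\<in>(UNIV::'d set). 0))"
    unfolding dW_def
    by (intro has_bochner_integral_mult_right has_bochner_integral_sum has_integral_weighted_increment(1)[OF st] bnd Si borel_measurable_times Sm Dm)
  have 2: "has_bochner_integral M (\<lambda>\<omega>. \<Sum>i\<in>UNIV. \<Sum>j\<in>UNIV. \<Sum>k\<in>UNIV. (D \<omega> $ i $ j * D \<omega> $ i $ k) * (dW \<omega> $ j * dW \<omega> $ k))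
     (\<Sum>i\<in>(UNIV::'n set). \<Sum>j\<in>UNIV. \<Sum>k\<in>UNIV. (if j = k then t - s else 0) * expectation (\<lambda>\<omega>. D \<omega> $ i $ j * D \<omega> $ i $ k))"
    unfolding dW_def
    by (intro has_bochner_integral_sum has_integral_weighted_increment(2)[OF st] DDi borel_measurable_times Dm)
  \<comment> \<open>Only the diagonal \<open>j = k\<close> survives, which turns the triple sum into
    the sum of the squared entries of \<open>D\<close>.\<close>
  have 3: "(\<Sum>i\<in>(UNIV::'n set). \<Sum>j\<in>UNIV. \<Sum>k\<in>UNIV. (if j = k then t - s else 0) * expectation (\<lambda>\<omega>. D \<omega> $ i $ j * D \<omega> $ i $ k))
     = (t - s) * expectation (\<lambda>\<omega>. (norm (D \<omega>))\<^sup>2)"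
    unfolding norm_sq_mat
    by (subst Bochner_Integration.integral_sum; (subst Bochner_Integration.integral_sum)?)
      (auto simp: power2_eq_square DDi sum_distrib_left if_distrib[where f="\<lambda>x. x * _"] sum.delta' cong: if_cong
        intro!: Bochner_Integration.integrable_sum)
  have "has_bochner_integral M (\<lambda>\<omega>. (norm (S \<omega>))\<^sup>2) (expectation (\<lambda>\<omega>. (norm (S \<omega>))\<^sup>2))"
    using S(2) by (simp add: has_bochner_integral_iff)
  from has_bochner_integral_add[OF has_bochner_integral_add[OF this 1] 2[unfolded 3]]
  show ?thesis unfolding eq[unfolded dW_def] dW_def by simp
qed

text \<open>A discrete form of Lenglart's inequality. The energy bound sits inside the event, so
  unbounded coefficients are covered and integrands that are close in probability suffice.\<close>

lemma discrete_maximal: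
  fixes D :: "nat \<Rightarrow> 'w \<Rightarrow> real^'d^'n::finite"
  assumes rho: "0 \<le> \<rho> 0" "\<And>j. j < r \<Longrightarrow> \<rho> j < \<rho> (Suc j)"
    and D: "\<And>j. j < r \<Longrightarrow> D j \<in> borel_measurable (F (\<rho> j))" and pos: "0 < \<epsilon>" "0 \<le> \<delta>"
  defines "S \<equiv> \<lambda>i \<omega>. \<Sum>j<i. D j \<omega> *v (W (\<rho> (Suc j)) \<omega> - W (\<rho> j) \<omega>)"
    and "V \<equiv> \<lambda>i \<omega>. \<Sum>j<i. (\<rho> (Suc j) - \<rho> j) * (norm (D j \<omega>))\<^sup>2"
  shows "mostly (\<delta> / \<epsilon>\<^sup>2) (\<lambda>\<omega>. V r \<omega> \<le> \<delta> \<longrightarrow> (\<forall>i\<le>r. norm (S i \<omega>) \<le> \<epsilon>))"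
proof -
  have rho_mono: "i \<le> r \<Longrightarrow> j \<le> i \<Longrightarrow> \<rho> j \<le> \<rho> i" for i j
  proof (induction i)
    case (Suc i)
    then show ?case using rho(2)[of i] by (cases "j = Suc i") (auto simp: not_less_eq_eq[symmetric] intro: order_trans)
  qed simp
  have rho_nn: "i \<le> r \<Longrightarrow> 0 \<le> \<rho> i" for i
    using rho_mono[of i 0] rho(1) by simp
  have Dm: "D j \<in> borel_measurable (F (\<rho> i))" if "j < r" "j \<le> i" "i \<le> r" for i j
    using measurable_F_mono[OF rho_nn rho_mono D] that by auto
  have Wm: "W (\<rho> j) \<in> borel_measurable (F (\<rho> i))" if "j \<le> i" "i \<le> r" for i j
    using measurable_F_mono[OF rho_nn rho_mono W_adapted[OF rho_nn]] that by auto
  have Sm: "S j \<in> borel_measurable (F (\<rho> i))" if "j \<le> i" "i \<le> r" for i j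
    unfolding S_def using that
    by (intro borel_measurable_sum measurable_matrix_vector borel_measurable_diff Dm Wm) auto
  have Vm: "V j \<in> borel_measurable (F (\<rho> i))" if "j \<le> Suc i" "i < r" for i j
    unfolding V_def using that
    by (intro borel_measurable_sum borel_measurable_times borel_measurable_power borel_measurable_const measurable_norm_comp Dm) auto
  \<comment> \<open>Freezing the sum once it exceeds \<open>\<epsilon>\<close> or its energy exceeds \<open>\<delta>\<close> reduces the maximal inequality
    to Chebyshev's inequality for the final value of the frozen sum.\<close>
  define ok where "ok = (\<lambda>j \<omega>. \<forall>i\<le>j. norm (S i \<omega>) \<le> \<epsilon> \<and> V (Suc i) \<omega> \<le> \<delta>)"
  define D' where "D' = (\<lambda>j \<omega>. if ok j \<omega> then D j \<omega> else 0)"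
  define S' where "S' = (\<lambda>i \<omega>. \<Sum>j<i. D' j \<omega> *v (W (\<rho> (Suc j)) \<omega> - W (\<rho> j) \<omega>))"
  \<comment> \<open>The energy is predictable: \<open>V (Suc i)\<close> includes the step that
    starts at \<open>\<rho> i\<close>, yet is known at that time since \<open>D i\<close> is. So the
    sum is frozen before the bound \<open>\<delta>\<close> is passed, not after.\<close>
  have okm: "Measurable.pred (F (\<rho> j)) (ok j)" if "j < r" for j
  proof -
    have "Measurable.pred (F (\<rho> j)) (\<lambda>\<omega>. norm (S i \<omega>) \<le> \<epsilon> \<and> V (Suc i) \<omega> \<le> \<delta>)" if "i \<in> {..j}" for i
    proof -
      have [measurable]: "S i \<in> borel_measurable (F (\<rho> j))" "V (Suc i) \<in> borel_measurable (F (\<rho> j))"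
        using that \<open>j < r\<close> by (auto intro!: Sm Vm)
      show ?thesis by (intro pred_intros_logic borel_measurable_le[unfolded pred_def[symmetric]]; measurable)
    qed
    then have "Measurable.pred (F (\<rho> j)) (\<lambda>\<omega>. \<forall>i\<in>{..j}. norm (S i \<omega>) \<le> \<epsilon> \<and> V (Suc i) \<omega> \<le> \<delta>)"
      by (intro pred_intros_finite(3)) simp_all
    moreover have "(\<lambda>\<omega>. \<forall>i\<in>{..j}. norm (S i \<omega>) \<le> \<epsilon> \<and> V (Suc i) \<omega> \<le> \<delta>) = ok j"
      unfolding ok_def by (intro ext) (simp add: Ball_def)
    ultimately show ?thesis by (simp only:)
  qed
  have D'm: "D' j \<in> borel_measurable (F (\<rho> i))" if "j < r" "j \<le> i" "i \<le> r" for i j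
  proof -
    have "D' j \<in> borel_measurable (F (\<rho> j))"
      unfolding D'_def using okm[OF that(1)] D[OF that(1)]
      by (intro measurable_If borel_measurable_const) (simp_all only: pred_def)
    then show ?thesis using measurable_F_mono[OF rho_nn rho_mono] that by auto
  qed
  have S'm: "S' i \<in> borel_measurable (F (\<rho> i))" if "i \<le> r" for i
    unfolding S'_def using that
    by (intro borel_measurable_sum measurable_matrix_vector borel_measurable_diff D'm Wm) auto
  have V_mono: "i \<le> r \<Longrightarrow> j \<le> i \<Longrightarrow> V j \<omega> \<le> V i \<omega>" for i j \<omega>
  proof -
    assume ij: "i \<le> r" "j \<le> i"
    have "0 \<le> (\<rho> (Suc k) - \<rho> k) * (norm (D k \<omega>))\<^sup>2" if "k < r" for k
      using rho(2)[OF that] by simp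
    then show "V j \<omega> \<le> V i \<omega>"
      unfolding V_def using ij by (intro sum_mono2) auto
  qed
  \<comment> \<open>A step that is not frozen has energy at most \<open>\<delta>\<close>, which
    bounds its coefficient; \<open>isometry_step\<close> wants bounded coefficients.\<close>
  have D'b: "norm (D' j \<omega>) \<le> sqrt (\<delta> / (\<rho> (Suc j) - \<rho> j))" if "j < r" for j \<omega>
  proof (cases "ok j \<omega>")
    case True
    have "(\<rho> (Suc j) - \<rho> j) * (norm (D j \<omega>))\<^sup>2 \<le> V (Suc j) \<omega>"
      using V_mono[of j 0 \<omega>] that by (simp add: V_def)
    also have "\<dots> \<le> \<delta>" using True by (auto simp: ok_def)
    finally have "(norm (D j \<omega>))\<^sup>2 \<le> \<delta> / (\<rho> (Suc j) - \<rho> j)"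
      using rho(2)[OF that] by (simp add: field_simps)
    then show ?thesis using True by (simp add: D'_def real_le_rsqrt)
  next
    case False
    then show ?thesis using pos rho(2)[OF that] by (simp add: D'_def)
  qed
  \<comment> \<open>If step \<open>i\<close> is not frozen, none before it was, and the sum equals
    \<open>V (Suc i)\<close>; otherwise the last term is 0.\<close>
  have energy: "(\<Sum>j<i. (\<rho> (Suc j) - \<rho> j) * (norm (D' j \<omega>))\<^sup>2) \<le> \<delta>" if "i \<le> r" for i \<omega>
    using that
  proof (induction i)
    case (Suc i)
    show ?case
    proof (cases "ok i \<omega>")
      case True
      then have "D' j \<omega> = D j \<omega>" if "j \<le> i" for j
        using that by (auto simp: D'_def ok_def)
      then have "(\<Sum>j<Suc i. (\<rho> (Suc j) - \<rho> j) * (norm (D' j \<omega>))\<^sup>2) = V (Suc i) \<omega>"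
        unfolding V_def by (intro sum.cong) auto
      then show ?thesis using True by (auto simp: ok_def)
    qed (use Suc in \<open>auto simp: D'_def\<close>)
  qed (use pos in auto)
  have D'i: "integrable M (\<lambda>\<omega>. (norm (D' j \<omega>))\<^sup>2)" if "j < r" for j
  proof (rule integrable_const_bound)
    show "AE \<omega> in M. norm ((norm (D' j \<omega>))\<^sup>2) \<le> (sqrt (\<delta> / (\<rho> (Suc j) - \<rho> j)))\<^sup>2"
      using D'b[OF that] by (auto intro!: power_mono)
    show "(\<lambda>\<omega>. (norm (D' j \<omega>))\<^sup>2) \<in> borel_measurable M"
      using measurable_F_M[OF rho_nn D'm[of j j]] that by auto
  qed
  have S'i: "integrable M (\<lambda>\<omega>. (norm (S' i \<omega>))\<^sup>2) \<and>
      expectation (\<lambda>\<omega>. (norm (S' i \<omega>))\<^sup>2) = (\<Sum>j<i. (\<rho> (Suc j) - \<rho> j) * expectation (\<lambda>\<omega>. (norm (D' j \<omega>))\<^sup>2))" if "i \<le> r" for i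
    using that
  proof (induction i)
    case 0
    then show ?case by (simp add: S'_def)
  next
    case (Suc i)
    have "has_bochner_integral M (\<lambda>\<omega>. (norm (S' i \<omega> + D' i \<omega> *v (W (\<rho> (Suc i)) \<omega> - W (\<rho> i) \<omega>)))\<^sup>2)
      (expectation (\<lambda>\<omega>. (norm (S' i \<omega>))\<^sup>2) + (\<rho> (Suc i) - \<rho> i) * expectation (\<lambda>\<omega>. (norm (D' i \<omega>))\<^sup>2))"
      using Suc by (intro isometry_step[where K="sqrt (\<delta> / (\<rho> (Suc i) - \<rho> i))"] rho_nn rho(2) S'm D'm D'b) auto
    then show ?case using Suc by (simp add: has_bochner_integral_iff S'_def)
  qed
  have "expectation (\<lambda>\<omega>. (norm (S' r \<omega>))\<^sup>2) = expectation (\<lambda>\<omega>. \<Sum>j<r. (\<rho> (Suc j) - \<rho> j) * (norm (D' j \<omega>))\<^sup>2)"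
    using S'i[of r] D'i by (subst Bochner_Integration.integral_sum) auto
  also have "\<dots> \<le> expectation (\<lambda>\<omega>. \<delta>)"
    using D'i energy[of r] by (intro integral_mono) auto
  finally have E: "expectation (\<lambda>\<omega>. (norm (S' r \<omega>))\<^sup>2) \<le> \<delta>" by (simp add: prob_space)
  have "prob {\<omega>\<in>space M. (norm (S' r \<omega>))\<^sup>2 \<ge> \<epsilon>\<^sup>2} \<le> expectation (\<lambda>\<omega>. (norm (S' r \<omega>))\<^sup>2) / \<epsilon>\<^sup>2"
    using S'i[of r] pos by (intro integral_Markov_inequality_measure[where A="space M" and u="\<lambda>\<omega>. (norm (S' r \<omega>))\<^sup>2"]) auto
  also have "\<dots> \<le> \<delta> / \<epsilon>\<^sup>2" using E pos by (simp add: divide_right_mono)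
  finally have P: "prob {\<omega>\<in>space M. (norm (S' r \<omega>))\<^sup>2 \<ge> \<epsilon>\<^sup>2} \<le> \<delta> / \<epsilon>\<^sup>2" .
  have mS: "S' r \<in> borel_measurable M"
    using measurable_F_M[OF rho_nn S'm] by auto
  have ev: "{\<omega>\<in>space M. (norm (S' r \<omega>))\<^sup>2 \<ge> \<epsilon>\<^sup>2} \<in> events"
    using mS by measurable
  \<comment> \<open>Let \<open>k\<close> be the first index at which the sum exceeds
    \<open>\<epsilon>\<close>. While the energy is within its bound, freezing starts exactly at
    \<open>k\<close>, so the final frozen value is \<open>S k\<close>, whose norm still exceeds
    \<open>\<epsilon>\<close>.\<close>
  have "norm (S i \<omega>) \<le> \<epsilon>" if w: "(norm (S' r \<omega>))\<^sup>2 < \<epsilon>\<^sup>2" "V r \<omega> \<le> \<delta>" "i \<le> r" for i \<omega>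
  proof (rule ccontr)
    assume "\<not> norm (S i \<omega>) \<le> \<epsilon>"
    define k where "k = (LEAST k. \<not> norm (S k \<omega>) \<le> \<epsilon>)"
    have k: "\<not> norm (S k \<omega>) \<le> \<epsilon>" "k \<le> r" "\<And>j. j < k \<Longrightarrow> norm (S j \<omega>) \<le> \<epsilon>"
    proof -
      note ex = \<open>\<not> norm (S i \<omega>) \<le> \<epsilon>\<close>
      show "\<not> norm (S k \<omega>) \<le> \<epsilon>"
        unfolding k_def by (rule LeastI[of "\<lambda>k. \<not> norm (S k \<omega>) \<le> \<epsilon>", OF ex])
      show "k \<le> r"
        unfolding k_def using Least_le[of "\<lambda>k. \<not> norm (S k \<omega>) \<le> \<epsilon>", OF ex] w(3) by linarith
      show "norm (S j \<omega>) \<le> \<epsilon>" if "j < k" for j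
        using not_less_Least[of j "\<lambda>k. \<not> norm (S k \<omega>) \<le> \<epsilon>"] that unfolding k_def by blast
    qed
    have ok: "ok j \<omega> \<longleftrightarrow> j < k" if "j < r" for j
    proof
      assume "j < k"
      show "ok j \<omega>" unfolding ok_def
      proof (intro allI impI conjI)
        fix i assume "i \<le> j"
        then show "norm (S i \<omega>) \<le> \<epsilon>" using k(3)[of i] \<open>j < k\<close> by simp
        have "V (Suc i) \<omega> \<le> V r \<omega>"
          using V_mono[of r "Suc i" \<omega>] \<open>i \<le> j\<close> \<open>j < r\<close> by simp
        then show "V (Suc i) \<omega> \<le> \<delta>" using w(2) by linarith
      qed
    next
      assume "ok j \<omega>"
      then show "j < k" using k(1) unfolding ok_def by (meson not_le)
    qed
    have "S' r \<omega> = (\<Sum>j<r. if j < k then D j \<omega> *v (W (\<rho> (Suc j)) \<omega> - W (\<rho> j) \<omega>) else 0)"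
      unfolding S'_def D'_def by (intro sum.cong) (auto simp: ok)
    also have "\<dots> = S k \<omega>"
      proof -
      have "{..<r} \<inter> {j. j < k} = {..<k}" using k(2) by auto
      then show ?thesis unfolding S_def by (simp add: sum.If_cases)
    qed
    finally have "\<epsilon> < norm (S' r \<omega>)" using k(1) by simp
    then have "\<epsilon>\<^sup>2 < (norm (S' r \<omega>))\<^sup>2" using pos by (intro power_strict_mono) auto
    then show False using w(1) by simp
  qed
  then show ?thesis
    unfolding mostly_def using P ev by (intro bexI[OF _ ev]) (auto simp: not_le)
qed

end

section \<open>Simple processes on a common refinement\<close>

lemma grid_strict:
  fixes \<rho> :: "nat \<Rightarrow> real"
  assumes "\<And>j. j < r \<Longrightarrow> \<rho> j < \<rho> (Suc j)" "i < j" "j \<le> r"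
  shows "\<rho> i < \<rho> j"
  using assms(2,3)
proof (induction j)
  case (Suc j)
  then show ?case using assms(1)[of j] by (cases "i = j") auto
qed simp

lemma grid_le_iff:
  fixes \<rho> :: "nat \<Rightarrow> real"
  assumes "\<And>j. j < r \<Longrightarrow> \<rho> j < \<rho> (Suc j)" "i \<le> r" "j \<le> r"
  shows "\<rho> i \<le> \<rho> j \<longleftrightarrow> i \<le> j" "\<rho> i < \<rho> j \<longleftrightarrow> i < j"
proof -
  note st = grid_strict[of r \<rho>, OF assms(1)]
  consider "i < j" | "i = j" | "j < i" by linarith
  then have "(\<rho> i \<le> \<rho> j \<longleftrightarrow> i \<le> j) \<and> (\<rho> i < \<rho> j \<longleftrightarrow> i < j)"
    using st[of i j] st[of j i] assms by cases auto
  then show "\<rho> i \<le> \<rho> j \<longleftrightarrow> i \<le> j" "\<rho> i < \<rho> j \<longleftrightarrow> i < j" by auto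
qed

lemma grid_exists:
  fixes P :: "real set"
  assumes "finite P" "P \<noteq> {}"
  obtains \<rho> r where "\<rho> ` {..r} = P" "\<And>j::nat. j < r \<Longrightarrow> \<rho> j < \<rho> (Suc j)"
proof -
  define xs where "xs = sorted_list_of_set P"
  have xs: "set xs = P" "sorted_wrt (<) xs" "xs \<noteq> []"
    using assms by (auto simp: xs_def)
  then have l: "0 < length xs" by auto
  then have "{..length xs - 1} = {..<length xs}" by (cases xs) auto
  then have "(\<lambda>i. xs ! i) ` {..length xs - 1} = P"
    using xs(1) l by (auto simp: set_conv_nth)
  moreover have "xs ! j < xs ! Suc j" if "j < length xs - 1" for j
    using sorted_wrt_nth_less[OF xs(2), of j "Suc j"] that by auto
  ultimately show ?thesis by (rule that)
qed

text \<open>No grid point lies inside a cell, so the order between a point of a cell and a grid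
  point depends on indices alone. Cells are open on the left, as are the intervals of a simple
  process.\<close>

lemma grid_cell:
  fixes \<rho> :: "nat \<Rightarrow> real"
  assumes gr: "\<And>j. j < r \<Longrightarrow> \<rho> j < \<rho> (Suc j)" and "p \<le> r" "j < r" "\<rho> j < s" "s \<le> \<rho> (Suc j)"
  shows "\<rho> p < s \<longleftrightarrow> p \<le> j" "s \<le> \<rho> p \<longleftrightarrow> j < p"
proof -
  have 1: "p \<le> j \<Longrightarrow> \<rho> p < s"
    using grid_le_iff(1)[of r \<rho> p j, OF gr] assms by auto
  have 2: "j < p \<Longrightarrow> s \<le> \<rho> p"
    using grid_le_iff(1)[of r \<rho> "Suc j" p, OF gr] assms by auto
  show "\<rho> p < s \<longleftrightarrow> p \<le> j" "s \<le> \<rho> p \<longleftrightarrow> j < p"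
    using 1 2 by force+
qed

text \<open>An interval between grid points, cut off at a third one, is a union of cells, and the
  increments over the cells telescope. The right endpoint of a cell decides whether the cell lies in
  the interval, because intervals are open on the left.\<close>

lemma grid_telescope:
  fixes \<rho> :: "nat \<Rightarrow> real" and w :: "real \<Rightarrow> 'b::real_vector"
  assumes gr: "\<And>j. j < r \<Longrightarrow> \<rho> j < \<rho> (Suc j)" and pq: "p \<le> q" "q \<le> r" and "i \<le> r"
  shows "w (min (\<rho> q) (\<rho> i)) - w (min (\<rho> p) (\<rho> i)) =
    (\<Sum>j<i. indicator {\<rho> p<..\<rho> q} (\<rho> (Suc j)) *\<^sub>R (w (\<rho> (Suc j)) - w (\<rho> j)))"
  using \<open>i \<le> r\<close>
proof (induction i)
  case 0
  have "\<rho> 0 \<le> \<rho> p" "\<rho> 0 \<le> \<rho> q" using grid_le_iff(1)[of r \<rho> 0, OF gr] pq by auto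
  then show ?case by (simp add: min_absorb2)
next
  case (Suc i)
  have le: "\<rho> a \<le> \<rho> b \<longleftrightarrow> a \<le> b" if "a \<le> r" "b \<le> r" for a b
    using grid_le_iff(1)[of r \<rho> a b, OF gr] that by simp
  have mn: "min (\<rho> a) (\<rho> b) = \<rho> (min a b)" if "a \<le> r" "b \<le> r" for a b
    using le[OF that] by (simp add: min_def)
  have ind: "indicator {\<rho> p<..\<rho> q} (\<rho> (Suc i)) = (if p \<le> i \<and> i < q then 1 else (0::real))"
    using grid_cell[of r \<rho> p i "\<rho> (Suc i)", OF gr] grid_cell[of r \<rho> q i "\<rho> (Suc i)", OF gr] Suc.prems pq gr[of i]
    by (auto simp: indicator_def)
  consider "i < p" | "p \<le> i" "i < q" | "q \<le> i" using pq by linarith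
  then have "w (\<rho> (min q (Suc i))) - w (\<rho> (min p (Suc i))) =
     w (\<rho> (min q i)) - w (\<rho> (min p i)) + indicator {\<rho> p<..\<rho> q} (\<rho> (Suc i)) *\<^sub>R (w (\<rho> (Suc i)) - w (\<rho> i))"
    unfolding ind using pq by cases (auto simp: min_def le_Suc_eq)
  then show ?case
    using Suc pq by (simp add: mn)
qed

section \<open>The random squared distance between integrands\<close>

definition sq_dist :: "real \<Rightarrow> (real \<Rightarrow> 'w \<Rightarrow> 'b::real_normed_vector) \<Rightarrow> (real \<Rightarrow> 'w \<Rightarrow> 'b) \<Rightarrow> 'w \<Rightarrow> ennreal"
  where "sq_dist t A B \<omega> = (\<integral>\<^sup>+s\<in>{0..t}. ennreal ((norm (A s \<omega> - B s \<omega>))\<^sup>2) \<partial>lborel)"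

text \<open>With \<open>F t\<close> in place of \<open>M\<close> this is the condition that
  \<open>progressively_measurable\<close> imposes at time \<open>t\<close>; both choices occur
  below.\<close>

definition jointly_measurable :: "'w measure \<Rightarrow> real \<Rightarrow> (real \<Rightarrow> 'w \<Rightarrow> 'b::topological_space) \<Rightarrow> bool"
  where "jointly_measurable M t A \<longleftrightarrow> (\<lambda>(s, \<omega>). A s \<omega>) \<in> borel_measurable (restrict_space borel {0..t} \<Otimes>\<^sub>M M)"

lemma sq_dist_measurable:
  fixes A B :: "real \<Rightarrow> 'w \<Rightarrow> 'b::{real_normed_vector, second_countable_topology}"
  assumes "jointly_measurable M t A" "jointly_measurable M t B"
  shows "sq_dist t A B \<in> borel_measurable M"
proof -
  define R where "R = restrict_space lborel {0..t}"
  interpret R: sigma_finite_measure R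
    unfolding R_def by (intro sigma_finite_measure_restrict_space) (auto intro: sigma_finite_lborel)
  have sR: "sets R = sets (restrict_space borel {0..t})"
    unfolding R_def by (intro sets_restrict_space_cong) simp
  have [measurable]: "(\<lambda>p. A (fst p) (snd p)) \<in> borel_measurable (R \<Otimes>\<^sub>M M)"
    "(\<lambda>p. B (fst p) (snd p)) \<in> borel_measurable (R \<Otimes>\<^sub>M M)"
    using assms unfolding jointly_measurable_def
    by (simp_all add: case_prod_beta' cong: measurable_cong_sets sets_pair_measure_cong[OF sR refl])
  have "(\<lambda>p. ennreal ((norm (A (fst p) (snd p) - B (fst p) (snd p)))\<^sup>2)) \<in> borel_measurable (R \<Otimes>\<^sub>M M)"
    by measurable
  from measurable_compose[OF measurable_pair_swap' this]
  have "(\<lambda>p. ennreal ((norm (A (snd p) (fst p) - B (snd p) (fst p)))\<^sup>2)) \<in> borel_measurable (M \<Otimes>\<^sub>M R)"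
    by (simp add: case_prod_beta')
  from R.borel_measurable_nn_integral_fst[OF this]
  show ?thesis
    by (simp add: sq_dist_def[abs_def] R_def nn_integral_restrict_space)
qed

lemma jointly_measurable_section:
  fixes A :: "real \<Rightarrow> 'w \<Rightarrow> 'b::{real_normed_vector, second_countable_topology}"
  assumes "jointly_measurable N t A" "\<omega> \<in> space N"
  shows "(\<lambda>s. indicator {0..t} s *\<^sub>R A s \<omega>) \<in> borel_measurable borel"
  using measurable_Pair2'[OF assms(2), THEN measurable_compose, OF assms(1)[unfolded jointly_measurable_def]]
  by (subst borel_measurable_restrict_space_iff[symmetric]) auto

lemma sq_dist_triangle:
  fixes A B H :: "real \<Rightarrow> 'w \<Rightarrow> 'b::{real_normed_vector, second_countable_topology}"
  assumes jm: "jointly_measurable M t A" "jointly_measurable M t B" "jointly_measurable M t H" and w: "\<omega> \<in> space M"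
  shows "sq_dist t A B \<omega> \<le> 2 * sq_dist t A H \<omega> + 2 * sq_dist t B H \<omega>"
proof -
  have m: "(\<lambda>s. ennreal ((norm (C s \<omega> - D s \<omega>))\<^sup>2) * indicator {0..t} s) \<in> borel_measurable lborel"
    if "jointly_measurable M t C" "jointly_measurable M t D" for C D :: "real \<Rightarrow> 'w \<Rightarrow> 'b"
  proof -
    note [measurable] = jointly_measurable_section[OF that(1) w] jointly_measurable_section[OF that(2) w]
    have "(\<lambda>s. ennreal ((norm (indicator {0..t} s *\<^sub>R C s \<omega> - indicator {0..t} s *\<^sub>R D s \<omega>))\<^sup>2)) \<in> borel_measurable lborel"
      by measurable
    also have "(\<lambda>s. ennreal ((norm (indicator {0..t} s *\<^sub>R C s \<omega> - indicator {0..t} s *\<^sub>R D s \<omega>))\<^sup>2))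
        = (\<lambda>s. ennreal ((norm (C s \<omega> - D s \<omega>))\<^sup>2) * indicator {0..t} s)"
      by (auto simp: indicator_def)
    finally show ?thesis .
  qed
  have "sq_dist t A B \<omega> \<le> (\<integral>\<^sup>+s. 2 * (ennreal ((norm (A s \<omega> - H s \<omega>))\<^sup>2) * indicator {0..t} s)
      + 2 * (ennreal ((norm (B s \<omega> - H s \<omega>))\<^sup>2) * indicator {0..t} s) \<partial>lborel)"
    unfolding sq_dist_def
  proof (intro nn_integral_mono)
    fix s
    have "(norm (A s \<omega> - B s \<omega>))\<^sup>2 \<le> (norm (A s \<omega> - H s \<omega>) + norm (B s \<omega> - H s \<omega>))\<^sup>2"
      using norm_triangle_ineq4[of "A s \<omega> - H s \<omega>" "B s \<omega> - H s \<omega>"] by (intro power_mono) auto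
    also have "\<dots> \<le> 2 * (norm (A s \<omega> - H s \<omega>))\<^sup>2 + 2 * (norm (B s \<omega> - H s \<omega>))\<^sup>2"
      using sum_squares_bound[of "norm (A s \<omega> - H s \<omega>)" "norm (B s \<omega> - H s \<omega>)"] by (simp add: power2_sum)
    finally have "ennreal ((norm (A s \<omega> - B s \<omega>))\<^sup>2) \<le> 2 * ennreal ((norm (A s \<omega> - H s \<omega>))\<^sup>2) + 2 * ennreal ((norm (B s \<omega> - H s \<omega>))\<^sup>2)"
      by (subst (asm) ennreal_le_iff[symmetric]) (simp_all add: ennreal_plus ennreal_mult')
    then show "ennreal ((norm (A s \<omega> - B s \<omega>))\<^sup>2) * indicator {0..t} s \<le>
       2 * (ennreal ((norm (A s \<omega> - H s \<omega>))\<^sup>2) * indicator {0..t} s) + 2 * (ennreal ((norm (B s \<omega> - H s \<omega>))\<^sup>2) * indicator {0..t} s)"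
      by (auto simp: indicator_def)
  qed
  also have "\<dots> = 2 * sq_dist t A H \<omega> + 2 * sq_dist t B H \<omega>"
    unfolding sq_dist_def using m[OF jm(1,3)] m[OF jm(2,3)]
    by (subst nn_integral_add) (simp_all add: nn_integral_cmult)
  finally show ?thesis .
qed

lemma sq_dist_triangle_bound:
  fixes A B H :: "real \<Rightarrow> 'w \<Rightarrow> 'b::{real_normed_vector, second_countable_topology}"
  assumes "jointly_measurable M t A" "jointly_measurable M t B" "jointly_measurable M t H" "\<omega> \<in> space M"
    and "sq_dist t A H \<omega> \<le> ennreal a" "sq_dist t B H \<omega> \<le> ennreal b" "0 \<le> a" "0 \<le> b"
  shows "sq_dist t A B \<omega> \<le> ennreal (2 * a + 2 * b)"
proof -
  have "sq_dist t A B \<omega> \<le> 2 * sq_dist t A H \<omega> + 2 * sq_dist t B H \<omega>"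
    by (rule sq_dist_triangle[OF assms(1-4)])
  also have "\<dots> \<le> 2 * ennreal a + 2 * ennreal b"
    using assms by (intro add_mono mult_left_mono) auto
  also have "\<dots> = ennreal (2 * a + 2 * b)"
    using assms by (simp add: ennreal_plus ennreal_mult')
  finally show ?thesis .
qed

lemma sq_dist_mono: "t \<le> t' \<Longrightarrow> sq_dist t A B \<omega> \<le> sq_dist t' A B \<omega>"
  unfolding sq_dist_def by (intro nn_integral_mono) (auto simp: indicator_def)

lemma sum_matrix_vector_mult: "(\<Sum>k\<in>K. B k) *v x = (\<Sum>k\<in>K. B k *v x)" for x :: "real^'d::finite" and B :: "'k \<Rightarrow> real^'d^'n::finite"
  by (induction K rule: infinite_finite_induct) (simp_all add: matrix_vector_mult_add_rdistrib)

text \<open>For a process that is constant on cells, the time integral over the union of the cells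
  equals the discrete energy. This turns a bound on \<open>sq_dist\<close> into the energy condition
  of \<open>discrete_maximal\<close>.\<close>

lemma step_energy_le:
  fixes D :: "real \<Rightarrow> 'b::real_normed_vector"
  assumes gr: "\<And>j. j < r \<Longrightarrow> \<rho> j < \<rho> (Suc j)" and "0 \<le> \<rho> 0" "\<rho> r \<le> T"
    and D: "\<And>j s. j < r \<Longrightarrow> \<rho> j < s \<Longrightarrow> s \<le> \<rho> (Suc j) \<Longrightarrow> D s = D (\<rho> (Suc j))"
  shows "ennreal (\<Sum>j<r. (\<rho> (Suc j) - \<rho> j) * (norm (D (\<rho> (Suc j))))\<^sup>2) \<le> (\<integral>\<^sup>+s\<in>{0..T}. ennreal ((norm (D s))\<^sup>2) \<partial>lborel)"
proof -
  have "ennreal (\<Sum>j<r. (\<rho> (Suc j) - \<rho> j) * (norm (D (\<rho> (Suc j))))\<^sup>2)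
    = (\<Sum>j<r. \<integral>\<^sup>+s. ennreal ((norm (D (\<rho> (Suc j))))\<^sup>2) * indicator {\<rho> j<..\<rho> (Suc j)} s \<partial>lborel)"
  proof -
    have "(\<integral>\<^sup>+s. ennreal ((norm (D (\<rho> (Suc j))))\<^sup>2) * indicator {\<rho> j<..\<rho> (Suc j)} s \<partial>lborel)
        = ennreal ((\<rho> (Suc j) - \<rho> j) * (norm (D (\<rho> (Suc j))))\<^sup>2)" if "j < r" for j
    proof -
      have "(\<integral>\<^sup>+s. ennreal ((norm (D (\<rho> (Suc j))))\<^sup>2) * indicator {\<rho> j<..\<rho> (Suc j)} s \<partial>lborel)
          = ennreal ((norm (D (\<rho> (Suc j))))\<^sup>2) * ennreal (\<rho> (Suc j) - \<rho> j)"
        using gr[OF that] by (subst nn_integral_cmult_indicator) simp_all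
      then show ?thesis
        using gr[OF that] by (simp add: ennreal_mult' mult.commute)
    qed
    then have "(\<Sum>j<r. \<integral>\<^sup>+s. ennreal ((norm (D (\<rho> (Suc j))))\<^sup>2) * indicator {\<rho> j<..\<rho> (Suc j)} s \<partial>lborel)
        = (\<Sum>j<r. ennreal ((\<rho> (Suc j) - \<rho> j) * (norm (D (\<rho> (Suc j))))\<^sup>2))"
      by (intro sum.cong) auto
    also have "\<dots> = ennreal (\<Sum>j<r. (\<rho> (Suc j) - \<rho> j) * (norm (D (\<rho> (Suc j))))\<^sup>2)"
    proof (intro sum_ennreal mult_nonneg_nonneg zero_le_power2)
      show "0 \<le> \<rho> (Suc j) - \<rho> j" if "j \<in> {..<r}" for j using gr[of j] that by simp
    qed
    finally show ?thesis ..
  qed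
  also have "\<dots> = (\<integral>\<^sup>+s. (\<Sum>j<r. ennreal ((norm (D (\<rho> (Suc j))))\<^sup>2) * indicator {\<rho> j<..\<rho> (Suc j)} s) \<partial>lborel)"
    by (subst nn_integral_sum) auto
  also have "\<dots> \<le> (\<integral>\<^sup>+s\<in>{0..T}. ennreal ((norm (D s))\<^sup>2) \<partial>lborel)"
  proof (intro nn_integral_mono)
    fix s
    show "(\<Sum>j<r. ennreal ((norm (D (\<rho> (Suc j))))\<^sup>2) * indicator {\<rho> j<..\<rho> (Suc j)} s) \<le> ennreal ((norm (D s))\<^sup>2) * indicator {0..T} s"
    proof (cases "\<exists>j<r. s \<in> {\<rho> j<..\<rho> (Suc j)}")
      case True
      then obtain j where j: "j < r" "\<rho> j < s" "s \<le> \<rho> (Suc j)" by auto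
      have "s \<in> {\<rho> i<..\<rho> (Suc i)} \<longleftrightarrow> i = j" if "i < r" for i
        using grid_cell[of r \<rho> i j s, OF gr] grid_cell[of r \<rho> "Suc i" j s, OF gr] j that by auto
      then have "(\<Sum>j<r. ennreal ((norm (D (\<rho> (Suc j))))\<^sup>2) * indicator {\<rho> j<..\<rho> (Suc j)} s)
          = (\<Sum>i<r. if i = j then ennreal ((norm (D (\<rho> (Suc j))))\<^sup>2) else 0)"
        by (intro sum.cong) (auto simp: indicator_def)
      also have "\<dots> = ennreal ((norm (D s))\<^sup>2)" using j D[OF j] by simp
      finally show ?thesis
        using j assms(2,3) grid_le_iff(1)[of r \<rho> 0 j, OF gr] grid_le_iff(1)[of r \<rho> "Suc j" r, OF gr] by auto
    next
      case False
      then have "(\<Sum>j<r. ennreal ((norm (D (\<rho> (Suc j))))\<^sup>2) * indicator {\<rho> j<..\<rho> (Suc j)} s) = 0"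
        by (intro sum.neutral) (auto simp: indicator_def)
      then show ?thesis by simp
    qed
  qed
  finally show ?thesis .
qed

section \<open>Simple processes evaluated on a finer grid\<close>

context filtered_bm
begin

text \<open>
  Unlike in \<^const>\<open>simple_integrand\<close>, the coefficients need not be bounded, so that Euler sums of an
  unbounded integrand are covered.
\<close>

definition adapted_simple :: "nat \<Rightarrow> (nat \<Rightarrow> real) \<Rightarrow> (nat \<Rightarrow> 'w \<Rightarrow> real^'d^'n::finite) \<Rightarrow> bool"
  where "adapted_simple m \<tau> A \<longleftrightarrow>
    0 \<le> \<tau> 0 \<and> (\<forall>k<m. \<tau> k \<le> \<tau> (Suc k)) \<and> (\<forall>k<m. A k \<in> borel_measurable (F (\<tau> k)))"

lemma adapted_simple_nonneg: "adapted_simple m \<tau> A \<Longrightarrow> k \<le> m \<Longrightarrow> 0 \<le> \<tau> k"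
  unfolding adapted_simple_def by (induction k) (auto intro: order_trans)

lemma jointly_measurable_simple:
  assumes "adapted_simple m \<tau> A"
  shows "jointly_measurable M t (simple_process m \<tau> A)"
proof -
  have A[measurable]: "A k \<in> borel_measurable M" if "k \<in> {..<m}" for k
    using assms that adapted_simple_nonneg[OF assms, of k] by (auto simp: adapted_simple_def intro: measurable_F_M)
  have i: "(\<lambda>s. s) \<in> borel_measurable (restrict_space borel {0..t::real})"
    by (intro measurable_restrict_space1) simp
  have "(\<lambda>p. \<Sum>k<m. indicator {\<tau> k<..\<tau> (Suc k)} (fst p) *\<^sub>R A k (snd p)) \<in> borel_measurable (restrict_space borel {0..t} \<Otimes>\<^sub>M M)"
  proof (intro borel_measurable_sum borel_measurable_scaleR)
    fix k assume "k \<in> {..<m}"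
    then show "(\<lambda>p. A k (snd p)) \<in> borel_measurable (restrict_space borel {0..t} \<Otimes>\<^sub>M M)"
      using measurable_compose[OF measurable_snd A] by blast
    show "(\<lambda>p. indicator {\<tau> k<..\<tau> (Suc k)} (fst p)) \<in> borel_measurable (restrict_space borel {0..t} \<Otimes>\<^sub>M M)"
      using measurable_compose[OF measurable_fst[of "restrict_space borel {0..t}" M] measurable_compose[OF i borel_measurable_indicator[of "{\<tau> k<..\<tau> (Suc k)}"]]]
      by simp
  qed
  then show ?thesis
    unfolding jointly_measurable_def simple_process_def by (simp add: case_prod_beta')
qed

lemma jointly_measurable_progressive:
  assumes "progressively_measurable F H" "0 \<le> t"
  shows "jointly_measurable M t H"
proof -
  have "(\<lambda>\<omega>. \<omega>) \<in> measurable M (F t)"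
    using F_subalg[OF assms(2)] by (auto simp: measurable_def subalgebra_def)
  then have 1: "(\<lambda>p. (fst p, snd p)) \<in> measurable (restrict_space borel {0..t} \<Otimes>\<^sub>M M) (restrict_space borel {0..t} \<Otimes>\<^sub>M F t)"
    by (rule measurable_Pair[OF measurable_fst measurable_compose[OF measurable_snd]])
  have 2: "(\<lambda>p. H (fst p) (snd p)) \<in> borel_measurable (restrict_space borel {0..t} \<Otimes>\<^sub>M F t)"
    using assms unfolding progressively_measurable_def case_prod_beta' by blast
  show ?thesis
    using measurable_compose[OF 1 2] unfolding jointly_measurable_def case_prod_beta' by simp
qed

lemma simple_process_cell:
  assumes ad: "adapted_simple m \<tau> A" and gr: "\<And>j. j < r \<Longrightarrow> \<rho> j < \<rho> (Suc j)" and sub: "\<tau> ` {..m} \<subseteq> \<rho> ` {..r}"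
    and j: "j < r" "\<rho> j < s" "s \<le> \<rho> (Suc j)"
  shows "simple_process m \<tau> A s \<omega> = simple_process m \<tau> A (\<rho> (Suc j)) \<omega>"
proof -
  have "indicator {\<tau> k<..\<tau> (Suc k)} s = (indicator {\<tau> k<..\<tau> (Suc k)} (\<rho> (Suc j)) :: real)" if "k < m" for k
  proof -
    have "\<tau> k \<in> \<rho> ` {..r}" "\<tau> (Suc k) \<in> \<rho> ` {..r}" using sub that by auto
    then obtain p q where pq: "\<tau> k = \<rho> p" "p \<le> r" "\<tau> (Suc k) = \<rho> q" "q \<le> r" by auto
    note c = grid_cell[of r \<rho>, OF gr]
    show ?thesis
      using c[of p j s] c[of q j s] c[of p j "\<rho> (Suc j)"] c[of q j "\<rho> (Suc j)"] pq j gr[of j]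
      by (auto simp: indicator_def)
  qed
  then show ?thesis unfolding simple_process_def by (intro sum.cong) auto
qed

text \<open>A coefficient that is active at the right endpoint of a cell starts at a grid point
  strictly before it, hence not after the left endpoint. So the value on the cell is known when the
  cell begins, as \<open>discrete_maximal\<close> requires.\<close>

lemma simple_process_cell_measurable:
  assumes ad: "adapted_simple m \<tau> A" and gr: "\<And>j. j < r \<Longrightarrow> \<rho> j < \<rho> (Suc j)" and sub: "\<tau> ` {..m} \<subseteq> \<rho> ` {..r}"
    and j: "j < r"
  shows "simple_process m \<tau> A (\<rho> (Suc j)) \<in> borel_measurable (F (\<rho> j))"
proof -
  have *: "(\<lambda>\<omega>. indicator {\<tau> k<..\<tau> (Suc k)} (\<rho> (Suc j)) *\<^sub>R A k \<omega>) \<in> borel_measurable (F (\<rho> j))" if "k < m" for k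
  proof (cases "\<tau> k < \<rho> (Suc j)")
    case True
    have "\<tau> k \<in> \<rho> ` {..r}" using sub that by auto
    then obtain p where p: "\<tau> k = \<rho> p" "p \<le> r" by auto
    have "\<tau> k \<le> \<rho> j"
      using grid_cell(1)[of r \<rho> p j "\<rho> (Suc j)", OF gr] grid_le_iff(1)[of r \<rho> p j, OF gr] p j gr[of j] True by auto
    moreover have "A k \<in> borel_measurable (F (\<tau> k))" "0 \<le> \<tau> k"
      using ad that adapted_simple_nonneg[OF ad, of k] unfolding adapted_simple_def by auto
    ultimately have "A k \<in> borel_measurable (F (\<rho> j))"
      by (intro measurable_F_mono[of "\<tau> k" "\<rho> j" "A k" borel])
    then show ?thesis by (rule borel_measurable_scaleR[OF borel_measurable_const])
  next
    case False
    then have "\<rho> (Suc j) \<notin> {\<tau> k<..\<tau> (Suc k)}" by simp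
    then have ind: "indicator {\<tau> k<..\<tau> (Suc k)} (\<rho> (Suc j)) = (0::real)" by (rule indicator_simps)
    show ?thesis unfolding ind scaleR_zero_left by (rule borel_measurable_const)
  qed
  show ?thesis
    unfolding simple_process_def[abs_def]
  proof (rule borel_measurable_sum)
    fix k assume "k \<in> {..<m}"
    then have "k < m" by simp
    then show "(\<lambda>\<omega>. indicator {\<tau> k<..\<tau> (Suc k)} (\<rho> (Suc j)) *\<^sub>R A k \<omega>) \<in> borel_measurable (F (\<rho> j))"
      by (rule *)
  qed
qed

text \<open>Once the grid contains the partition, the integral is a sum over cells with the value of
  the process as coefficient. Integrals over different partitions can then be subtracted term by
  term.\<close>

lemma simple_ito_refine:
  assumes ad: "adapted_simple m \<tau> A" and gr: "\<And>j. j < r \<Longrightarrow> \<rho> j < \<rho> (Suc j)" and sub: "\<tau> ` {..m} \<subseteq> \<rho> ` {..r}"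
    and i: "i \<le> r"
  shows "simple_ito_integral W m \<tau> A (\<rho> i) \<omega> =
    (\<Sum>j<i. simple_process m \<tau> A (\<rho> (Suc j)) \<omega> *v (W (\<rho> (Suc j)) \<omega> - W (\<rho> j) \<omega>))"
proof -
  have "A k \<omega> *v (W (min (\<tau> (Suc k)) (\<rho> i)) \<omega> - W (min (\<tau> k) (\<rho> i)) \<omega>)
    = (\<Sum>j<i. (indicator {\<tau> k<..\<tau> (Suc k)} (\<rho> (Suc j)) *\<^sub>R A k \<omega>) *v (W (\<rho> (Suc j)) \<omega> - W (\<rho> j) \<omega>))" if "k < m" for k
  proof -
    have "\<tau> k \<in> \<rho> ` {..r}" "\<tau> (Suc k) \<in> \<rho> ` {..r}" using sub that by auto
    then obtain p q where pq: "\<tau> k = \<rho> p" "p \<le> r" "\<tau> (Suc k) = \<rho> q" "q \<le> r" by auto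
    have "\<tau> k \<le> \<tau> (Suc k)" using ad that by (simp add: adapted_simple_def)
    then have "p \<le> q"
      using pq grid_le_iff(1)[of r \<rho> p q, OF gr] by simp
    from grid_telescope[of r \<rho> p q i "\<lambda>t. W t \<omega>", OF gr this pq(4) i]
    show ?thesis
      unfolding pq
      by (simp only: linear_sum[OF matrix_vector_mul_linear] matrix_vector_mult_scaleR scaleR_matrix_vector_assoc)
  qed
  then have "simple_ito_integral W m \<tau> A (\<rho> i) \<omega> =
    (\<Sum>k<m. \<Sum>j<i. (indicator {\<tau> k<..\<tau> (Suc k)} (\<rho> (Suc j)) *\<^sub>R A k \<omega>) *v (W (\<rho> (Suc j)) \<omega> - W (\<rho> j) \<omega>))"
    unfolding simple_ito_integral_def by (intro sum.cong) auto
  also have "\<dots> = (\<Sum>j<i. \<Sum>k<m. (indicator {\<tau> k<..\<tau> (Suc k)} (\<rho> (Suc j)) *\<^sub>R A k \<omega>) *v (W (\<rho> (Suc j)) \<omega> - W (\<rho> j) \<omega>))"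
    by (rule sum.swap)
  also have "\<dots> = (\<Sum>j<i. simple_process m \<tau> A (\<rho> (Suc j)) \<omega> *v (W (\<rho> (Suc j)) \<omega> - W (\<rho> j) \<omega>))"
    unfolding simple_process_def sum_matrix_vector_mult ..
  finally show ?thesis .
qed

text \<open>The difference of the two integrals is a discrete stochastic integral on the union of
  both partitions and \<open>Q\<close>. The maximal inequality treats all times of \<open>Q\<close>
  at once, so the bound does not grow with their number.\<close>

lemma simple_integrals_close:
  fixes A A' :: "nat \<Rightarrow> 'w \<Rightarrow> real^'d^'n::finite"
  assumes ad: "adapted_simple m \<tau> A" "adapted_simple m' \<tau>' A'" and Q: "finite Q" "Q \<subseteq> {0..T}" "0 \<le> T"
    and pos: "0 < \<epsilon>" "0 \<le> \<delta>"
  shows "mostly (\<delta> / \<epsilon>\<^sup>2) (\<lambda>\<omega>. sq_dist T (simple_process m \<tau> A) (simple_process m' \<tau>' A') \<omega> \<le> ennreal \<delta> \<longrightarrow>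
    (\<forall>t\<in>Q. norm (simple_ito_integral W m \<tau> A t \<omega> - simple_ito_integral W m' \<tau>' A' t \<omega>) \<le> \<epsilon>))"
proof -
  define P where "P = \<tau> ` {..m} \<union> \<tau>' ` {..m'} \<union> Q \<union> {0, T}"
  have P: "finite P" "P \<noteq> {}" unfolding P_def using Q by auto
  have Pnn: "0 \<le> t" if "t \<in> P" for t
    using that adapted_simple_nonneg[OF ad(1)] adapted_simple_nonneg[OF ad(2)] Q unfolding P_def by auto
  obtain \<rho> r where \<rho>: "\<rho> ` {..r} = P" "\<And>j::nat. j < r \<Longrightarrow> \<rho> j < \<rho> (Suc j)"
    using grid_exists[OF P] by blast
  note le = grid_le_iff[of r \<rho>, OF \<rho>(2)]
  \<comment> \<open>The partitions may extend beyond \<open>T\<close>; only the \<open>r'\<close>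
    cells up to \<open>T\<close> are used, because \<open>sq_dist T\<close> controls nothing
    later.\<close>
  have "T \<in> \<rho> ` {..r}" using \<rho>(1) by (simp add: P_def)
  then obtain r' where r': "r' \<le> r" "\<rho> r' = T" by auto
  have \<rho>0: "0 \<le> \<rho> 0" using \<rho>(1) Pnn by auto
  have sub: "\<tau> ` {..m} \<subseteq> \<rho> ` {..r}" "\<tau>' ` {..m'} \<subseteq> \<rho> ` {..r}"
    unfolding \<rho>(1) P_def by auto
  define D where "D = (\<lambda>s \<omega>. simple_process m \<tau> A s \<omega> - simple_process m' \<tau>' A' s \<omega>)"
  have "mostly (\<delta> / \<epsilon>\<^sup>2) (\<lambda>\<omega>. (\<Sum>j<r'. (\<rho> (Suc j) - \<rho> j) * (norm (D (\<rho> (Suc j)) \<omega>))\<^sup>2) \<le> \<delta> \<longrightarrow>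
     (\<forall>i\<le>r'. norm (\<Sum>j<i. D (\<rho> (Suc j)) \<omega> *v (W (\<rho> (Suc j)) \<omega> - W (\<rho> j) \<omega>)) \<le> \<epsilon>))"
  proof (rule discrete_maximal[where D="\<lambda>j. D (\<rho> (Suc j))"])
    fix j assume "j < r'"
    then have "j < r" using r' by simp
    then show "\<rho> j < \<rho> (Suc j)" by (rule \<rho>(2))
    show "D (\<rho> (Suc j)) \<in> borel_measurable (F (\<rho> j))"
      unfolding D_def
      by (intro borel_measurable_diff simple_process_cell_measurable[OF ad(1) \<rho>(2) sub(1) \<open>j < r\<close>]
          simple_process_cell_measurable[OF ad(2) \<rho>(2) sub(2) \<open>j < r\<close>]) auto
  qed (use \<rho>0 pos in auto)
  then show ?thesis
  proof (rule mostly_mono)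
    fix \<omega>
    assume *: "(\<Sum>j<r'. (\<rho> (Suc j) - \<rho> j) * (norm (D (\<rho> (Suc j)) \<omega>))\<^sup>2) \<le> \<delta> \<longrightarrow>
     (\<forall>i\<le>r'. norm (\<Sum>j<i. D (\<rho> (Suc j)) \<omega> *v (W (\<rho> (Suc j)) \<omega> - W (\<rho> j) \<omega>)) \<le> \<epsilon>)"
    show "sq_dist T (simple_process m \<tau> A) (simple_process m' \<tau>' A') \<omega> \<le> ennreal \<delta> \<longrightarrow>
      (\<forall>t\<in>Q. norm (simple_ito_integral W m \<tau> A t \<omega> - simple_ito_integral W m' \<tau>' A' t \<omega>) \<le> \<epsilon>)"
    proof (intro impI ballI)
      fix t assume d: "sq_dist T (simple_process m \<tau> A) (simple_process m' \<tau>' A') \<omega> \<le> ennreal \<delta>" and t: "t \<in> Q"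
      have "ennreal (\<Sum>j<r'. (\<rho> (Suc j) - \<rho> j) * (norm (D (\<rho> (Suc j)) \<omega>))\<^sup>2) \<le> sq_dist T (simple_process m \<tau> A) (simple_process m' \<tau>' A') \<omega>"
        unfolding sq_dist_def D_def
      proof (rule step_energy_le)
        fix j s assume j: "j < r'" "\<rho> j < s" "s \<le> \<rho> (Suc j)"
        then show "simple_process m \<tau> A s \<omega> - simple_process m' \<tau>' A' s \<omega>
           = simple_process m \<tau> A (\<rho> (Suc j)) \<omega> - simple_process m' \<tau>' A' (\<rho> (Suc j)) \<omega>"
          using simple_process_cell[OF ad(1) \<rho>(2) sub(1) _ j(2,3), of \<omega>] simple_process_cell[OF ad(2) \<rho>(2) sub(2) _ j(2,3), of \<omega>] r'
          by simp
      qed (use r' \<rho> \<rho>0 in auto)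
      also note d
      finally have V: "(\<Sum>j<r'. (\<rho> (Suc j) - \<rho> j) * (norm (D (\<rho> (Suc j)) \<omega>))\<^sup>2) \<le> \<delta>"
        using pos by simp
      have "t \<in> \<rho> ` {..r}" using t unfolding \<rho>(1) P_def by auto
      then obtain i where i: "i \<le> r" "\<rho> i = t" by auto
      have "i \<le> r'" using le(1)[of i r'] i r' t Q by auto
      have "norm (\<Sum>j<i. D (\<rho> (Suc j)) \<omega> *v (W (\<rho> (Suc j)) \<omega> - W (\<rho> j) \<omega>)) \<le> \<epsilon>"
        using * V \<open>i \<le> r'\<close> by blast
      then show "norm (simple_ito_integral W m \<tau> A t \<omega> - simple_ito_integral W m' \<tau>' A' t \<omega>) \<le> \<epsilon>"
        unfolding i(2)[symmetric]
        using simple_ito_refine[OF ad(1) \<rho>(2) sub(1) i(1), of \<omega>] simple_ito_refine[OF ad(2) \<rho>(2) sub(2) i(1), of \<omega>]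
        by (simp add: D_def matrix_vector_mult_diff_rdistrib sum_subtractf)
    qed
  qed simp
qed

end

section \<open>Euler sums for the Ito integral\<close>

definition grid_pt :: "real \<Rightarrow> nat \<Rightarrow> nat \<Rightarrow> real"
  where "grid_pt T N k = real k * T / real N"

lemma grid_pt_0 [simp]: "grid_pt T N 0 = 0"
  and grid_pt_last: "0 < N \<Longrightarrow> grid_pt T N N = T"
  by (simp_all add: grid_pt_def)

lemma grid_pt_step: "grid_pt T N (Suc k) - grid_pt T N k = T / N"
  by (simp add: grid_pt_def diff_divide_distrib[symmetric] algebra_simps)

lemma grid_pt_strict: "0 < T \<Longrightarrow> 0 < N \<Longrightarrow> grid_pt T N k < grid_pt T N (Suc k)"
  by (simp add: grid_pt_def divide_strict_right_mono)

lemma grid_pt_nonneg: "0 < T \<Longrightarrow> 0 \<le> grid_pt T N k"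
  by (simp add: grid_pt_def)

lemma grid_pt_mono: "0 < T \<Longrightarrow> a \<le> b \<Longrightarrow> grid_pt T N a \<le> grid_pt T N b"
  by (simp add: grid_pt_def divide_right_mono mult_right_mono)

lemma grid_pt_range: "0 < T \<Longrightarrow> k \<le> N \<Longrightarrow> grid_pt T N k \<in> {0..T}"
  by (cases "N = 0") (auto simp: grid_pt_def field_simps)

text \<open>Points of a cell are compared with its left endpoint only, as that is where the Euler
  scheme freezes its coefficients.\<close>

definition small_oscillation :: "real \<Rightarrow> nat \<Rightarrow> real \<Rightarrow> (real \<Rightarrow> 'b::real_normed_vector) \<Rightarrow> bool"
  where "small_oscillation T N \<delta> x \<longleftrightarrow>
    (\<forall>k<N. \<forall>s\<in>{grid_pt T N k..grid_pt T N (Suc k)}. norm (x s - x (grid_pt T N k)) \<le> \<delta>)"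

lemma small_oscillationD:
  "small_oscillation T N \<delta> x \<Longrightarrow> k < N \<Longrightarrow> s \<in> {grid_pt T N k..grid_pt T N (Suc k)} \<Longrightarrow>
    norm (x s - x (grid_pt T N k)) \<le> \<delta>"
  by (simp add: small_oscillation_def)

lemma grid_cell_exists:
  fixes \<rho> :: "nat \<Rightarrow> real"
  assumes "\<rho> 0 < s" "s \<le> \<rho> r"
  shows "\<exists>j<r. \<rho> j < s \<and> s \<le> \<rho> (Suc j)"
  using assms(2)
proof (induction r)
  case (Suc r)
  then show ?case by (cases "s \<le> \<rho> r") (auto intro: less_SucI)
qed (use assms in auto)

text \<open>A closed condition on a continuous path needs to be tested only on a countable dense set
  of times.\<close>

lemma closed_path_event:
  fixes Y :: "real \<Rightarrow> 'a \<Rightarrow> 'b::{second_countable_topology, metric_space}"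
  assumes meas: "\<And>s. s \<in> I \<Longrightarrow> Y s \<in> borel_measurable M" and "closed I" "closed C"
    and cont: "\<And>\<omega>. \<omega> \<in> space M \<Longrightarrow> continuous_on I (\<lambda>s. Y s \<omega>)"
  shows "{\<omega>\<in>space M. \<forall>s\<in>I. Y s \<omega> \<in> C} \<in> sets M"
proof -
  obtain D where D: "countable D" "D \<subseteq> I" "I \<subseteq> closure D"
    using separable[of I] by blast
  have "(\<forall>s\<in>I. Y s \<omega> \<in> C) \<longleftrightarrow> (\<forall>s\<in>D. Y s \<omega> \<in> C)" if "\<omega> \<in> space M" for \<omega>
  proof
    assume *: "\<forall>s\<in>D. Y s \<omega> \<in> C"
    have "closed (I \<inter> (\<lambda>s. Y s \<omega>) -` C)"
      by (rule continuous_closed_preimage[OF cont[OF that] \<open>closed I\<close> \<open>closed C\<close>])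
    moreover have "D \<subseteq> I \<inter> (\<lambda>s. Y s \<omega>) -` C" using * D by auto
    ultimately have "closure D \<subseteq> I \<inter> (\<lambda>s. Y s \<omega>) -` C" by (rule closure_minimal[rotated])
    then show "\<forall>s\<in>I. Y s \<omega> \<in> C" using D by auto
  qed (use D in auto)
  then have "{\<omega>\<in>space M. \<forall>s\<in>I. Y s \<omega> \<in> C} = space M \<inter> (\<Inter>s\<in>D. Y s -` C \<inter> space M) \<or> D = {}"
    by auto
  moreover have "(\<Inter>s\<in>D. Y s -` C \<inter> space M) \<in> sets M" if "D \<noteq> {}"
  proof (rule sets.countable_INT'[OF D(1) that])
    show "(\<lambda>s. Y s -` C \<inter> space M) ` D \<subseteq> sets M"
      using meas D(2) \<open>closed C\<close> by (auto intro!: measurable_sets borel_closed)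
  qed
  moreover have "{\<omega>\<in>space M. \<forall>s\<in>I. Y s \<omega> \<in> C} = space M" if "D = {}"
    using D(3) that by auto
  ultimately show ?thesis
    by (cases "D = {}") auto
qed

text \<open>Every path is uniformly continuous on \<open>{0..T}\<close>, so its oscillation is
  eventually small; \<open>mostly_eventually\<close> makes the mesh uniform in the path outside a
  small event.\<close>

lemma (in prob_space) oscillation_eventually_small:
  fixes \<Theta> :: "real \<Rightarrow> 'a \<Rightarrow> 'b::{second_countable_topology, real_normed_vector}"
  assumes meas: "\<And>s. s \<in> {0..T} \<Longrightarrow> \<Theta> s \<in> borel_measurable M"
    and cont: "\<And>\<omega>. \<omega> \<in> space M \<Longrightarrow> continuous_on {0..T} (\<lambda>s. \<Theta> s \<omega>)"
    and pos: "0 < T" "0 < \<delta>" "0 < e"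
  shows "eventually (\<lambda>N. mostly e (\<lambda>\<omega>. small_oscillation T N \<delta> (\<lambda>s. \<Theta> s \<omega>))) sequentially"
  unfolding small_oscillation_def
proof (rule mostly_eventually[OF _ _ \<open>0 < e\<close>])
  fix N
  have "{\<omega>\<in>space M. \<forall>s\<in>{grid_pt T N k..grid_pt T N (Suc k)}. \<Theta> s \<omega> - \<Theta> (grid_pt T N k) \<omega> \<in> cball 0 \<delta>} \<in> events" if "k < N" for k
  proof (rule closed_path_event)
    have k: "grid_pt T N k \<in> {0..T}" "{grid_pt T N k..grid_pt T N (Suc k)} \<subseteq> {0..T}"
      using grid_pt_range[OF pos(1), of k N] grid_pt_range[OF pos(1), of "Suc k" N] that by auto
    show "(\<lambda>\<omega>. \<Theta> s \<omega> - \<Theta> (grid_pt T N k) \<omega>) \<in> borel_measurable M" if "s \<in> {grid_pt T N k..grid_pt T N (Suc k)}" for s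
      using k that by (intro borel_measurable_diff meas) auto
    show "continuous_on {grid_pt T N k..grid_pt T N (Suc k)} (\<lambda>s. \<Theta> s \<omega> - \<Theta> (grid_pt T N k) \<omega>)" if "\<omega> \<in> space M" for \<omega>
      by (intro continuous_intros continuous_on_subset[OF cont[OF that] k(2)])
  qed auto
  then have "space M \<inter> (\<Inter>k\<in>{..<N}. {\<omega>\<in>space M. \<forall>s\<in>{grid_pt T N k..grid_pt T N (Suc k)}. \<Theta> s \<omega> - \<Theta> (grid_pt T N k) \<omega> \<in> cball 0 \<delta>}) \<in> events"
    by (cases "N = 0") (auto intro!: sets.Int sets.finite_INT)
  also have "space M \<inter> (\<Inter>k\<in>{..<N}. {\<omega>\<in>space M. \<forall>s\<in>{grid_pt T N k..grid_pt T N (Suc k)}. \<Theta> s \<omega> - \<Theta> (grid_pt T N k) \<omega> \<in> cball 0 \<delta>})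
    = {\<omega>\<in>space M. \<forall>k<N. \<forall>s\<in>{grid_pt T N k..grid_pt T N (Suc k)}. norm (\<Theta> s \<omega> - \<Theta> (grid_pt T N k) \<omega>) \<le> \<delta>}"
    by auto
  finally show "{\<omega>\<in>space M. \<forall>k<N. \<forall>s\<in>{grid_pt T N k..grid_pt T N (Suc k)}. norm (\<Theta> s \<omega> - \<Theta> (grid_pt T N k) \<omega>) \<le> \<delta>} \<in> events" .
next
  fix \<omega> assume "\<omega> \<in> space M"
  then have "uniformly_continuous_on {0..T} (\<lambda>s. \<Theta> s \<omega>)"
    by (intro compact_uniformly_continuous cont) auto
  then obtain d where d: "0 < d" "\<And>s s'. s \<in> {0..T} \<Longrightarrow> s' \<in> {0..T} \<Longrightarrow> dist s' s < d \<Longrightarrow> dist (\<Theta> s' \<omega>) (\<Theta> s \<omega>) < \<delta>"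
    unfolding uniformly_continuous_on_def using pos(2) by metis
  have "eventually (\<lambda>N. T / real N < d) sequentially"
    using d(1) by (intro order_tendstoD(2)[OF lim_const_over_n])
  then show "\<forall>\<^sub>F N in sequentially. \<forall>k<N. \<forall>s\<in>{grid_pt T N k..grid_pt T N (Suc k)}. norm (\<Theta> s \<omega> - \<Theta> (grid_pt T N k) \<omega>) \<le> \<delta>"
  proof (rule eventually_mono, intro allI impI ballI)
    fix N k s assume N: "T / real N < d" "k < N" "s \<in> {grid_pt T N k..grid_pt T N (Suc k)}"
    have "dist s (grid_pt T N k) < d"
      using N grid_pt_step[of T N k] by (auto simp: dist_real_def)
    then show "norm (\<Theta> s \<omega> - \<Theta> (grid_pt T N k) \<omega>) \<le> \<delta>"
      using d(2)[of "grid_pt T N k" s] N grid_pt_range[OF pos(1), of k N] grid_pt_range[OF pos(1), of "Suc k" N]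
      by (auto simp: dist_norm)
  qed
qed

lemma (in prob_space) tendsto_imp_mostly:
  fixes f :: "nat \<Rightarrow> 'a \<Rightarrow> 'c::{second_countable_topology, linorder_topology}"
  assumes "(\<lambda>N. measure M {\<omega>\<in>space M. f N \<omega> > c}) \<longlonglongrightarrow> 0" "\<And>N. f N \<in> borel_measurable M" "0 < e"
  shows "eventually (\<lambda>N. mostly e (\<lambda>\<omega>. f N \<omega> \<le> c)) sequentially"
proof -
  have "eventually (\<lambda>N. measure M {\<omega>\<in>space M. f N \<omega> > c} < e) sequentially"
    using order_tendstoD(2)[OF assms(1,3)] .
  then show ?thesis
  proof (rule eventually_mono)
    fix N assume N: "measure M {\<omega>\<in>space M. f N \<omega> > c} < e"
    have "{\<omega>\<in>space M. c < f N \<omega>} \<in> events"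
      by (rule borel_measurable_less[OF borel_measurable_const assms(2)])
    then show "mostly e (\<lambda>\<omega>. f N \<omega> \<le> c)"
      using N by (intro mostly_event) (simp_all add: not_le)
  qed
qed

context filtered_bm
begin

lemma simple_integrand_adapted: "simple_integrand M F m \<tau> A \<Longrightarrow> adapted_simple m \<tau> A"
  unfolding simple_integrand_def adapted_simple_def by blast

lemma simple_ito_integral_measurable:
  assumes ad: "adapted_simple m \<tau> A" and t: "0 \<le> t"
  shows "simple_ito_integral W m \<tau> A t \<in> borel_measurable M"
  unfolding simple_ito_integral_def[abs_def]
proof (rule borel_measurable_sum)
  fix k assume "k \<in> {..<m}"
  then have k: "0 \<le> \<tau> k" "0 \<le> \<tau> (Suc k)" "A k \<in> borel_measurable (F (\<tau> k))"
    using adapted_simple_nonneg[OF ad] ad unfolding adapted_simple_def by auto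
  show "(\<lambda>\<omega>. A k \<omega> *v (W (min (\<tau> (Suc k)) t) \<omega> - W (min (\<tau> k) t) \<omega>)) \<in> borel_measurable M"
    using k t by (intro measurable_matrix_vector measurable_F_M[OF k(1) k(3)] borel_measurable_diff W_measurable) auto
qed

lemma ito_approximation:
  fixes H :: "real \<Rightarrow> 'w \<Rightarrow> real^'d^'n::finite"
  assumes "has_ito_integral M F W H t I" and pos: "0 \<le> t" "0 < \<delta>" "0 < \<epsilon>" "0 < e"
  obtains m \<tau> A where "adapted_simple m \<tau> A"
    "mostly e (\<lambda>\<omega>. sq_dist t (simple_process m \<tau> A) H \<omega> \<le> ennreal \<delta>)"
    "mostly e (\<lambda>\<omega>. norm (simple_ito_integral W m \<tau> A t \<omega> - I \<omega>) \<le> \<epsilon>)"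
proof -
  obtain m \<tau> and A :: "nat \<Rightarrow> nat \<Rightarrow> 'w \<Rightarrow> real^'d^'n" where
    si: "\<And>N::nat. simple_integrand M F (m N) (\<tau> N) (A N)" and
    c1: "\<And>\<epsilon>. 0 < \<epsilon> \<Longrightarrow> (\<lambda>N. measure M {\<omega>\<in>space M. sq_dist t (simple_process (m N) (\<tau> N) (A N)) H \<omega> > ennreal \<epsilon>}) \<longlonglongrightarrow> 0" and
    c2: "\<And>\<epsilon>. 0 < \<epsilon> \<Longrightarrow> (\<lambda>N. measure M {\<omega>\<in>space M. norm (simple_ito_integral W (m N) (\<tau> N) (A N) t \<omega> - I \<omega>) > \<epsilon>}) \<longlonglongrightarrow> 0"
    using assms(1) unfolding has_ito_integral_def sq_dist_def by blast
  have pr: "progressively_measurable F H" and I: "I \<in> borel_measurable M"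
    using assms(1) unfolding has_ito_integral_def by auto
  note ad = simple_integrand_adapted[OF si]
  have "eventually (\<lambda>N. mostly e (\<lambda>\<omega>. sq_dist t (simple_process (m N) (\<tau> N) (A N)) H \<omega> \<le> ennreal \<delta>)) sequentially"
    by (rule tendsto_imp_mostly[OF c1[OF pos(2)] _ pos(4)])
      (rule sq_dist_measurable[OF jointly_measurable_simple[OF ad] jointly_measurable_progressive[OF pr pos(1)]])
  moreover have "eventually (\<lambda>N. mostly e (\<lambda>\<omega>. norm (simple_ito_integral W (m N) (\<tau> N) (A N) t \<omega> - I \<omega>) \<le> \<epsilon>)) sequentially"
    by (rule tendsto_imp_mostly[OF c2[OF pos(3)] _ pos(4)])
      (rule measurable_norm_comp[OF borel_measurable_diff[OF simple_ito_integral_measurable[OF ad pos(1)] I]])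
  ultimately have "eventually (\<lambda>N. mostly e (\<lambda>\<omega>. sq_dist t (simple_process (m N) (\<tau> N) (A N)) H \<omega> \<le> ennreal \<delta>)
      \<and> mostly e (\<lambda>\<omega>. norm (simple_ito_integral W (m N) (\<tau> N) (A N) t \<omega> - I \<omega>) \<le> \<epsilon>)) sequentially"
    by (rule eventually_conj)
  then obtain N where "mostly e (\<lambda>\<omega>. sq_dist t (simple_process (m N) (\<tau> N) (A N)) H \<omega> \<le> ennreal \<delta>)"
      "mostly e (\<lambda>\<omega>. norm (simple_ito_integral W (m N) (\<tau> N) (A N) t \<omega> - I \<omega>) \<le> \<epsilon>)"
    unfolding eventually_sequentially by blast
  with ad[of N] show ?thesis by (rule that)
qed

text \<open>
  The approximating sequence in \<^const>\<open>has_ito_integral\<close> may depend on the time; here one simple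
  process approximates the integrals at all times of \<open>Q\<close> at once.
\<close>

lemma ito_approximation_uniform:
  fixes H :: "real \<Rightarrow> 'w \<Rightarrow> real^'d^'n::finite"
  assumes T: "0 \<le> T" "has_ito_integral M F W H T J" and Q: "finite Q" "Q \<subseteq> {0..T}"
    and I: "\<And>t. t \<in> Q \<Longrightarrow> has_ito_integral M F W H t (I t)" and pos: "0 < \<delta>" "0 < \<epsilon>" "0 < e"
  obtains m \<tau> A where "adapted_simple m \<tau> A"
    "mostly e (\<lambda>\<omega>. sq_dist T (simple_process m \<tau> A) H \<omega> \<le> ennreal \<delta> \<and>
      (\<forall>t\<in>Q. norm (simple_ito_integral W m \<tau> A t \<omega> - I t \<omega>) \<le> \<epsilon>))"
proof -
  \<comment> \<open>One share \<open>e1\<close> pays for the approximation at \<open>T\<close>, and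
    three shares for each time of \<open>Q\<close>.\<close>
  define e1 where "e1 = e / (3 * card Q + 1)"
  have e1: "0 < e1" unfolding e1_def using pos by (intro divide_pos_pos) auto
  \<comment> \<open>Two processes within \<open>d\<close> of \<open>H\<close> are within
    \<open>2 * d + 2 * d\<close> of each other. The second entry makes the maximal inequality with
    this energy and the threshold \<open>\<epsilon>/2\<close> cost at most
    \<open>e1\<close>.\<close>
  define d where "d = min \<delta> (e1 * (\<epsilon>/2)\<^sup>2 / 4)"
  have d: "0 < d" "d \<le> \<delta>" "4 * d / (\<epsilon>/2)\<^sup>2 \<le> e1"
    using pos e1 by (auto simp: d_def min_def field_simps)
  have pr: "progressively_measurable F H" using T(2) by (simp add: has_ito_integral_def)
  note jH = jointly_measurable_progressive[OF pr]
  obtain m \<tau> A where ad: "adapted_simple m \<tau> A" and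
    mT: "mostly e1 (\<lambda>\<omega>. sq_dist T (simple_process m \<tau> A) H \<omega> \<le> ennreal d)"
    using ito_approximation[OF T(2) T(1) d(1) pos(2) e1] by blast
  \<comment> \<open>The closeness at \<open>T\<close> stays a premise, so that its exceptional event
    is counted once and not for every \<open>t\<close>. At each \<open>t\<close> a simple process
    from the approximation of \<open>I t\<close> mediates between the common process and
    \<open>I t\<close>.\<close>
  have "mostly (3 * e1) (\<lambda>\<omega>. sq_dist T (simple_process m \<tau> A) H \<omega> \<le> ennreal d \<longrightarrow>
      norm (simple_ito_integral W m \<tau> A t \<omega> - I t \<omega>) \<le> \<epsilon>)" if t: "t \<in> Q" for t
  proof -
    have t0: "0 \<le> t" "t \<le> T" using Q t by auto
    obtain m' \<tau>' A' where ad': "adapted_simple m' \<tau>' A'" and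
      m1: "mostly e1 (\<lambda>\<omega>. sq_dist t (simple_process m' \<tau>' A') H \<omega> \<le> ennreal d)" and
      m2: "mostly e1 (\<lambda>\<omega>. norm (simple_ito_integral W m' \<tau>' A' t \<omega> - I t \<omega>) \<le> \<epsilon>/2)"
      using ito_approximation[OF I[OF t] t0(1) d(1) _ e1, of "\<epsilon>/2"] pos by auto
    have "mostly (4 * d / (\<epsilon>/2)\<^sup>2) (\<lambda>\<omega>. sq_dist t (simple_process m \<tau> A) (simple_process m' \<tau>' A') \<omega> \<le> ennreal (4 * d) \<longrightarrow>
       (\<forall>t\<in>{t}. norm (simple_ito_integral W m \<tau> A t \<omega> - simple_ito_integral W m' \<tau>' A' t \<omega>) \<le> \<epsilon>/2))"
      using pos t0 d by (intro simple_integrals_close ad ad') auto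
    then have m3: "mostly e1 (\<lambda>\<omega>. sq_dist t (simple_process m \<tau> A) (simple_process m' \<tau>' A') \<omega> \<le> ennreal (4 * d) \<longrightarrow>
       norm (simple_ito_integral W m \<tau> A t \<omega> - simple_ito_integral W m' \<tau>' A' t \<omega>) \<le> \<epsilon>/2)"
      by (rule mostly_mono[OF _ _ d(3)]) simp
    show ?thesis
    proof (rule mostly_mono[OF mostly_conj[OF m1 mostly_conj[OF m2 m3]]], intro impI)
      fix \<omega> assume w: "\<omega> \<in> space M" and
        *: "sq_dist t (simple_process m' \<tau>' A') H \<omega> \<le> ennreal d \<and> norm (simple_ito_integral W m' \<tau>' A' t \<omega> - I t \<omega>) \<le> \<epsilon> / 2 \<and>
         (sq_dist t (simple_process m \<tau> A) (simple_process m' \<tau>' A') \<omega> \<le> ennreal (4 * d) \<longrightarrow>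
          norm (simple_ito_integral W m \<tau> A t \<omega> - simple_ito_integral W m' \<tau>' A' t \<omega>) \<le> \<epsilon> / 2)"
        and dT: "sq_dist T (simple_process m \<tau> A) H \<omega> \<le> ennreal d"
      have "sq_dist t (simple_process m \<tau> A) H \<omega> \<le> ennreal d"
        by (rule order_trans[OF sq_dist_mono[OF t0(2)] dT])
      then have "sq_dist t (simple_process m \<tau> A) (simple_process m' \<tau>' A') \<omega> \<le> ennreal (2 * d + 2 * d)"
        using * d w by (intro sq_dist_triangle_bound[OF jointly_measurable_simple[OF ad] jointly_measurable_simple[OF ad'] jH[OF t0(1)]]) auto
      then have "norm (simple_ito_integral W m \<tau> A t \<omega> - simple_ito_integral W m' \<tau>' A' t \<omega>) \<le> \<epsilon> / 2"
        using * by (auto simp: algebra_simps)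
      then show "norm (simple_ito_integral W m \<tau> A t \<omega> - I t \<omega>) \<le> \<epsilon>"
        using * norm_triangle_ineq[of "simple_ito_integral W m \<tau> A t \<omega> - simple_ito_integral W m' \<tau>' A' t \<omega>" "simple_ito_integral W m' \<tau>' A' t \<omega> - I t \<omega>"]
        by simp
    qed simp
  qed
  from mostly_conj[OF mT mostly_ball[OF Q(1) this]]
  have "mostly e (\<lambda>\<omega>. sq_dist T (simple_process m \<tau> A) H \<omega> \<le> ennreal \<delta> \<and>
      (\<forall>t\<in>Q. norm (simple_ito_integral W m \<tau> A t \<omega> - I t \<omega>) \<le> \<epsilon>))"
  proof (rule mostly_mono)
    have "e1 + real (card Q) * (3 * e1) = e1 * (3 * card Q + 1)" by (simp add: algebra_simps)
    also have "\<dots> = e" unfolding e1_def by (simp add: add_pos_nonneg)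
    finally show "e1 + real (card Q) * (3 * e1) \<le> e" by simp
  next
    fix \<omega> assume "sq_dist T (simple_process m \<tau> A) H \<omega> \<le> ennreal d \<and>
      (\<forall>t\<in>Q. sq_dist T (simple_process m \<tau> A) H \<omega> \<le> ennreal d \<longrightarrow> norm (simple_ito_integral W m \<tau> A t \<omega> - I t \<omega>) \<le> \<epsilon>)"
    then show "sq_dist T (simple_process m \<tau> A) H \<omega> \<le> ennreal \<delta> \<and> (\<forall>t\<in>Q. norm (simple_ito_integral W m \<tau> A t \<omega> - I t \<omega>) \<le> \<epsilon>)"
      using order_trans[OF _ ennreal_leI[OF d(2)]] by blast
  qed
  with ad show ?thesis by (rule that)
qed

lemma euler_simple_process:
  assumes pos: "0 < T" "0 < N" and H: "\<And>t. 0 \<le> t \<Longrightarrow> H t \<in> borel_measurable (F t)"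
  shows "adapted_simple N (grid_pt T N) (\<lambda>k. H (grid_pt T N k))"
    and "k \<le> N \<Longrightarrow> simple_ito_integral W N (grid_pt T N) (\<lambda>k. H (grid_pt T N k)) (grid_pt T N k) \<omega> =
      (\<Sum>j<k. H (grid_pt T N j) \<omega> *v (W (grid_pt T N (Suc j)) \<omega> - W (grid_pt T N j) \<omega>))"
    and "small_oscillation T N \<eta> (\<lambda>s. H s \<omega>) \<Longrightarrow>
      sq_dist T (simple_process N (grid_pt T N) (\<lambda>k. H (grid_pt T N k))) H \<omega> \<le> ennreal (T * \<eta>\<^sup>2)"
proof -
  note st = grid_pt_strict[OF pos]
  have nn: "0 \<le> grid_pt T N k" for k using pos by (simp add: grid_pt_def)
  show "adapted_simple N (grid_pt T N) (\<lambda>k. H (grid_pt T N k))"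
    unfolding adapted_simple_def using st H[OF nn] by (auto intro: less_imp_le)
  show "simple_ito_integral W N (grid_pt T N) (\<lambda>k. H (grid_pt T N k)) (grid_pt T N k) \<omega> =
      (\<Sum>j<k. H (grid_pt T N j) \<omega> *v (W (grid_pt T N (Suc j)) \<omega> - W (grid_pt T N j) \<omega>))" if k: "k \<le> N"
  proof -
    have "simple_ito_integral W N (grid_pt T N) (\<lambda>k. H (grid_pt T N k)) (grid_pt T N k) \<omega> =
      (\<Sum>j<N. if j < k then H (grid_pt T N j) \<omega> *v (W (grid_pt T N (Suc j)) \<omega> - W (grid_pt T N j) \<omega>) else 0)"
      unfolding simple_ito_integral_def
    proof (intro sum.cong refl)
      fix j assume "j \<in> {..<N}"
      have le: "grid_pt T N a \<le> grid_pt T N b \<longleftrightarrow> a \<le> b" for a b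
        using pos by (simp add: grid_pt_def divide_le_cancel)
      show "H (grid_pt T N j) \<omega> *v (W (min (grid_pt T N (Suc j)) (grid_pt T N k)) \<omega> - W (min (grid_pt T N j) (grid_pt T N k)) \<omega>) =
        (if j < k then H (grid_pt T N j) \<omega> *v (W (grid_pt T N (Suc j)) \<omega> - W (grid_pt T N j) \<omega>) else 0)"
        by (cases "j < k") (auto simp: min_def le)
    qed
    also have "\<dots> = (\<Sum>j<k. H (grid_pt T N j) \<omega> *v (W (grid_pt T N (Suc j)) \<omega> - W (grid_pt T N j) \<omega>))"
    proof -
      have "{..<N} \<inter> {j. j < k} = {..<k}" using k by auto
      then show ?thesis by (simp add: sum.If_cases)
    qed
    finally show ?thesis .
  qed
  show "sq_dist T (simple_process N (grid_pt T N) (\<lambda>k. H (grid_pt T N k))) H \<omega> \<le> ennreal (T * \<eta>\<^sup>2)"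
    if osc: "small_oscillation T N \<eta> (\<lambda>s. H s \<omega>)"
  proof -
    have "norm (simple_process N (grid_pt T N) (\<lambda>k. H (grid_pt T N k)) s \<omega> - H s \<omega>) \<le> \<eta>" if s: "0 < s" "s \<le> T" for s
    proof -
      obtain j where j: "j < N" "grid_pt T N j < s" "s \<le> grid_pt T N (Suc j)"
        using grid_cell_exists[of "grid_pt T N" s N] s grid_pt_last[OF pos(2)] by auto
      have "indicator {grid_pt T N k<..grid_pt T N (Suc k)} s = (if k = j then 1 else (0::real))" if "k < N" for k
        using grid_cell[of N "grid_pt T N" k j s, OF st] grid_cell[of N "grid_pt T N" "Suc k" j s, OF st] j that
        by (auto simp: indicator_def)
      then have "simple_process N (grid_pt T N) (\<lambda>k. H (grid_pt T N k)) s \<omega> = (\<Sum>k<N. if k = j then H (grid_pt T N k) \<omega> else 0)"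
        unfolding simple_process_def by (intro sum.cong) auto
      also have "\<dots> = H (grid_pt T N j) \<omega>" using j by simp
      finally show ?thesis using small_oscillationD[OF osc j(1), of s] j by (simp add: norm_minus_commute)
    qed
    then have "(norm (simple_process N (grid_pt T N) (\<lambda>k. H (grid_pt T N k)) s \<omega> - H s \<omega>))\<^sup>2 \<le> \<eta>\<^sup>2" if "0 < s" "s \<le> T" for s
      using that by (intro power_mono) auto
    \<comment> \<open>At time 0, which belongs to no cell, the simple process vanishes; a single
      time is negligible.\<close>
    then have "sq_dist T (simple_process N (grid_pt T N) (\<lambda>k. H (grid_pt T N k))) H \<omega> \<le> (\<integral>\<^sup>+s\<in>{0..T}. ennreal (\<eta>\<^sup>2) \<partial>lborel)"
      unfolding sq_dist_def using AE_lborel_singleton[of "0::real"]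
      by (intro nn_integral_mono_AE) (auto elim!: eventually_mono simp: indicator_def intro!: ennreal_leI)
    also have "\<dots> = ennreal (T * \<eta>\<^sup>2)"
      using pos by (subst nn_integral_cmult_indicator) (simp_all add: ennreal_mult' mult.commute)
    finally show ?thesis .
  qed
qed

text \<open>The integrals \<open>I t\<close> are given for each time separately, so continuity in
  time cannot pass from single times to the whole grid. Instead one simple process approximates them
  at all grid times, and the maximal inequality compares it with the Euler process.\<close>

lemma euler_integral_uniform:
  fixes H :: "real \<Rightarrow> 'w \<Rightarrow> real^'d^'n::finite"
  assumes T: "0 < T" and H: "\<And>t. 0 \<le> t \<Longrightarrow> H t \<in> borel_measurable (F t)"
    and cont: "\<And>\<omega>. \<omega> \<in> space M \<Longrightarrow> continuous_on {0..T} (\<lambda>t. H t \<omega>)"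
    and I: "\<And>t. 0 \<le> t \<Longrightarrow> has_ito_integral M F W H t (I t)" and pos: "0 < \<epsilon>" "0 < e"
  shows "eventually (\<lambda>N. mostly e (\<lambda>\<omega>. \<forall>k\<le>N. norm ((\<Sum>j<k. H (grid_pt T N j) \<omega> *v (W (grid_pt T N (Suc j)) \<omega> - W (grid_pt T N j) \<omega>))
      - I (grid_pt T N k) \<omega>) \<le> \<epsilon>)) sequentially"
proof -
  define e1 where "e1 = e / 3"
  have e1: "0 < e1" using pos by (simp add: e1_def)
  \<comment> \<open>\<open>d\<close> balances the maximal inequality,
    \<open>4 * d / (\<epsilon>/2)^2 = e1\<close>; below, \<open>\<eta>\<close> is the oscillation at
    which the Euler process is within \<open>d\<close> of \<open>H\<close>, as
    \<open>T * \<eta>^2 = d\<close>.\<close>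
  define d where "d = e1 * (\<epsilon>/2)\<^sup>2 / 4"
  have d: "0 < d" "4 * d / (\<epsilon>/2)\<^sup>2 = e1" using e1 pos by (auto simp: d_def)
  define \<eta> where "\<eta> = sqrt (d / T)"
  have eta: "0 < \<eta>" "T * \<eta>\<^sup>2 = d" using d T by (auto simp: \<eta>_def)
  have osc: "eventually (\<lambda>N. mostly e1 (\<lambda>\<omega>. small_oscillation T N \<eta> (\<lambda>s. H s \<omega>))) sequentially"
  proof (rule oscillation_eventually_small[OF _ cont T eta(1) e1])
    show "H s \<in> borel_measurable M" if "s \<in> {0..T}" for s
      using that by (intro measurable_F_M[OF _ H]) simp_all
  qed
  have pr: "progressively_measurable F H" using I[of 0] by (simp add: has_ito_integral_def)
  have jH: "jointly_measurable M T H" using jointly_measurable_progressive[OF pr] T by simp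
  show ?thesis
    using eventually_conj[OF osc eventually_gt_at_top[of 0]]
  proof (rule eventually_mono, elim conjE)
    fix N :: nat assume N: "0 < N" and m1: "mostly e1 (\<lambda>\<omega>. small_oscillation T N \<eta> (\<lambda>s. H s \<omega>))"
    \<comment> \<open>The simple process obtained below depends on \<open>N\<close> through
      \<open>Q\<close>; this is harmless since its error bounds do not.\<close>
    define Q where "Q = grid_pt T N ` {..N}"
    have Q: "finite Q" "Q \<subseteq> {0..T}" unfolding Q_def using grid_pt_range[OF T] by auto
    have E1: "adapted_simple N (grid_pt T N) (\<lambda>k. H (grid_pt T N k))"
      by (rule euler_simple_process(1)[OF T N H])
    define E where "E = simple_process N (grid_pt T N) (\<lambda>k. H (grid_pt T N k))"
    obtain m \<tau> A where ad: "adapted_simple m \<tau> A" and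
      m2: "mostly e1 (\<lambda>\<omega>. sq_dist T (simple_process m \<tau> A) H \<omega> \<le> ennreal d \<and>
      (\<forall>t\<in>Q. norm (simple_ito_integral W m \<tau> A t \<omega> - I t \<omega>) \<le> \<epsilon>/2))"
    proof (rule ito_approximation_uniform[of T H "I T" Q I d "\<epsilon>/2" e1])
      show "has_ito_integral M F W H t (I t)" if "t \<in> Q" for t
        using that Q by (intro I) auto
    qed (use T Q I[of T] pos d e1 in simp_all)
    have m3: "mostly (4 * d / (\<epsilon>/2)\<^sup>2) (\<lambda>\<omega>. sq_dist T E (simple_process m \<tau> A) \<omega> \<le> ennreal (4 * d) \<longrightarrow>
      (\<forall>t\<in>Q. norm (simple_ito_integral W N (grid_pt T N) (\<lambda>k. H (grid_pt T N k)) t \<omega> - simple_ito_integral W m \<tau> A t \<omega>) \<le> \<epsilon>/2))"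
      unfolding E_def using T pos d Q by (intro simple_integrals_close E1 ad) auto
    show "mostly e (\<lambda>\<omega>. \<forall>k\<le>N. norm ((\<Sum>j<k. H (grid_pt T N j) \<omega> *v (W (grid_pt T N (Suc j)) \<omega> - W (grid_pt T N j) \<omega>))
      - I (grid_pt T N k) \<omega>) \<le> \<epsilon>)"
    proof (rule mostly_mono[OF mostly_conj[OF m1 mostly_conj[OF m2 m3]]], intro allI impI)
      fix \<omega> k assume w: "\<omega> \<in> space M" and k: "k \<le> N" and
        *: "(small_oscillation T N \<eta> (\<lambda>s. H s \<omega>)) \<and>
         (sq_dist T (simple_process m \<tau> A) H \<omega> \<le> ennreal d \<and> (\<forall>t\<in>Q. norm (simple_ito_integral W m \<tau> A t \<omega> - I t \<omega>) \<le> \<epsilon> / 2)) \<and>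
         (sq_dist T E (simple_process m \<tau> A) \<omega> \<le> ennreal (4 * d) \<longrightarrow>
          (\<forall>t\<in>Q. norm (simple_ito_integral W N (grid_pt T N) (\<lambda>k. H (grid_pt T N k)) t \<omega> - simple_ito_integral W m \<tau> A t \<omega>) \<le> \<epsilon> / 2))"
      have "sq_dist T E H \<omega> \<le> ennreal d"
        unfolding E_def eta(2)[symmetric] using * by (intro euler_simple_process(3)[OF T N H]) auto
      then have "sq_dist T E (simple_process m \<tau> A) \<omega> \<le> ennreal (2 * d + 2 * d)"
        using * w d unfolding E_def
        by (intro sq_dist_triangle_bound[OF jointly_measurable_simple[OF E1] jointly_measurable_simple[OF ad] jH]) auto
      moreover have "grid_pt T N k \<in> Q" using k by (auto simp: Q_def)
      ultimately have "norm (simple_ito_integral W N (grid_pt T N) (\<lambda>k. H (grid_pt T N k)) (grid_pt T N k) \<omega> - simple_ito_integral W m \<tau> A (grid_pt T N k) \<omega>) \<le> \<epsilon> / 2"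
        "norm (simple_ito_integral W m \<tau> A (grid_pt T N k) \<omega> - I (grid_pt T N k) \<omega>) \<le> \<epsilon> / 2"
        using * by auto
      then show "norm ((\<Sum>j<k. H (grid_pt T N j) \<omega> *v (W (grid_pt T N (Suc j)) \<omega> - W (grid_pt T N j) \<omega>)) - I (grid_pt T N k) \<omega>) \<le> \<epsilon>"
        using euler_simple_process(2)[where H=H, OF T N H k, of \<omega>] norm_triangle_ineq[of "simple_ito_integral W N (grid_pt T N) (\<lambda>k. H (grid_pt T N k)) (grid_pt T N k) \<omega> - simple_ito_integral W m \<tau> A (grid_pt T N k) \<omega>" "simple_ito_integral W m \<tau> A (grid_pt T N k) \<omega> - I (grid_pt T N k) \<omega>"]
        by simp
    qed (use d in \<open>simp add: e1_def\<close>)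
  qed
qed

end

section \<open>Second-order Taylor expansion\<close>

lemma partial_deriv_line:
  fixes \<phi> :: "real^'n::finite \<Rightarrow> real"
  assumes "\<phi> differentiable (at (y + t *\<^sub>R z))"
  shows "((\<lambda>t. \<phi> (y + t *\<^sub>R z)) has_real_derivative (\<Sum>i\<in>UNIV. partial_deriv i \<phi> (y + t *\<^sub>R z) * z $ i)) (at t)"
proof -
  define D where "D = frechet_derivative \<phi> (at (y + t *\<^sub>R z))"
  have d: "(\<phi> has_derivative D) (at (y + t *\<^sub>R z))"
    using assms unfolding D_def frechet_derivative_works .
  have line: "((\<lambda>t. y + t *\<^sub>R z) has_derivative (\<lambda>s. s *\<^sub>R z)) (at t)"
    by (auto intro!: derivative_eq_intros)
  have comp: "((\<lambda>t. \<phi> (y + t *\<^sub>R z)) has_derivative (\<lambda>s. D (s *\<^sub>R z))) (at t)"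
    by (rule has_derivative_compose[OF line d])
  interpret D: linear D by (rule has_derivative_linear[OF d])
  have "D z = D (\<Sum>i\<in>UNIV. z $ i *\<^sub>R axis i 1)"
    using basis_expansion[of z] by (simp add: scalar_mult_eq_scaleR)
  also have "\<dots> = (\<Sum>i\<in>UNIV. partial_deriv i \<phi> (y + t *\<^sub>R z) * z $ i)"
    unfolding D.sum D.scaleR by (simp add: partial_deriv_def D_def mult.commute)
  finally have "(\<lambda>s. D (s *\<^sub>R z)) = (*) (\<Sum>i\<in>UNIV. partial_deriv i \<phi> (y + t *\<^sub>R z) * z $ i)"
    by (simp add: D.scaleR fun_eq_iff)
  with comp show ?thesis unfolding has_field_derivative_def by simp
qed

lemma C2_openD:
  assumes "C_k_open 2 h O'"
  shows "\<And>x. x \<in> O' \<Longrightarrow> h differentiable (at x)"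
    and "\<And>i x. x \<in> O' \<Longrightarrow> partial_deriv i h differentiable (at x)"
    and "\<And>i j. continuous_on O' (partial_deriv i (partial_deriv j h))"
  using assms by (simp_all add: numeral_2_eq_2)

lemma C2_open_continuous:
  assumes "C_k_open 2 h O'"
  shows "continuous_on O' h" "continuous_on O' (partial_deriv i h)"
  using differentiable_imp_continuous_within[OF C2_openD(1)[OF assms]]
    differentiable_imp_continuous_within[OF C2_openD(2)[OF assms]]
  by (auto intro!: continuous_at_imp_continuous_on)

lemma second_order_taylor:
  fixes h :: "real^'n::finite \<Rightarrow> real"
  assumes C2: "C_k_open 2 h O'" and seg: "\<And>t. 0 \<le> t \<Longrightarrow> t \<le> 1 \<Longrightarrow> y + t *\<^sub>R z \<in> O'"
  obtains \<theta> where "0 \<le> \<theta>" "\<theta> \<le> 1"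
    "h (y + z) = h y + (\<Sum>i\<in>UNIV. partial_deriv i h y * z $ i)
      + 1/2 * (\<Sum>i\<in>UNIV. \<Sum>j\<in>UNIV. partial_deriv i (partial_deriv j h) (y + \<theta> *\<^sub>R z) * (z $ i * z $ j))"
proof -
  \<comment> \<open>\<open>diff m\<close> is the \<open>m\<close>-th derivative of \<open>h\<close>
    along the segment for \<open>m\<close> at most 2; in the last case the order of summation is
    opposite to that of the claim.\<close>
  define diff where "diff = (\<lambda>(m::nat) t. if m = 0 then h (y + t *\<^sub>R z)
    else if m = 1 then (\<Sum>i\<in>UNIV. partial_deriv i h (y + t *\<^sub>R z) * z $ i)
    else (\<Sum>j\<in>UNIV. (\<Sum>i\<in>UNIV. partial_deriv i (partial_deriv j h) (y + t *\<^sub>R z) * z $ i) * z $ j))"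
  have "\<exists>t. (if (1::real) < 0 then 1 < t \<and> t < 0 else 0 < t \<and> t < 1) \<and>
    diff 0 1 = (\<Sum>m<2. diff m 0 / fact m * (1 - 0) ^ m) + diff 2 t / fact 2 * (1 - 0) ^ 2"
  proof (rule Taylor[where a=0 and b=1])
    show "\<forall>m t. m < 2 \<and> 0 \<le> t \<and> t \<le> 1 \<longrightarrow> (diff m has_real_derivative diff (Suc m) t) (at t)"
    proof (intro allI impI, elim conjE)
      fix m :: nat and t :: real assume m: "m < 2" and t: "0 \<le> t" "t \<le> 1"
      consider "m = 0" | "m = 1" using m by linarith
      then show "(diff m has_real_derivative diff (Suc m) t) (at t)"
      proof cases
        case 1
        then show ?thesis
          using partial_deriv_line[OF C2_openD(1)[OF C2 seg[OF t]]] by (simp add: diff_def)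
      next
        case 2
        have "((\<lambda>t. \<Sum>j\<in>UNIV. partial_deriv j h (y + t *\<^sub>R z) * z $ j) has_real_derivative
          (\<Sum>j\<in>UNIV. (\<Sum>i\<in>UNIV. partial_deriv i (partial_deriv j h) (y + t *\<^sub>R z) * z $ i) * z $ j)) (at t)"
          by (intro DERIV_sum DERIV_cmult_right partial_deriv_line C2_openD(2)[OF C2 seg[OF t]])
        then show ?thesis using 2 by (simp add: diff_def)
      qed
    qed
  qed auto
  then obtain t where t: "0 < t" "t < 1" and
    eq: "diff 0 1 = diff 0 0 + diff 1 0 + diff 2 t / 2"
    by (auto simp: lessThan_Suc numeral_2_eq_2)
  have d2: "diff 2 t = (\<Sum>i\<in>UNIV. \<Sum>j\<in>UNIV. partial_deriv i (partial_deriv j h) (y + t *\<^sub>R z) * (z $ i * z $ j))"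
    unfolding diff_def by (subst sum.swap) (simp add: sum_distrib_right mult.assoc)
  show ?thesis
    by (rule that[of t]) (use t eq d2 in \<open>simp_all add: diff_def\<close>)
qed

lemma quadratic_form_bound:
  fixes z z' :: "real^'n::finite"
  assumes "\<And>i j. \<bar>q i j\<bar> \<le> L"
  shows "\<bar>\<Sum>i\<in>UNIV. \<Sum>j\<in>UNIV. q i j * (z $ i * z' $ j)\<bar> \<le> (real CARD('n))\<^sup>2 * L * (norm z * norm z')"
proof -
  have "\<bar>\<Sum>i\<in>UNIV. \<Sum>j\<in>UNIV. q i j * (z $ i * z' $ j)\<bar> \<le> (\<Sum>i\<in>(UNIV::'n set). \<Sum>j\<in>(UNIV::'n set). L * (norm z * norm z'))"
  proof (intro order_trans[OF sum_abs] sum_mono)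
    fix i j
    have "\<bar>z $ i\<bar> \<le> norm z" "\<bar>z' $ j\<bar> \<le> norm z'"
      by (simp_all add: component_le_norm_cart)
    then have "\<bar>q i j\<bar> * (\<bar>z $ i\<bar> * \<bar>z' $ j\<bar>) \<le> L * (norm z * norm z')"
      using assms[of i j] by (intro mult_mono) auto
    then show "\<bar>q i j * (z $ i * z' $ j)\<bar> \<le> L * (norm z * norm z')"
      by (simp add: abs_mult)
  qed
  also have "\<dots> = (real CARD('n))\<^sup>2 * L * (norm z * norm z')"
    by (simp add: power2_eq_square)
  finally show ?thesis .
qed

lemma linear_form_bound:
  fixes z :: "real^'n::finite"
  assumes "\<And>i. \<bar>p i\<bar> \<le> L"
  shows "\<bar>\<Sum>i\<in>UNIV. p i * z $ i\<bar> \<le> real CARD('n) * L * norm z"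
proof -
  have "\<bar>\<Sum>i\<in>UNIV. p i * z $ i\<bar> \<le> (\<Sum>i\<in>(UNIV::'n set). L * norm z)"
  proof (intro order_trans[OF sum_abs] sum_mono)
    fix i
    have "\<bar>p i\<bar> * \<bar>z $ i\<bar> \<le> L * norm z"
      using assms[of i] component_le_norm_cart[of z i] by (intro mult_mono) auto
    then show "\<bar>p i * z $ i\<bar> \<le> L * norm z" by (simp add: abs_mult)
  qed
  then show ?thesis by simp
qed

lemma C2_bounded_on_compact:
  fixes h :: "real^'n::finite \<Rightarrow> real"
  assumes C2: "C_k_open 2 h O'" and K: "compact K" "K \<subseteq> O'"
  obtains L where "0 \<le> L" "\<And>x. x \<in> K \<Longrightarrow> \<bar>h x\<bar> \<le> L" "\<And>x i. x \<in> K \<Longrightarrow> \<bar>partial_deriv i h x\<bar> \<le> L"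
    "\<And>x i j. x \<in> K \<Longrightarrow> \<bar>partial_deriv i (partial_deriv j h) x\<bar> \<le> L"
proof -
  \<comment> \<open>Collecting the function and its derivatives in one continuous map yields a
    single bound for all of them.\<close>
  define \<Psi> where "\<Psi> = (\<lambda>x. (h x, (\<chi> i. partial_deriv i h x) :: real^'n, (\<chi> i j. partial_deriv i (partial_deriv j h) x) :: real^'n^'n))"
  have "continuous_on K \<Psi>"
    unfolding \<Psi>_def
    by (intro continuous_on_Pair continuous_on_vec_lambda continuous_on_subset[OF _ K(2)]
        C2_open_continuous[OF C2] C2_openD(3)[OF C2])
  then have "bounded (\<Psi> ` K)"
    using K(1) compact_continuous_image compact_imp_bounded by blast
  then obtain L where L: "0 < L" "\<And>x. x \<in> K \<Longrightarrow> norm (\<Psi> x) \<le> L"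
    unfolding bounded_pos by auto
  have 1: "norm (fst w) \<le> norm w" "norm (fst (snd w)) \<le> norm w" "norm (snd (snd w)) \<le> norm w" for w :: "real \<times> (real^'n) \<times> (real^'n^'n)"
    using norm_fst_le[of "fst w" "snd w"] norm_snd_le[of "snd w" "fst w"] norm_fst_le[of "fst (snd w)" "snd (snd w)"] norm_snd_le[of "snd (snd w)" "fst (snd w)"]
    by auto
  show ?thesis
  proof (rule that[of L])
    fix x i j assume x: "x \<in> K"
    show "\<bar>h x\<bar> \<le> L" using 1(1)[of "\<Psi> x"] L(2)[OF x] by (simp add: \<Psi>_def)
    show "\<bar>partial_deriv i h x\<bar> \<le> L"
      using component_le_norm_cart[of "fst (snd (\<Psi> x))" i] 1(2)[of "\<Psi> x"] L(2)[OF x] by (simp add: \<Psi>_def)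
    have "\<bar>snd (snd (\<Psi> x)) $ i $ j\<bar> \<le> norm (snd (snd (\<Psi> x)))"
      using component_le_norm_cart[of "snd (snd (\<Psi> x)) $ i" j] Finite_Cartesian_Product.norm_nth_le[of "snd (snd (\<Psi> x))" i] by linarith
    then show "\<bar>partial_deriv i (partial_deriv j h) x\<bar> \<le> L"
      using 1(3)[of "\<Psi> x"] L(2)[OF x] by (simp add: \<Psi>_def)
  qed (use L in auto)
qed

text \<open>
  For increments longer than \<open>\<delta>\<close> the quartic term absorbs the jump of the function that is cut off
  outside \<open>K\<close>.
\<close>

lemma taylor_cutoff:
  fixes h :: "real^'n::finite \<Rightarrow> real"
  assumes C2: "C_k_open 2 h O'" and K: "compact K" "K \<subseteq> O'" and w: "0 < w"
  obtains \<delta>1 where "0 < \<delta>1" "\<And>\<delta>. 0 < \<delta> \<Longrightarrow> \<delta> \<le> \<delta>1 \<Longrightarrow> \<exists>C\<ge>0. \<forall>y z. cball y \<delta> \<subseteq> K \<longrightarrow>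
     \<bar>(if y + z \<in> K then h (y + z) else 0) - h y - (\<Sum>i\<in>UNIV. partial_deriv i h y * z $ i)
      - 1/2 * (\<Sum>i\<in>UNIV. \<Sum>j\<in>UNIV. partial_deriv i (partial_deriv j h) y * (z $ i * z $ j))\<bar> \<le> w * (norm z)\<^sup>2 + C * (norm z)^4"
proof -
  define n where "n = real CARD('n)"
  have n: "1 \<le> n" unfolding n_def by simp
  obtain L where L: "0 \<le> L" "\<And>x. x \<in> K \<Longrightarrow> \<bar>h x\<bar> \<le> L" "\<And>x i. x \<in> K \<Longrightarrow> \<bar>partial_deriv i h x\<bar> \<le> L"
    "\<And>x i j. x \<in> K \<Longrightarrow> \<bar>partial_deriv i (partial_deriv j h) x\<bar> \<le> L"
    using C2_bounded_on_compact[OF C2 K] by blast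
  define H where "H = (\<lambda>x. (\<chi> i j. partial_deriv i (partial_deriv j h) x) :: real^'n^'n)"
  have "continuous_on K H"
    unfolding H_def by (intro continuous_on_vec_lambda continuous_on_subset[OF _ K(2)] C2_openD(3)[OF C2])
  then have "uniformly_continuous_on K H"
    by (rule compact_uniformly_continuous) (rule K)
  moreover have "0 < w / n\<^sup>2" using w n by (intro divide_pos_pos) auto
  ultimately obtain \<delta>1 where d1: "0 < \<delta>1" "\<And>x x'. x \<in> K \<Longrightarrow> x' \<in> K \<Longrightarrow> dist x' x < \<delta>1 \<Longrightarrow> dist (H x') (H x) < w / n\<^sup>2"
    unfolding uniformly_continuous_on_def by metis
  show ?thesis
  \<comment> \<open>Halving makes distances up to \<open>\<delta>\<close> strictly smaller than the
    modulus \<open>\<delta>1\<close> of uniform continuity.\<close>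
  proof (rule that[of "\<delta>1/2"])
    fix \<delta> assume \<delta>: "0 < \<delta>" "\<delta> \<le> \<delta>1/2"
    \<comment> \<open>The three summands bound the difference of values, the linear and the
      quadratic term when \<open>norm z\<close> exceeds \<open>\<delta>\<close>: with
      \<open>r = norm z / \<delta>\<close> at least 1, each lower power of \<open>r\<close> is at
      most \<open>r^4\<close>.\<close>
    define C where "C = 2 * L / \<delta>^4 + n * L / \<delta>^3 + n\<^sup>2 * L / \<delta>\<^sup>2"
    have "0 \<le> C" unfolding C_def using L \<delta> n by auto
    moreover have "\<bar>(if y + z \<in> K then h (y + z) else 0) - h y - (\<Sum>i\<in>UNIV. partial_deriv i h y * z $ i)
      - 1/2 * (\<Sum>i\<in>UNIV. \<Sum>j\<in>UNIV. partial_deriv i (partial_deriv j h) y * (z $ i * z $ j))\<bar> \<le> w * (norm z)\<^sup>2 + C * (norm z)^4"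
      (is "\<bar>?\<phi> - h y - ?P - 1/2 * ?Q\<bar> \<le> _")
      if y: "cball y \<delta> \<subseteq> K" for y z :: "real^'n"
    proof (cases "norm z \<le> \<delta>")
      case True
      have yK: "y \<in> K" using y \<delta> by auto
      have seg: "y + t *\<^sub>R z \<in> K" if "0 \<le> t" "t \<le> 1" for t
      proof -
        have "t * norm z \<le> 1 * \<delta>" using that True by (intro mult_mono) auto
        then show ?thesis using y that by (auto simp: dist_norm)
      qed
      obtain \<theta> where th: "0 \<le> \<theta>" "\<theta> \<le> 1" and eq: "h (y + z) = h y + ?P
        + 1/2 * (\<Sum>i\<in>UNIV. \<Sum>j\<in>UNIV. partial_deriv i (partial_deriv j h) (y + \<theta> *\<^sub>R z) * (z $ i * z $ j))"
        using second_order_taylor[OF C2, of y z] seg K(2) by blast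
      have "?\<phi> = h (y + z)" using seg[of 1] by simp
      then have "?\<phi> - h y - ?P - 1/2 * ?Q = 1/2 * (\<Sum>i\<in>UNIV. \<Sum>j\<in>UNIV. (partial_deriv i (partial_deriv j h) (y + \<theta> *\<^sub>R z) - partial_deriv i (partial_deriv j h) y) * (z $ i * z $ j))"
        by (simp add: eq left_diff_distrib sum_subtractf algebra_simps)
      also have "\<bar>\<dots>\<bar> \<le> 1/2 * (n\<^sup>2 * (w / n\<^sup>2) * (norm z * norm z))"
      proof -
        have "\<theta> * norm z \<le> 1 * \<delta>" using th True by (intro mult_mono) auto
        then have "dist (y + \<theta> *\<^sub>R z) y < \<delta>1" using th \<delta> d1(1) by (simp add: dist_norm)
        then have dH: "norm (H (y + \<theta> *\<^sub>R z) - H y) < w / n\<^sup>2"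
          using d1(2)[OF yK seg[OF th]] by (simp add: dist_norm)
        have "\<bar>partial_deriv i (partial_deriv j h) (y + \<theta> *\<^sub>R z) - partial_deriv i (partial_deriv j h) y\<bar> \<le> w / n\<^sup>2" for i j
        proof -
          have "\<bar>(H (y + \<theta> *\<^sub>R z) - H y) $ i $ j\<bar> \<le> norm (H (y + \<theta> *\<^sub>R z) - H y)"
            using component_le_norm_cart[of "(H (y + \<theta> *\<^sub>R z) - H y) $ i" j] Finite_Cartesian_Product.norm_nth_le[of "H (y + \<theta> *\<^sub>R z) - H y" i] by linarith
          then show ?thesis using dH by (simp add: H_def)
        qed
        from quadratic_form_bound[of "\<lambda>i j. partial_deriv i (partial_deriv j h) (y + \<theta> *\<^sub>R z) - partial_deriv i (partial_deriv j h) y", OF this, of z z]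
        show ?thesis by (simp add: n_def abs_mult)
      qed
      also have "\<dots> \<le> w * (norm z)\<^sup>2"
        using n w by (simp add: power2_eq_square)
      also have "\<dots> \<le> w * (norm z)\<^sup>2 + C * (norm z)^4" using \<open>0 \<le> C\<close> by simp
      finally show ?thesis .
    next
      case False
      have yK: "y \<in> K" using y \<delta> by auto
      define r where "r = norm z / \<delta>"
      have r: "1 \<le> r" "norm z = r * \<delta>" using False \<delta> by (auto simp: r_def)
      have "\<bar>?\<phi>\<bar> \<le> L" "\<bar>h y\<bar> \<le> L" using L yK by auto
      moreover have "\<bar>?P\<bar> \<le> n * L * norm z" unfolding n_def by (rule linear_form_bound) (rule L(3)[OF yK])
      moreover have "\<bar>?Q\<bar> \<le> n\<^sup>2 * L * (norm z * norm z)" unfolding n_def by (rule quadratic_form_bound) (rule L(4)[OF yK])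
      ultimately have "\<bar>?\<phi> - h y - ?P - 1/2 * ?Q\<bar> \<le> 2 * L + n * L * norm z + n\<^sup>2 * L * (norm z * norm z)"
        by linarith
      also have "\<dots> = 2 * L * 1 + n * L * \<delta> * r + n\<^sup>2 * L * \<delta>\<^sup>2 * r\<^sup>2"
        by (simp add: r(2) power2_eq_square)
      also have "\<dots> \<le> 2 * L * r^4 + n * L * \<delta> * r^4 + n\<^sup>2 * L * \<delta>\<^sup>2 * r^4"
        using r(1) L(1) n \<delta> by (intro add_mono mult_left_mono power_increasing one_le_power self_le_power mult_nonneg_nonneg) auto
      also have "\<dots> = C * (norm z)^4"
        using \<delta> unfolding C_def r(2) by (simp add: field_simps eval_nat_numeral)
      also have "\<dots> \<le> w * (norm z)\<^sup>2 + C * (norm z)^4" using w by simp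
      finally show ?thesis .
    qed
    ultimately show "\<exists>C\<ge>0. \<forall>y z. cball y \<delta> \<subseteq> K \<longrightarrow>
     \<bar>(if y + z \<in> K then h (y + z) else 0) - h y - (\<Sum>i\<in>UNIV. partial_deriv i h y * z $ i)
      - 1/2 * (\<Sum>i\<in>UNIV. \<Sum>j\<in>UNIV. partial_deriv i (partial_deriv j h) y * (z $ i * z $ j))\<bar> \<le> w * (norm z)\<^sup>2 + C * (norm z)^4"
      by blast
  qed (use d1 in auto)
qed

text \<open>\<open>P\<close> says that the process has not been stopped yet, so it can only turn
  from true to false. The sum telescopes up to the stopping index \<open>\<nu>\<close>, the first
  failure of \<open>P\<close> or else \<open>N\<close>.\<close>

lemma stopped_telescope:
  fixes a :: "nat \<Rightarrow> real"
  assumes "\<And>k. P (Suc k) \<Longrightarrow> P k"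
  shows "\<exists>\<nu>\<le>N. (\<forall>k<\<nu>. P k) \<and> (\<nu> < N \<longrightarrow> \<not> P \<nu>) \<and> (\<Sum>k<N. if P k then a (Suc k) - a k else 0) = a \<nu> - a 0"
proof (induction N)
  case (Suc N)
  then obtain \<nu> where v: "\<nu> \<le> N" "\<forall>k<\<nu>. P k" "\<nu> < N \<longrightarrow> \<not> P \<nu>" "(\<Sum>k<N. if P k then a (Suc k) - a k else 0) = a \<nu> - a 0"
    by auto
  have up: "P k" if "P m" "k \<le> m" for k m
    using that(2,1) by (induction m) (auto simp: le_Suc_eq dest: assms)
  show ?case
  proof (cases "P N")
    case True
    then have "\<nu> = N" using v up[OF True, of \<nu>] by (auto simp: le_less)
    then show ?thesis using v True by (intro exI[of _ "Suc N"]) (auto simp: less_Suc_eq)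
  next
    case False
    then show ?thesis using v by (intro exI[of _ \<nu>]) (auto simp: le_less)
  qed
qed auto

section \<open>The error of a single Euler step\<close>

lemma norm_matrix_vector_le:
  fixes a :: "real^'d::finite^'n::finite"
  shows "norm (a *v v) \<le> norm a * norm v"
proof (rule power2_le_imp_le)
  have "(norm (a *v v))\<^sup>2 = (\<Sum>i\<in>UNIV. (inner (a $ i) v)\<^sup>2)"
    by (simp add: norm_sq_vec matrix_mult_dot)
  also have "\<dots> \<le> (\<Sum>i\<in>UNIV. (norm (a $ i) * norm v)\<^sup>2)"
    by (intro sum_mono power2_mono) (simp add: Cauchy_Schwarz_ineq2)
  also have "\<dots> = (norm a * norm v)\<^sup>2"
    by (simp add: power_mult_distrib sum_distrib_right[symmetric] norm_sq_mat norm_sq_vec)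
  finally show "(norm (a *v v))\<^sup>2 \<le> (norm a * norm v)\<^sup>2" .
qed simp

text \<open>A step consists of a drift \<open>\<beta>\<close> of order \<open>dt\<close> and a noise
  \<open>a *v v\<close> of order \<open>sqrt dt\<close>. Kept are the drift and the first and second
  order of the noise; quadratic terms that involve \<open>\<beta>\<close> are at most of order
  \<open>dt * sqrt dt\<close> on average and join the error. Summed over \<open>T / dt\<close>
  steps, the error retains the small factors \<open>w\<close>, \<open>sqrt dt\<close> and
  \<open>dt\<close>.\<close>

lemma euler_step_bound:
  fixes \<beta> :: "real^'n::finite" and a :: "real^'d::finite^'n" and v :: "real^'d"
  assumes q: "\<And>i j. \<bar>q i j\<bar> \<le> L" "0 \<le> L" and \<beta>: "norm \<beta> \<le> C1 * dt" and a: "norm a \<le> C1"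
    and dt: "0 < dt" "dt \<le> 1" and w: "0 \<le> w" and C: "0 \<le> C"
    and taylor: "\<bar>\<phi> - y - (\<Sum>i\<in>UNIV. p i * (\<beta> + a *v v) $ i)
      - 1/2 * (\<Sum>i\<in>UNIV. \<Sum>j\<in>UNIV. q i j * ((\<beta> + a *v v) $ i * (\<beta> + a *v v) $ j))\<bar>
      \<le> w * (norm (\<beta> + a *v v))\<^sup>2 + C * (norm (\<beta> + a *v v))^4"
  shows "\<phi> - y \<ge> (\<Sum>i\<in>UNIV. p i * \<beta> $ i) + (\<Sum>i\<in>UNIV. p i * (a *v v) $ i)
      + 1/2 * (\<Sum>i\<in>UNIV. \<Sum>j\<in>UNIV. q i j * ((a *v v) $ i * (a *v v) $ j))
      - ((2 * C1\<^sup>2 + 2 * (real CARD('n))\<^sup>2 * L * C1\<^sup>2) * (w + sqrt dt) * (dt + (norm v)\<^sup>2) + 8 * C * C1^4 * (dt\<^sup>2 + (norm v)^4))"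
proof -
  define n where "n = real CARD('n)"
  define N where "N = norm v"
  define av where "av = a *v v"
  have C1: "0 \<le> C1" using a norm_ge_zero[of a] by linarith
  have nv: "norm av \<le> C1 * N"
    unfolding av_def N_def using a by (intro order_trans[OF norm_matrix_vector_le] mult_right_mono) auto
  define Q where "Q = (\<lambda>x y :: real^'n. \<Sum>i\<in>UNIV. \<Sum>j\<in>UNIV. q i j * (x $ i * y $ j))"
  have Qb: "\<bar>Q x y\<bar> \<le> n\<^sup>2 * L * (norm x * norm y)" for x y
    unfolding Q_def n_def by (rule quadratic_form_bound) (rule q)
  have Qe: "Q (\<beta> + av) (\<beta> + av) = Q av av + Q \<beta> av + Q av \<beta> + Q \<beta> \<beta>"
    unfolding Q_def by (simp add: sum.distrib algebra_simps)
  have pe: "(\<Sum>i\<in>UNIV. p i * (\<beta> + av) $ i) = (\<Sum>i\<in>UNIV. p i * \<beta> $ i) + (\<Sum>i\<in>UNIV. p i * av $ i)"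
    by (simp add: sum.distrib algebra_simps)
  \<comment> \<open>With \<open>X = dt + N^2\<close> one has
    \<open>2 * s * N \<le> s^2 + N^2 = X\<close>, so a mixed term \<open>dt * N\<close> costs at
    most \<open>s * X / 2\<close>.\<close>
  define s where "s = sqrt dt"
  define X where "X = dt + N\<^sup>2"
  have s: "0 \<le> s" "s\<^sup>2 = dt" "dt \<le> s" using dt by (auto simp: s_def real_le_rsqrt power2_eq_square mult_le_one mult_left_le)
  have N0: "0 \<le> N" by (simp add: N_def)
  have X: "dt \<le> X" "N\<^sup>2 \<le> X" "0 \<le> X" using dt by (auto simp: X_def)
  have sN: "s * N \<le> X / 2" using sum_squares_bound[of s N] s by (simp add: X_def)
  have dN: "dt * N \<le> s * X / 2"
    using mult_left_mono[OF sN s(1)] by (simp add: s(2)[symmetric] power2_eq_square mult.assoc)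
  have dd: "dt * dt \<le> s * X" using s X dt by (intro mult_mono) auto
  have bm: "norm \<beta> * norm av \<le> C1\<^sup>2 * (s * X / 2)"
  proof -
    have "norm \<beta> * norm av \<le> (C1 * dt) * (C1 * N)" using \<beta> nv C1 dt by (intro mult_mono) auto
    also have "\<dots> = C1\<^sup>2 * (dt * N)" by (simp add: power2_eq_square)
    also have "\<dots> \<le> C1\<^sup>2 * (s * X / 2)" using dN by (intro mult_left_mono) auto
    finally show ?thesis .
  qed
  have bb0: "norm \<beta> * norm \<beta> \<le> C1\<^sup>2 * (dt * dt)"
    using mult_mono[OF \<beta> \<beta>] C1 dt by (simp add: power2_eq_square mult_ac)
  have bb: "norm \<beta> * norm \<beta> \<le> C1\<^sup>2 * (s * X)"
    by (rule order_trans[OF bb0]) (intro mult_left_mono dd zero_le_power2)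
  have mm: "norm av * norm av \<le> C1\<^sup>2 * N\<^sup>2"
    using mult_mono[OF nv nv] C1 N0 by (simp add: power2_eq_square mult_ac)
  have cross: "\<bar>Q \<beta> av + Q av \<beta> + Q \<beta> \<beta>\<bar> \<le> n\<^sup>2 * L * (2 * (C1\<^sup>2 * (s * X)))"
  proof -
    have "\<bar>Q \<beta> av + Q av \<beta> + Q \<beta> \<beta>\<bar> \<le> n\<^sup>2 * L * (norm \<beta> * norm av) + n\<^sup>2 * L * (norm \<beta> * norm av) + n\<^sup>2 * L * (norm \<beta> * norm \<beta>)"
      using Qb[of \<beta> av] Qb[of av \<beta>, unfolded mult.commute[of "norm av"]] Qb[of \<beta> \<beta>] by linarith
    also have "\<dots> = n\<^sup>2 * L * (2 * (norm \<beta> * norm av) + norm \<beta> * norm \<beta>)" by (simp add: algebra_simps)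
    also have "\<dots> \<le> n\<^sup>2 * L * (2 * (C1\<^sup>2 * (s * X)))"
      using bm bb q(2) by (intro mult_left_mono) auto
    finally show ?thesis .
  qed
  have z: "norm (\<beta> + av) \<le> norm \<beta> + norm av" by (rule norm_triangle_ineq)
  have sq: "(norm (\<beta> + av))\<^sup>2 \<le> 2 * (norm \<beta> * norm \<beta> + norm av * norm av)"
    using power_mono[OF z, of 2] sum_squares_bound[of "norm \<beta>" "norm av"] by (simp add: power2_eq_square algebra_simps)
  have e1: "w * (norm (\<beta> + av))\<^sup>2 \<le> w * (2 * (C1\<^sup>2 * X))"
  proof (rule mult_left_mono[OF _ w])
    have "C1\<^sup>2 * (dt * dt) \<le> C1\<^sup>2 * dt" using dt by (intro mult_left_mono mult_left_le) auto
    then show "(norm (\<beta> + av))\<^sup>2 \<le> 2 * (C1\<^sup>2 * X)"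
      using sq bb0 mm by (simp add: X_def algebra_simps)
  qed
  \<comment> \<open>Squaring the bound \<open>sq\<close> gives a factor 4 and one more use of
    \<open>(x + y)^2 \<le> 2 * x^2 + 2 * y^2\<close> makes it 8; \<open>dt \<le> 1\<close> allows
    \<open>dt^4 \<le> dt^2\<close>.\<close>
  have e2: "C * (norm (\<beta> + av))^4 \<le> C * (8 * (C1^4 * (dt\<^sup>2 + N^4)))"
  proof (rule mult_left_mono[OF _ C])
    have "(norm (\<beta> + av))^4 = ((norm (\<beta> + av))\<^sup>2)\<^sup>2" by simp
    also have "\<dots> \<le> (2 * (C1\<^sup>2 * (dt * dt) + C1\<^sup>2 * N\<^sup>2))\<^sup>2"
      using sq bb0 mm by (intro power_mono) auto
    also have "\<dots> = 4 * (C1^4 * (dt\<^sup>2 + N\<^sup>2)\<^sup>2)" by (simp add: power2_eq_square algebra_simps eval_nat_numeral)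
    also have "\<dots> \<le> 4 * (C1^4 * (2 * (dt\<^sup>2 + N^4)))"
    proof (intro mult_left_mono)
      have "(dt\<^sup>2 + N\<^sup>2)\<^sup>2 \<le> 2 * ((dt\<^sup>2)\<^sup>2 + (N\<^sup>2)\<^sup>2)"
        using sum_squares_bound[of "dt\<^sup>2" "N\<^sup>2"] by (simp add: power2_sum)
      moreover have "(dt\<^sup>2)\<^sup>2 \<le> dt\<^sup>2" using dt power_le_one[of dt 2] by (simp add: power2_eq_square mult_left_le)
      ultimately show "(dt\<^sup>2 + N\<^sup>2)\<^sup>2 \<le> 2 * (dt\<^sup>2 + N^4)" by simp
    qed (use C1 in auto)
    also have "\<dots> = 8 * (C1^4 * (dt\<^sup>2 + N^4))" by (simp add: algebra_simps)
    finally show "(norm (\<beta> + av))^4 \<le> 8 * (C1^4 * (dt\<^sup>2 + N^4))" .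
  qed
  have e3: "n\<^sup>2 * L * (C1\<^sup>2 * (s * X)) + w * (2 * (C1\<^sup>2 * X)) \<le> (2 * C1\<^sup>2 + 2 * n\<^sup>2 * L * C1\<^sup>2) * (w + s) * X"
  proof -
    have "0 \<le> n\<^sup>2 * L * (C1\<^sup>2 * (s * X))" "0 \<le> n\<^sup>2 * L * C1\<^sup>2 * (w * X)" "0 \<le> C1\<^sup>2 * (s * X)"
      using q(2) s X w by auto
    then show ?thesis by (simp add: algebra_simps)
  qed
  have main: "\<phi> - y \<ge> (\<Sum>i\<in>UNIV. p i * (\<beta> + av) $ i) + 1/2 * Q (\<beta> + av) (\<beta> + av) - (w * (norm (\<beta> + av))\<^sup>2 + C * (norm (\<beta> + av))^4)"
    using taylor unfolding av_def[symmetric] Q_def by linarith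
  have cc: "8 * C * C1^4 * (dt\<^sup>2 + N^4) = C * (8 * (C1^4 * (dt\<^sup>2 + N^4)))" by simp
  have "\<phi> - y \<ge> (\<Sum>i\<in>UNIV. p i * \<beta> $ i) + (\<Sum>i\<in>UNIV. p i * av $ i) + 1/2 * Q av av
      - ((2 * C1\<^sup>2 + 2 * n\<^sup>2 * L * C1\<^sup>2) * (w + s) * X + 8 * C * C1^4 * (dt\<^sup>2 + N^4))"
  proof -
    have "Q \<beta> av + Q av \<beta> + Q \<beta> \<beta> \<ge> - (2 * (n\<^sup>2 * L * (C1\<^sup>2 * (s * X))))"
      using cross by (simp add: abs_le_iff mult.left_commute)
    moreover have "1/2 * (Q av av + Q \<beta> av + Q av \<beta> + Q \<beta> \<beta>) = 1/2 * Q av av + 1/2 * (Q \<beta> av + Q av \<beta> + Q \<beta> \<beta>)"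
      by simp
    note m = main[unfolded Qe pe this add.assoc[symmetric]]
    moreover have comb: "u - (E + G) \<le> y" if "A \<le> W" "B \<le> G" "E0 + W \<le> E" "u + 1/2 * R - (A + B) \<le> y" "R \<ge> - (2 * E0)"
      for A B E E0 G R W u y :: real using that by linarith
    ultimately show ?thesis
      unfolding cc by (intro comb[OF e1 e2 e3]) (auto simp: add.assoc)
  qed
  then show ?thesis
    unfolding av_def s_def n_def N_def X_def Q_def .
qed

section \<open>The controlled diffusion and its Euler approximation\<close>

lemma jointly_measurable_set_integrable:
  fixes A :: "real \<Rightarrow> 'w \<Rightarrow> 'b::euclidean_space"
  assumes jm: "jointly_measurable N t A" "\<omega> \<in> space N" and sub: "{a..b} \<subseteq> {0..t}"
    and bnd: "\<And>s. s \<in> {a..b} \<Longrightarrow> norm (A s \<omega>) \<le> K"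
  shows "set_integrable lborel {a..b} (\<lambda>s. A s \<omega>)"
  unfolding set_integrable_def
proof (rule Bochner_Integration.integrable_bound)
  show "integrable lborel (\<lambda>s. indicator {a..b} s * \<bar>K\<bar> :: real)"
    by (intro integrable_mult_left integrable_real_indicator) (simp_all add: emeasure_lborel_Icc_eq)
  have "(\<lambda>s. indicator {a..b} s *\<^sub>R (indicator {0..t} s *\<^sub>R A s \<omega>)) \<in> borel_measurable borel"
    by (intro borel_measurable_scaleR jointly_measurable_section[OF jm] borel_measurable_indicator) simp
  also have "(\<lambda>s. indicator {a..b} s *\<^sub>R (indicator {0..t} s *\<^sub>R A s \<omega>)) = (\<lambda>s. indicator {a..b} s *\<^sub>R A s \<omega>)"
    using sub by (intro ext) (auto simp: indicator_def)
  finally show "(\<lambda>s. indicator {a..b} s *\<^sub>R A s \<omega>) \<in> borel_measurable lborel" by simp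
  show "AE s in lborel. norm (indicator {a..b} s *\<^sub>R A s \<omega>) \<le> norm (indicator {a..b} s * \<bar>K\<bar> :: real)"
    by (intro AE_I2) (auto simp: indicator_def intro!: order_trans[OF bnd abs_ge_self])
qed

text \<open>Fubini's theorem for a general \<open>N\<close>. Taken with \<open>F t\<close>, it shows
  that an integral up to time \<open>t\<close> is known at time \<open>t\<close>.\<close>

lemma jointly_measurable_integral:
  fixes A :: "real \<Rightarrow> 'w \<Rightarrow> 'b::euclidean_space"
  assumes jm: "jointly_measurable N t A" and sub: "{a..b} \<subseteq> {0..t}"
  shows "(\<lambda>\<omega>. LINT s:{a..b}|lborel. A s \<omega>) \<in> borel_measurable N"
proof -
  define R where "R = restrict_space lborel {0..t}"
  interpret R: sigma_finite_measure R
    unfolding R_def by (intro sigma_finite_measure_restrict_space) (auto intro: sigma_finite_lborel)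
  have sR: "sets R = sets (restrict_space borel {0..t})"
    unfolding R_def by (intro sets_restrict_space_cong) simp
  have A: "(\<lambda>p. A (fst p) (snd p)) \<in> borel_measurable (R \<Otimes>\<^sub>M N)"
    using jm unfolding jointly_measurable_def
    by (simp add: case_prod_beta' cong: measurable_cong_sets sets_pair_measure_cong[OF sR refl])
  have sw: "(\<lambda>p. A (snd p) (fst p)) \<in> borel_measurable (N \<Otimes>\<^sub>M R)"
    using measurable_compose[OF measurable_pair_swap' A] by (simp add: case_prod_beta')
  have i: "(\<lambda>s. indicator {a..b} s :: real) \<in> borel_measurable R"
    unfolding R_def by (intro measurable_restrict_space1) simp
  have "(\<lambda>p. indicator {a..b} (snd p) *\<^sub>R A (snd p) (fst p)) \<in> borel_measurable (N \<Otimes>\<^sub>M R)"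
    by (intro borel_measurable_scaleR sw measurable_compose[OF measurable_snd i])
  then have "(\<lambda>\<omega>. \<integral>s. indicator {a..b} s *\<^sub>R A s \<omega> \<partial>R) \<in> borel_measurable N"
    by (intro R.borel_measurable_lebesgue_integral) (simp add: case_prod_beta')
  also have "(\<lambda>\<omega>. \<integral>s. indicator {a..b} s *\<^sub>R A s \<omega> \<partial>R) = (\<lambda>\<omega>. LINT s:{a..b}|lborel. A s \<omega>)"
  proof (intro ext)
    fix \<omega>
    have "(\<integral>s. indicator {a..b} s *\<^sub>R A s \<omega> \<partial>R) = (\<integral>s. indicator {0..t} s *\<^sub>R (indicator {a..b} s *\<^sub>R A s \<omega>) \<partial>lborel)"
      unfolding R_def by (subst integral_restrict_space) auto
    also have "\<dots> = (LINT s:{a..b}|lborel. A s \<omega>)"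
      unfolding set_lebesgue_integral_def using sub
      by (intro Bochner_Integration.integral_cong) (auto simp: indicator_def)
    finally show "(\<integral>s. indicator {a..b} s *\<^sub>R A s \<omega> \<partial>R) = (LINT s:{a..b}|lborel. A s \<omega>)" .
  qed
  finally show ?thesis .
qed

lemma jointly_measurable_affine:
  fixes A :: "real \<Rightarrow> 'w \<Rightarrow> real^'p::finite" and G :: "'w \<Rightarrow> real^'p^'n::finite"
  assumes jm: "jointly_measurable N t A" and b: "b \<in> borel_measurable N" and G: "G \<in> borel_measurable N"
  shows "jointly_measurable N t (\<lambda>s \<omega>. b \<omega> + G \<omega> *v A s \<omega>)"
proof -
  have "(\<lambda>p. b (snd p) + G (snd p) *v A (fst p) (snd p)) \<in> borel_measurable (restrict_space borel {0..t} \<Otimes>\<^sub>M N)"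
    using jm unfolding jointly_measurable_def case_prod_beta'
    by (intro borel_measurable_add measurable_matrix_vector measurable_compose[OF measurable_snd b] measurable_compose[OF measurable_snd G])
  then show ?thesis unfolding jointly_measurable_def case_prod_beta' .
qed

lemma sum_sq_le_card: "(\<Sum>i\<in>A. x i)\<^sup>2 \<le> real (card A) * (\<Sum>i\<in>A. (x i :: real)\<^sup>2)"
  using Cauchy_Schwarz_ineq_sum[of "\<lambda>_. 1" x A] by simp

section \<open>Moments of the noise over one step\<close>

context filtered_bm
begin

lemma increment_norm_moments:
  assumes st: "0 \<le> s" "s < t"
  shows "has_bochner_integral M (\<lambda>\<omega>. (norm (W t \<omega> - W s \<omega>))\<^sup>2) (real CARD('d) * (t - s))"
    and "integrable M (\<lambda>\<omega>. norm (W t \<omega> - W s \<omega>) ^ 4)"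
    and "expectation (\<lambda>\<omega>. norm (W t \<omega> - W s \<omega>) ^ 4) \<le> 3 * (real CARD('d))\<^sup>2 * (t - s)\<^sup>2"
proof -
  define D where "D = (\<lambda>\<omega>. W t \<omega> - W s \<omega>)"
  have Dm: "D \<in> borel_measurable M" unfolding D_def using st by (intro borel_measurable_diff W_measurable) auto
  have "has_bochner_integral M (\<lambda>\<omega>. \<Sum>i\<in>UNIV. D \<omega> $ i * D \<omega> $ i) (\<Sum>i\<in>(UNIV::'d set). t - s)"
    unfolding D_def using increment_covariance[OF st]
    by (intro has_bochner_integral_sum) (simp add: has_bochner_integral_iff)
  then show "has_bochner_integral M (\<lambda>\<omega>. (norm (W t \<omega> - W s \<omega>))\<^sup>2) (real CARD('d) * (t - s))"
    unfolding norm_sq_vec by (simp add: D_def power2_eq_square)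
  \<comment> \<open>Cauchy-Schwarz reduces the fourth moment of the norm to fourth moments of single
    coordinates, so that no mixed moments have to be computed.\<close>
  have le: "norm (D \<omega>) ^ 4 \<le> real CARD('d) * (\<Sum>i\<in>UNIV. (D \<omega> $ i)^4)" for \<omega>
  proof -
    have "norm (D \<omega>) ^ 4 = ((norm (D \<omega>))\<^sup>2)\<^sup>2" by simp
    also have "\<dots> \<le> real CARD('d) * (\<Sum>i\<in>UNIV. ((D \<omega> $ i)\<^sup>2)\<^sup>2)"
      unfolding norm_sq_vec by (rule sum_sq_le_card)
    finally show ?thesis by simp
  qed
  have b: "has_bochner_integral M (\<lambda>\<omega>. real CARD('d) * (\<Sum>i\<in>UNIV. (D \<omega> $ i)^4)) (real CARD('d) * (\<Sum>i\<in>(UNIV::'d set). 3 * (t - s)\<^sup>2))"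
    unfolding D_def using increment_coordinate(3,4)[OF st]
    by (intro has_bochner_integral_mult_right has_bochner_integral_sum) (simp add: has_bochner_integral_iff)
  have i: "integrable M (\<lambda>\<omega>. norm (D \<omega>) ^ 4)"
  proof (rule Bochner_Integration.integrable_bound)
    show "integrable M (\<lambda>\<omega>. real CARD('d) * (\<Sum>i\<in>UNIV. (D \<omega> $ i)^4))"
      using b by (simp add: has_bochner_integral_iff)
    show "(\<lambda>\<omega>. norm (D \<omega>) ^ 4) \<in> borel_measurable M"
      by (intro borel_measurable_power measurable_norm_comp Dm)
    show "AE \<omega> in M. norm (norm (D \<omega>) ^ 4) \<le> norm (real CARD('d) * (\<Sum>i\<in>UNIV. (D \<omega> $ i)^4))"
      using order_trans[OF le abs_ge_self] by (intro AE_I2) simp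
  qed
  then show "integrable M (\<lambda>\<omega>. norm (W t \<omega> - W s \<omega>) ^ 4)" by (simp add: D_def)
  have "expectation (\<lambda>\<omega>. norm (D \<omega>) ^ 4) \<le> expectation (\<lambda>\<omega>. real CARD('d) * (\<Sum>i\<in>UNIV. (D \<omega> $ i)^4))"
    using i b le by (intro integral_mono) (simp_all add: has_bochner_integral_iff)
  also have "\<dots> = 3 * (real CARD('d))\<^sup>2 * (t - s)\<^sup>2"
    using b by (simp add: has_bochner_integral_iff power2_eq_square)
  finally show "expectation (\<lambda>\<omega>. norm (W t \<omega> - W s \<omega>) ^ 4) \<le> 3 * (real CARD('d))\<^sup>2 * (t - s)\<^sup>2"
    by (simp add: D_def)
qed

text \<open>Coefficients known at time \<open>s\<close> are independent of the increment, which is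
  centred with covariance \<open>(t - s) I\<close>: the linear part has mean 0, and so has the
  quadratic part after subtraction of \<open>t - s\<close> times the trace. This is the martingale
  part of a second-order expansion.\<close>

lemma centered_quadratic_form:
  fixes \<alpha> :: "'d \<Rightarrow> 'w \<Rightarrow> real" and B :: "'d \<Rightarrow> 'd \<Rightarrow> 'w \<Rightarrow> real"
  assumes st: "0 \<le> s" "s < t"
    and \<alpha>: "\<And>j. \<alpha> j \<in> borel_measurable (F s)" "\<And>j \<omega>. \<omega> \<in> space M \<Longrightarrow> \<bar>\<alpha> j \<omega>\<bar> \<le> K"
    and B: "\<And>j k. B j k \<in> borel_measurable (F s)" "\<And>j k \<omega>. \<omega> \<in> space M \<Longrightarrow> \<bar>B j k \<omega>\<bar> \<le> K"
  defines "D \<equiv> \<lambda>\<omega>. W t \<omega> - W s \<omega>"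
  shows "has_bochner_integral M (\<lambda>\<omega>. (\<Sum>j\<in>UNIV. \<alpha> j \<omega> * D \<omega> $ j)
    + 1/2 * ((\<Sum>j\<in>UNIV. \<Sum>k\<in>UNIV. B j k \<omega> * (D \<omega> $ j * D \<omega> $ k)) - (t - s) * (\<Sum>j\<in>UNIV. B j j \<omega>))) 0"
proof -
  have bi: "integrable M q" if "q \<in> borel_measurable (F s)" "\<And>\<omega>. \<omega> \<in> space M \<Longrightarrow> \<bar>q \<omega>\<bar> \<le> K" for q :: "'w \<Rightarrow> real"
    using that(2) by (intro integrable_const_bound[where B=K] AE_I2 measurable_F_M[OF st(1) that(1)]) auto
  note ai = bi[OF \<alpha>] and Bi = bi[OF B]
  have 1: "has_bochner_integral M (\<lambda>\<omega>. \<Sum>j\<in>UNIV. \<alpha> j \<omega> * D \<omega> $ j) (\<Sum>j\<in>(UNIV::'d set). 0)"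
    unfolding D_def by (intro has_bochner_integral_sum has_integral_weighted_increment(1) st \<alpha>(1) ai)
  have 2: "has_bochner_integral M (\<lambda>\<omega>. \<Sum>j\<in>UNIV. \<Sum>k\<in>UNIV. B j k \<omega> * (D \<omega> $ j * D \<omega> $ k))
     (\<Sum>j\<in>UNIV. \<Sum>k\<in>UNIV. (if j = k then t - s else 0) * expectation (B j k))"
    unfolding D_def by (intro has_bochner_integral_sum has_integral_weighted_increment(2) st B(1) Bi)
  have 3: "has_bochner_integral M (\<lambda>\<omega>. (t - s) * (\<Sum>j\<in>UNIV. B j j \<omega>)) ((t - s) * (\<Sum>j\<in>UNIV. expectation (B j j)))"
    using Bi by (intro has_bochner_integral_mult_right has_bochner_integral_sum) (simp add: has_bochner_integral_iff)
  have e: "(\<Sum>j\<in>UNIV. \<Sum>k\<in>UNIV. (if j = k then t - s else 0) * expectation (B j k)) = (t - s) * (\<Sum>j\<in>UNIV. expectation (B j j))"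
    by (simp add: if_distrib[where f="\<lambda>x. x * _"] sum_distrib_left cong: if_cong)
  from has_bochner_integral_add[OF 1 has_bochner_integral_mult_right[OF has_bochner_integral_diff[OF 2 3], of "1/2"]]
  show ?thesis unfolding e by simp
qed

end

section \<open>Continuity along paths and integrals over a cell\<close>

lemma locally_lipschitz_on_continuous_on:
  assumes "locally_lipschitz_on \<phi> S"
  shows "continuous_on S \<phi>"
  unfolding continuous_on_eq_continuous_within
proof
  fix x assume x: "x \<in> S"
  then obtain \<epsilon> L where e: "0 < \<epsilon>" "L-lipschitz_on (cball x \<epsilon> \<inter> S) \<phi>"
    using assms unfolding locally_lipschitz_on_def by blast
  have "continuous (at x within cball x \<epsilon> \<inter> S) \<phi>"
    using lipschitz_on_continuous_on[OF e(2)] x e(1) unfolding continuous_on_eq_continuous_within by auto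
  moreover have "at x within cball x \<epsilon> \<inter> S = at x within S"
    using e(1) by (intro at_within_nhd[of x "ball x \<epsilon>"]) auto
  ultimately show "continuous (at x within S) \<phi>" by simp
qed

lemma measurable_continuous_comp:
  assumes "continuous_on S \<phi>" "Y \<in> borel_measurable N" "\<And>\<omega>. \<omega> \<in> space N \<Longrightarrow> Y \<omega> \<in> S"
  shows "(\<lambda>\<omega>. \<phi> (Y \<omega>)) \<in> borel_measurable N"
proof (rule measurable_compose[where f=Y and g=\<phi>])
  show "Y \<in> measurable N (restrict_space borel S)"
    using assms(2,3) by (intro measurable_restrict_space2) auto
  show "\<phi> \<in> borel_measurable (restrict_space borel S)"
    by (rule borel_measurable_continuous_on_restrict[OF assms(1)])
qed

lemma set_integral_norm_bound_cell:
  fixes A :: "real \<Rightarrow> 'b::euclidean_space"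
  assumes "set_integrable lborel {a..b} A" "a \<le> b" "\<And>s. s \<in> {a..b} \<Longrightarrow> norm (A s) \<le> K"
  shows "norm (LINT s:{a..b}|lborel. A s) \<le> K * (b - a)"
proof -
  have "norm (integral {a..b} A) \<le> integral {a..b} (\<lambda>s. K)"
    by (rule Henstock_Kurzweil_Integration.integral_norm_bound_integral[OF set_borel_integral_eq_integral(1)[OF assms(1)]])
      (use assms(3) in auto)
  then show ?thesis
    using assms(2) by (simp add: set_borel_integral_eq_integral(2)[OF assms(1)] mult.commute)
qed

lemma set_integral_lower_bound_cell:
  fixes A :: "real \<Rightarrow> real"
  assumes "set_integrable lborel {a..b} A" "a \<le> b" "\<And>s. s \<in> {a..b} \<Longrightarrow> K \<le> A s"
  shows "K * (b - a) \<le> (LINT s:{a..b}|lborel. A s)"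
proof -
  have "integral {a..b} (\<lambda>s. K) \<le> integral {a..b} A"
    by (rule integral_le[OF _ set_borel_integral_eq_integral(1)[OF assms(1)]]) (use assms(3) in auto)
  then show ?thesis
    using assms(2) by (simp add: set_borel_integral_eq_integral(2)[OF assms(1)] mult.commute)
qed

text \<open>The generator with drift, diffusion matrix and base point as independent arguments: in
  an Euler step the derivatives of \<open>h\<close> are taken at the Euler point, the coefficients
  at the state, and the control at any time of the cell.\<close>

definition gen_at :: "(real^'n::finite \<Rightarrow> real) \<Rightarrow> real^'n \<Rightarrow> real^'d::finite^'n \<Rightarrow> real^'n \<Rightarrow> real"
  where "gen_at h b s y = (\<Sum>i\<in>UNIV. partial_deriv i h y * b $ i) +
    1/2 * (\<Sum>i\<in>UNIV. \<Sum>j\<in>UNIV. (s ** transpose s) $ i $ j * partial_deriv i (partial_deriv j h) y)"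

lemma generator_eq_gen_at: "generator f g \<sigma> v h x = gen_at h (f x + g x *v v) (\<sigma> x) x"
  by (simp add: generator_def gen_at_def)

lemma gen_at_continuous:
  fixes h :: "real^'n::finite \<Rightarrow> real"
  assumes C2: "C_k_open 2 h O'" and K: "K \<subseteq> O'"
  shows "continuous_on (cball 0 R \<times> cball 0 R \<times> K) (\<lambda>p. gen_at h (fst p) (fst (snd p) :: real^'d::finite^'n) (snd (snd p)))"
proof -
  have 1: "continuous_on (cball 0 R \<times> cball 0 R \<times> K) (\<lambda>p::(real^'n) \<times> (real^'d^'n) \<times> (real^'n). \<psi> (snd (snd p)))"
    if "continuous_on O' \<psi>" for \<psi> :: "real^'n \<Rightarrow> real"
    by (rule continuous_on_compose2[OF that]) (use K in \<open>auto intro!: continuous_intros\<close>)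
  show ?thesis
    unfolding gen_at_def matrix_matrix_mult_def transpose_def
    by (simp, intro continuous_intros 1 C2_open_continuous(2)[OF C2] C2_openD(3)[OF C2]) simp
qed

lemma gen_at_bounded:
  fixes h :: "real^'n::finite \<Rightarrow> real"
  assumes C2: "C_k_open 2 h O'" and K: "compact K" "K \<subseteq> O'"
  obtains G where "0 < G" "\<And>b (s::real^'d::finite^'n) y. norm b \<le> R \<Longrightarrow> norm s \<le> R \<Longrightarrow> y \<in> K \<Longrightarrow> \<bar>gen_at h b s y\<bar> \<le> G"
proof -
  have "compact (cball 0 R \<times> cball 0 R \<times> K :: ((real^'n) \<times> (real^'d^'n) \<times> (real^'n)) set)"
    by (intro compact_Times K compact_cball)
  then have "bounded ((\<lambda>p. gen_at h (fst p) (fst (snd p) :: real^'d^'n) (snd (snd p))) ` (cball 0 R \<times> cball 0 R \<times> K))"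
    by (intro compact_imp_bounded compact_continuous_image gen_at_continuous[OF C2 K(2)])
  then obtain G where G: "0 < G" "\<And>p. p \<in> cball 0 R \<times> cball 0 R \<times> K \<Longrightarrow> \<bar>gen_at h (fst p) (fst (snd p) :: real^'d^'n) (snd (snd p))\<bar> \<le> G"
    unfolding bounded_pos by auto
  show ?thesis
    by (rule that[OF G(1)]) (use G(2) in force)
qed

lemma gen_at_uniform:
  fixes h :: "real^'n::finite \<Rightarrow> real"
  assumes C2: "C_k_open 2 h O'" and K: "compact K" "K \<subseteq> O'" and e: "0 < e"
  obtains \<delta> where "0 < \<delta>" "\<And>b b' (s::real^'d::finite^'n) s' y y'. norm b \<le> R \<Longrightarrow> norm s \<le> R \<Longrightarrow> y \<in> K \<Longrightarrow>
    norm b' \<le> R \<Longrightarrow> norm s' \<le> R \<Longrightarrow> y' \<in> K \<Longrightarrow> norm (b - b') < \<delta> \<Longrightarrow> norm (s - s') < \<delta> \<Longrightarrow> norm (y - y') < \<delta> \<Longrightarrow>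
    \<bar>gen_at h b s y - gen_at h b' s' y'\<bar> < e"
proof -
  have "compact (cball 0 R \<times> cball 0 R \<times> K :: ((real^'n) \<times> (real^'d^'n) \<times> (real^'n)) set)"
    by (intro compact_Times K compact_cball)
  then have "uniformly_continuous_on (cball 0 R \<times> cball 0 R \<times> K) (\<lambda>p. gen_at h (fst p) (fst (snd p) :: real^'d^'n) (snd (snd p)))"
    by (intro compact_uniformly_continuous gen_at_continuous[OF C2 K(2)])
  then obtain d where d: "0 < d" "\<And>p p'. p \<in> cball 0 R \<times> cball 0 R \<times> K \<Longrightarrow> p' \<in> cball 0 R \<times> cball 0 R \<times> K \<Longrightarrow> dist p' p < d \<Longrightarrow>
      dist (gen_at h (fst p') (fst (snd p') :: real^'d^'n) (snd (snd p'))) (gen_at h (fst p) (fst (snd p)) (snd (snd p))) < e"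
    unfolding uniformly_continuous_on_def using e by metis
  show ?thesis
  proof (rule that[of "d/3"])
    fix b b' :: "real^'n" and s s' :: "real^'d^'n" and y y' :: "real^'n"
    assume *: "norm b \<le> R" "norm s \<le> R" "y \<in> K" "norm b' \<le> R" "norm s' \<le> R" "y' \<in> K"
      "norm (b - b') < d/3" "norm (s - s') < d/3" "norm (y - y') < d/3"
    have "dist (b, s, y) (b', s', y') \<le> dist b b' + dist (s, y) (s', y')"
      unfolding dist_Pair_Pair[of b "(s, y)"] by (rule sqrt_sum_squares_le_sum) auto
    also have "dist (s, y) (s', y') \<le> dist s s' + dist y y'"
      unfolding dist_Pair_Pair by (rule sqrt_sum_squares_le_sum) auto
    finally have "dist (b, s, y) (b', s', y') < d"
      using * by (simp add: dist_norm)
    then show "\<bar>gen_at h b s y - gen_at h b' s' y'\<bar> < e"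
      using d(2)[of "(b', s', y')" "(b, s, y)"] * by (simp add: dist_real_def)
  qed (use d in auto)
qed

lemma linear_growth_bound:
  assumes "linear_growth_on \<phi> S"
  obtains K where "0 \<le> K" "\<And>x. x \<in> S \<Longrightarrow> norm x \<le> R \<Longrightarrow> norm (\<phi> x) \<le> K"
proof -
  obtain K where K: "\<And>x. x \<in> S \<Longrightarrow> norm (\<phi> x) \<le> K * (1 + norm x)"
    using assms unfolding linear_growth_on_def by blast
  show ?thesis
  proof (rule that[of "\<bar>K\<bar> * (1 + \<bar>R\<bar>)"])
    fix x assume "x \<in> S" "norm x \<le> R"
    then have "K * (1 + norm x) \<le> \<bar>K\<bar> * (1 + \<bar>R\<bar>)" by (intro mult_mono) auto
    with K[OF \<open>x \<in> S\<close>] show "norm (\<phi> x) \<le> \<bar>K\<bar> * (1 + \<bar>R\<bar>)" by linarith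
  qed simp
qed

section \<open>The controlled process and its Euler scheme\<close>

locale controlled_diffusion = filtered_bm M F W
  for M :: "'w measure" and F :: "real \<Rightarrow> 'w measure" and W :: "real \<Rightarrow> 'w \<Rightarrow> real^'d::finite" +
  fixes S O' :: "(real^'n::finite) set"
    and f :: "real^'n \<Rightarrow> real^'n" and g :: "real^'n \<Rightarrow> real^'p::finite^'n" and \<sigma> :: "real^'n \<Rightarrow> real^'d^'n"
    and h :: "real^'n \<Rightarrow> real" and \<xi> :: "real^'n"
    and u :: "real \<Rightarrow> 'w \<Rightarrow> real^'p" and X :: "real \<Rightarrow> 'w \<Rightarrow> real^'n" and Ku :: real
  assumes coef_cont: "continuous_on S f" "continuous_on S g" "continuous_on S \<sigma>"
    and growth: "linear_growth_on f S" "linear_growth_on g S" "linear_growth_on \<sigma> S"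
    and nbhd: "open O'" "S \<subseteq> O'" and C2: "C_k_open 2 h O'"
    and solution: "strong_solution M F W S f g \<sigma> u \<xi> X"
    and u_bound: "\<And>t \<omega>. 0 \<le> t \<Longrightarrow> \<omega> \<in> space M \<Longrightarrow> norm (u t \<omega>) \<le> Ku"
    and u_progressive: "progressively_measurable F u"
    and generator_nonneg: "AE \<omega> in M. \<forall>t\<ge>0. 0 \<le> generator f g \<sigma> (u t \<omega>) h (X t \<omega>)"
    and initial: "\<xi> \<in> S" "0 < h \<xi>"
begin

lemma X_adapted: "0 \<le> t \<Longrightarrow> X t \<in> borel_measurable (F t)"
  and X_in: "0 \<le> t \<Longrightarrow> \<omega> \<in> space M \<Longrightarrow> X t \<omega> \<in> S"
  and X_cont: "\<omega> \<in> space M \<Longrightarrow> continuous_on {0..} (\<lambda>t. X t \<omega>)"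
  and X_start: "AE \<omega> in M. X 0 \<omega> = \<xi>"
  and drift_integrable: "0 \<le> t \<Longrightarrow> AE \<omega> in M. set_integrable lborel {0..t} (\<lambda>s. f (X s \<omega>) + g (X s \<omega>) *v u s \<omega>)"
  and ito_exists: "0 \<le> t \<Longrightarrow> \<exists>I. has_ito_integral M F W (\<lambda>s \<omega>. \<sigma> (X s \<omega>)) t I \<and>
      (AE \<omega> in M. X t \<omega> = X 0 \<omega> + (LINT s:{0..t}|lborel. f (X s \<omega>) + g (X s \<omega>) *v u s \<omega>) + I \<omega>)"
  using solution unfolding strong_solution_def by blast+

lemma Ku_nonneg: "0 \<le> Ku"
  using not_empty u_bound[of 0] norm_ge_zero order_trans by blast

lemma comp_adapted: "continuous_on S \<phi> \<Longrightarrow> 0 \<le> t \<Longrightarrow> (\<lambda>\<omega>. \<phi> (X t \<omega>)) \<in> borel_measurable (F t)"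
  by (rule measurable_continuous_comp[OF _ X_adapted]) (auto simp: X_in space_F)

lemma comp_path_cont: "continuous_on S \<phi> \<Longrightarrow> \<omega> \<in> space M \<Longrightarrow> continuous_on {0..T} (\<lambda>t. \<phi> (X t \<omega>))"
  by (rule continuous_on_compose2[of S \<phi>]) (auto intro: continuous_on_subset[OF X_cont] simp: X_in)

lemma h_cont: "continuous_on S h"
  by (rule continuous_on_subset[OF C2_open_continuous(1)[OF C2] nbhd(2)])

text \<open>Only the state is frozen at the left endpoint. The control may be irregular in time and
  stays under the integral.\<close>

definition euler_drift :: "real \<Rightarrow> nat \<Rightarrow> nat \<Rightarrow> 'w \<Rightarrow> real^'n"
  where "euler_drift T N k \<omega> = (LINT s:{grid_pt T N k..grid_pt T N (Suc k)}|lborel.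
    f (X (grid_pt T N k) \<omega>) + g (X (grid_pt T N k) \<omega>) *v u s \<omega>)"

text \<open>Not a recursion: the coefficients are taken at \<open>X\<close>, which stays in
  \<open>S\<close>, and not at the Euler point, which may leave \<open>S\<close>.\<close>

definition euler :: "real \<Rightarrow> nat \<Rightarrow> nat \<Rightarrow> 'w \<Rightarrow> real^'n"
  where "euler T N k \<omega> = \<xi> + (\<Sum>j<k. euler_drift T N j \<omega> +
    \<sigma> (X (grid_pt T N j) \<omega>) *v (W (grid_pt T N (Suc j)) \<omega> - W (grid_pt T N j) \<omega>))"

lemma frozen_drift_integrable:
  assumes "0 \<le> a" "\<omega> \<in> space M"
  shows "set_integrable lborel {a..b} (\<lambda>s. y + G *v u s \<omega>)"
proof (rule jointly_measurable_set_integrable[where N=M and t="max 0 b" and A="\<lambda>s \<omega>. y + G *v u s \<omega>" and K="norm y + norm G * Ku"])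
  show "jointly_measurable M (max 0 b) (\<lambda>s \<omega>. y + G *v u s \<omega>)"
    by (rule jointly_measurable_affine[OF jointly_measurable_progressive[OF u_progressive]]) simp_all
  show "norm (y + G *v u s \<omega>) \<le> norm y + norm G * Ku" if "s \<in> {a..b}" for s
  proof -
    have "norm (G *v u s \<omega>) \<le> norm G * Ku"
      using norm_matrix_vector_le[of G "u s \<omega>"] u_bound[of s \<omega>] that assms mult_left_mono[of "norm (u s \<omega>)" Ku "norm G"] by auto
    then show ?thesis using norm_triangle_ineq[of y "G *v u s \<omega>"] by linarith
  qed
qed (use assms in auto)

text \<open>The control on a cell is revealed only by the right endpoint. So the drift of a cell
  cannot serve as a coefficient of the noise over the same cell, and products of the two have to be
  estimated rather than averaged.\<close>

lemma euler_drift_adapted: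
  assumes "0 < T" "0 < N"
  shows "euler_drift T N k \<in> borel_measurable (F (grid_pt T N (Suc k)))"
proof -
  let ?t = "grid_pt T N k" and ?t' = "grid_pt T N (Suc k)"
  have t: "0 \<le> ?t" "?t \<le> ?t'" using grid_pt_strict[OF assms, of k] grid_pt_nonneg[OF assms(1), of N k] by auto
  have "jointly_measurable (F ?t') ?t' u"
    using u_progressive t unfolding progressively_measurable_def jointly_measurable_def by auto
  then have "jointly_measurable (F ?t') ?t' (\<lambda>s \<omega>. f (X ?t \<omega>) + g (X ?t \<omega>) *v u s \<omega>)"
    by (rule jointly_measurable_affine) (rule measurable_F_mono[OF t comp_adapted[OF coef_cont(1) t(1)]],
        rule measurable_F_mono[OF t comp_adapted[OF coef_cont(2) t(1)]])
  from jointly_measurable_integral[OF this, of ?t ?t'] t show ?thesis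
    unfolding euler_drift_def[abs_def] by auto
qed

lemma euler_adapted:
  assumes "0 < T" "0 < N"
  shows "euler T N k \<in> borel_measurable (F (grid_pt T N k))"
proof -
  note nn = grid_pt_nonneg[OF assms(1), of N]
  have "(\<lambda>\<omega>. \<xi> + (\<Sum>j<k. euler_drift T N j \<omega> + \<sigma> (X (grid_pt T N j) \<omega>) *v (W (grid_pt T N (Suc j)) \<omega> - W (grid_pt T N j) \<omega>)))
    \<in> borel_measurable (F (grid_pt T N k))"
  proof (rule borel_measurable_add[OF borel_measurable_const], rule borel_measurable_sum)
    fix j assume "j \<in> {..<k}"
    then have j: "j < k" by simp
    have m1: "grid_pt T N j \<le> grid_pt T N k" and m2: "grid_pt T N (Suc j) \<le> grid_pt T N k"
      using j by (auto intro!: grid_pt_mono[OF assms(1)])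
    show "(\<lambda>\<omega>. euler_drift T N j \<omega> + \<sigma> (X (grid_pt T N j) \<omega>) *v (W (grid_pt T N (Suc j)) \<omega> - W (grid_pt T N j) \<omega>)) \<in> borel_measurable (F (grid_pt T N k))"
      by (intro borel_measurable_add measurable_matrix_vector borel_measurable_diff
          measurable_F_mono[OF nn m2 euler_drift_adapted[OF assms]]
          measurable_F_mono[OF nn m1 comp_adapted[OF coef_cont(3) nn]]
          measurable_F_mono[OF nn m2 W_adapted[OF nn]] measurable_F_mono[OF nn m1 W_adapted[OF nn]])
  qed
  then show ?thesis unfolding euler_def[abs_def] .
qed

lemma euler_drift_bound:
  assumes "0 < T" "0 < N" "\<omega> \<in> space M"
  shows "norm (euler_drift T N k \<omega>) \<le> (norm (f (X (grid_pt T N k) \<omega>)) + norm (g (X (grid_pt T N k) \<omega>)) * Ku) * (T / N)"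
proof -
  let ?t = "grid_pt T N k" and ?t' = "grid_pt T N (Suc k)"
  have t: "0 \<le> ?t" "?t \<le> ?t'" using grid_pt_strict[OF assms(1,2), of k] grid_pt_nonneg[OF assms(1), of N k] by auto
  have "norm (euler_drift T N k \<omega>) \<le> (norm (f (X ?t \<omega>)) + norm (g (X ?t \<omega>)) * Ku) * (?t' - ?t)"
    unfolding euler_drift_def
  proof (rule set_integral_norm_bound_cell[OF frozen_drift_integrable[OF t(1) assms(3)] t(2)])
    fix s assume "s \<in> {?t..?t'}"
    then have "norm (g (X ?t \<omega>) *v u s \<omega>) \<le> norm (g (X ?t \<omega>)) * Ku"
      using norm_matrix_vector_le[of "g (X ?t \<omega>)" "u s \<omega>"] u_bound[of s \<omega>] t assms mult_left_mono[of "norm (u s \<omega>)" Ku "norm (g (X ?t \<omega>))"] by auto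
    then show "norm (f (X ?t \<omega>) + g (X ?t \<omega>) *v u s \<omega>) \<le> norm (f (X ?t \<omega>)) + norm (g (X ?t \<omega>)) * Ku"
      using norm_triangle_ineq[of "f (X ?t \<omega>)" "g (X ?t \<omega>) *v u s \<omega>"] by linarith
  qed
  then show ?thesis by (simp add: grid_pt_step)
qed

text \<open>The drift enters the generator linearly, so a lower bound on the generator for all control values
  on a cell passes to the averaged drift.\<close>

lemma generator_cell_bound:
  assumes "0 < T" "0 < N" "\<omega> \<in> space M"
    and low: "\<And>s. s \<in> {grid_pt T N k..grid_pt T N (Suc k)} \<Longrightarrow>
      - m \<le> gen_at h (f (X (grid_pt T N k) \<omega>) + g (X (grid_pt T N k) \<omega>) *v u s \<omega>) (a :: real^'d^'n) y"
  shows "- m * (T / N) \<le> (\<Sum>i\<in>UNIV. partial_deriv i h y * euler_drift T N k \<omega> $ i) +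
    1/2 * (T / N) * (\<Sum>i\<in>UNIV. \<Sum>j\<in>UNIV. (a ** transpose a) $ i $ j * partial_deriv i (partial_deriv j h) y)"
proof -
  let ?t = "grid_pt T N k" and ?t' = "grid_pt T N (Suc k)"
  have t: "0 \<le> ?t" "?t \<le> ?t'" using grid_pt_strict[OF assms(1,2), of k] grid_pt_nonneg[OF assms(1), of N k] by auto
  define b where "b = (\<lambda>s. f (X ?t \<omega>) + g (X ?t \<omega>) *v u s \<omega>)"
  define lin where "lin = (\<lambda>v::real^'n. \<Sum>i\<in>UNIV. partial_deriv i h y * v $ i)"
  define q where "q = 1/2 * (\<Sum>i\<in>UNIV. \<Sum>j\<in>UNIV. (a ** transpose a) $ i $ j * partial_deriv i (partial_deriv j h) y)"
  have bl: "bounded_linear lin"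
    unfolding lin_def by (intro bounded_linear_sum bounded_linear_mult_right[THEN bounded_linear_compose] bounded_linear_vec_nth)
  have bi: "set_integrable lborel {?t..?t'} b"
    unfolding b_def by (rule frozen_drift_integrable[OF t(1) assms(3)])
  have li: "set_integrable lborel {?t..?t'} (\<lambda>s. lin (b s))"
    using integrable_bounded_linear[OF bl bi[unfolded set_integrable_def]]
    unfolding set_integrable_def by (simp add: linear_simps(5)[OF bl])
  have le: "(LINT s:{?t..?t'}|lborel. lin (b s)) = lin (euler_drift T N k \<omega>)"
    using integral_bounded_linear[OF bl bi[unfolded set_integrable_def]]
    unfolding set_lebesgue_integral_def euler_drift_def b_def[symmetric] by (simp add: linear_simps(5)[OF bl])
  have "(- m - q) * (?t' - ?t) \<le> (LINT s:{?t..?t'}|lborel. lin (b s))"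
  proof (rule set_integral_lower_bound_cell[OF li t(2)])
    fix s assume "s \<in> {?t..?t'}"
    then have "- m \<le> gen_at h (b s) a y" unfolding b_def by (rule low)
    also have "gen_at h (b s) a y = lin (b s) + q" unfolding gen_at_def lin_def q_def ..
    finally show "- m - q \<le> lin (b s)" by linarith
  qed
  then have "(- m - q) * (T / N) \<le> lin (euler_drift T N k \<omega>)"
    unfolding le grid_pt_step .
  then have "- m * (T / N) \<le> lin (euler_drift T N k \<omega>) + q * (T / N)"
    by (simp only: left_diff_distrib)
  then show ?thesis
    unfolding lin_def q_def by (simp only: mult.assoc mult.commute[of _ "T / N"] mult.left_commute[of _ "T / N"])
qed

lemma euler_uniform:
  assumes T: "0 < T" and pos: "0 < \<delta>" "0 < e"
  shows "eventually (\<lambda>N. mostly e (\<lambda>\<omega>. \<forall>k\<le>N. norm (euler T N k \<omega> - X (grid_pt T N k) \<omega>) \<le> \<delta>)) sequentially"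
proof -
  \<comment> \<open>Each cell contributes at most \<open>T / N * ((1 + Ku) * \<eta>)\<close> to the
    drift error, which adds up to \<open>\<delta> / 2\<close>; the other half is left to the
    noise.\<close>
  define \<eta> where "\<eta> = \<delta> / (2 * T * (1 + Ku))"
  have eta: "0 < \<eta>" "T * (1 + Ku) * \<eta> = \<delta> / 2" 
  proof -
    have p: "0 < 2 * T * (1 + Ku)" using T Ku_nonneg by (intro mult_pos_pos) auto
    show "0 < \<eta>" unfolding \<eta>_def by (rule divide_pos_pos[OF pos(1) p])
    have "T * (1 + Ku) * \<eta> = (2 * T * (1 + Ku)) * \<eta> / 2" by simp
    also have "\<dots> = \<delta> / 2" unfolding \<eta>_def using p by (subst nonzero_mult_div_cancel_left[symmetric, of "2 * T * (1 + Ku)" \<delta>]) auto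
    finally show "T * (1 + Ku) * \<eta> = \<delta> / 2" .
  qed
  \<comment> \<open>A version of the stochastic integral is chosen for each time on its own. Only
    the finitely many grid times are used, so the almost sure equations hold simultaneously.\<close>
  define I where "I = (\<lambda>t. SOME I. has_ito_integral M F W (\<lambda>s \<omega>. \<sigma> (X s \<omega>)) t I \<and>
      (AE \<omega> in M. X t \<omega> = X 0 \<omega> + (LINT s:{0..t}|lborel. f (X s \<omega>) + g (X s \<omega>) *v u s \<omega>) + I \<omega>))"
  have I: "has_ito_integral M F W (\<lambda>s \<omega>. \<sigma> (X s \<omega>)) t (I t)"
    "AE \<omega> in M. X t \<omega> = X 0 \<omega> + (LINT s:{0..t}|lborel. f (X s \<omega>) + g (X s \<omega>) *v u s \<omega>) + I t \<omega>" if "0 \<le> t" for t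
    using someI_ex[OF ito_exists[OF that]] unfolding I_def by auto
  have osc: "eventually (\<lambda>N. mostly (e/3) (\<lambda>\<omega>. small_oscillation T N \<eta> (\<lambda>s. \<phi> (X s \<omega>)))) sequentially"
    if "continuous_on S \<phi>" for \<phi> :: "real^'n \<Rightarrow> 'b::{second_countable_topology, real_normed_vector}"
  proof (rule oscillation_eventually_small[OF _ comp_path_cont[OF that] T eta(1)])
    show "(\<lambda>\<omega>. \<phi> (X s \<omega>)) \<in> borel_measurable M" if "s \<in> {0..T}" for s
      using that by (intro measurable_F_M[OF _ comp_adapted[OF \<open>continuous_on S \<phi>\<close>]]) simp_all
  qed (use pos in auto)
  have ito: "eventually (\<lambda>N. mostly (e/3) (\<lambda>\<omega>. \<forall>k\<le>N. norm ((\<Sum>j<k. \<sigma> (X (grid_pt T N j) \<omega>) *v (W (grid_pt T N (Suc j)) \<omega> - W (grid_pt T N j) \<omega>))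
      - I (grid_pt T N k) \<omega>) \<le> \<delta>/2)) sequentially"
    using pos by (intro euler_integral_uniform[OF T comp_adapted[OF coef_cont(3)] comp_path_cont[OF coef_cont(3)] I(1)]) auto
  show ?thesis
    using eventually_conj[OF eventually_conj[OF osc[OF coef_cont(1)] osc[OF coef_cont(2)]] eventually_conj[OF ito eventually_gt_at_top[of 0]]]
  proof (rule eventually_mono, elim conjE)
    fix N :: nat
    assume N: "0 < N"
      and m1: "mostly (e/3) (\<lambda>\<omega>. small_oscillation T N \<eta> (\<lambda>s. f (X s \<omega>)))"
      and m2: "mostly (e/3) (\<lambda>\<omega>. small_oscillation T N \<eta> (\<lambda>s. g (X s \<omega>)))"
      and m3: "mostly (e/3) (\<lambda>\<omega>. \<forall>k\<le>N. norm ((\<Sum>j<k. \<sigma> (X (grid_pt T N j) \<omega>) *v (W (grid_pt T N (Suc j)) \<omega> - W (grid_pt T N j) \<omega>))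
      - I (grid_pt T N k) \<omega>) \<le> \<delta>/2)"
    have nn: "0 \<le> grid_pt T N k" for k by (rule grid_pt_nonneg[OF T])
    have "AE \<omega> in M. X 0 \<omega> = \<xi> \<and> (\<forall>k\<in>{..N}. X (grid_pt T N k) \<omega> = X 0 \<omega> + (LINT s:{0..grid_pt T N k}|lborel. f (X s \<omega>) + g (X s \<omega>) *v u s \<omega>) + I (grid_pt T N k) \<omega>)
        \<and> set_integrable lborel {0..T} (\<lambda>s. f (X s \<omega>) + g (X s \<omega>) *v u s \<omega>)"
      using T by (intro AE_conjI X_start AE_finite_allI I(2) nn drift_integrable) auto
    then have m4: "mostly 0 (\<lambda>\<omega>. X 0 \<omega> = \<xi> \<and> (\<forall>k\<in>{..N}. X (grid_pt T N k) \<omega> = X 0 \<omega> + (LINT s:{0..grid_pt T N k}|lborel. f (X s \<omega>) + g (X s \<omega>) *v u s \<omega>) + I (grid_pt T N k) \<omega>)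
        \<and> set_integrable lborel {0..T} (\<lambda>s. f (X s \<omega>) + g (X s \<omega>) *v u s \<omega>))"
      by (rule mostly_AE) simp
    show "mostly e (\<lambda>\<omega>. \<forall>k\<le>N. norm (euler T N k \<omega> - X (grid_pt T N k) \<omega>) \<le> \<delta>)"
    proof (rule mostly_mono[OF mostly_conj[OF mostly_conj[OF m1 m2] mostly_conj[OF m3 m4]]], elim conjE, intro allI impI)
      fix \<omega> k assume w: "\<omega> \<in> space M" and k: "k \<le> N"
        and fcl: "small_oscillation T N \<eta> (\<lambda>s. f (X s \<omega>))"
        and gcl: "small_oscillation T N \<eta> (\<lambda>s. g (X s \<omega>))"
        and icl: "\<forall>k\<le>N. norm ((\<Sum>j<k. \<sigma> (X (grid_pt T N j) \<omega>) *v (W (grid_pt T N (Suc j)) \<omega> - W (grid_pt T N j) \<omega>)) - I (grid_pt T N k) \<omega>) \<le> \<delta>/2"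
        and x0: "X 0 \<omega> = \<xi>"
        and xk: "\<forall>k\<in>{..N}. X (grid_pt T N k) \<omega> = X 0 \<omega> + (LINT s:{0..grid_pt T N k}|lborel. f (X s \<omega>) + g (X s \<omega>) *v u s \<omega>) + I (grid_pt T N k) \<omega>"
        and sint: "set_integrable lborel {0..T} (\<lambda>s. f (X s \<omega>) + g (X s \<omega>) *v u s \<omega>)"
      define b where "b = (\<lambda>s. f (X s \<omega>) + g (X s \<omega>) *v u s \<omega>)"
      have bi: "set_integrable lborel {a..a'} b" if "{a..a'} \<subseteq> {0..T}" for a a'
        unfolding b_def by (rule set_integrable_subset[OF sint _ that]) simp
      have drift: "norm ((\<Sum>j<k. euler_drift T N j \<omega>) - (LINT s:{0..grid_pt T N k}|lborel. b s)) \<le> real k * (T / N * ((1 + Ku) * \<eta>))" if "k \<le> N" for k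
        using that
      proof (induction k)
        case 0
        have "(LINT s:{0..0}|lborel. b s) = integral {0..0} b"
          by (rule set_borel_integral_eq_integral(2)[OF bi]) (use T in auto)
        then show ?case by simp
      next
        case (Suc k)
        let ?t = "grid_pt T N k" and ?t' = "grid_pt T N (Suc k)"
        have t: "0 \<le> ?t" "?t \<le> ?t'" "?t' \<le> T"
          using grid_pt_strict[OF T N, of k] nn[of k] grid_pt_range[OF T Suc.prems] by auto
        have sub: "{0..?t} \<subseteq> {0..T}" "{?t..?t'} \<subseteq> {0..T}" "{0..?t'} \<subseteq> {0..T}" using t by auto
        have split: "(LINT s:{0..?t'}|lborel. b s) = (LINT s:{0..?t}|lborel. b s) + (LINT s:{?t..?t'}|lborel. b s)"
          using Henstock_Kurzweil_Integration.integral_combine[OF t(1,2) set_borel_integral_eq_integral(1)[OF bi[OF sub(3)]]]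
          by (simp add: set_borel_integral_eq_integral(2)[OF bi[OF sub(1)]] set_borel_integral_eq_integral(2)[OF bi[OF sub(2)]] set_borel_integral_eq_integral(2)[OF bi[OF sub(3)]])
        have fi: "set_integrable lborel {?t..?t'} (\<lambda>s. f (X ?t \<omega>) + g (X ?t \<omega>) *v u s \<omega>)"
          by (rule frozen_drift_integrable[OF t(1) w])
        have "euler_drift T N k \<omega> - (LINT s:{?t..?t'}|lborel. b s) = (LINT s:{?t..?t'}|lborel. (f (X ?t \<omega>) + g (X ?t \<omega>) *v u s \<omega>) - b s)"
          unfolding euler_drift_def by (rule set_integral_diff(2)[OF fi bi[OF sub(2)], symmetric])
        also have "norm \<dots> \<le> ((1 + Ku) * \<eta>) * (?t' - ?t)"
        proof (rule set_integral_norm_bound_cell[OF set_integral_diff(1)[OF fi bi[OF sub(2)]] t(2)])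
          fix s assume s: "s \<in> {?t..?t'}"
          have "(f (X ?t \<omega>) + g (X ?t \<omega>) *v u s \<omega>) - b s = (f (X ?t \<omega>) - f (X s \<omega>)) + (g (X ?t \<omega>) - g (X s \<omega>)) *v u s \<omega>"
            by (simp add: b_def matrix_vector_mult_diff_rdistrib)
          also have "norm \<dots> \<le> norm (f (X ?t \<omega>) - f (X s \<omega>)) + norm (g (X ?t \<omega>) - g (X s \<omega>)) * norm (u s \<omega>)"
            by (rule order_trans[OF norm_triangle_ineq add_left_mono[OF norm_matrix_vector_le]])
          also have "\<dots> \<le> \<eta> + \<eta> * Ku"
            using small_oscillationD[OF fcl, of k s] small_oscillationD[OF gcl, of k s] s Suc.prems u_bound[OF _ w, of s] t eta(1)
            by (intro add_mono mult_mono) (auto simp: norm_minus_commute)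
          also have "\<dots> = (1 + Ku) * \<eta>" by (simp add: algebra_simps)
          finally show "norm ((f (X ?t \<omega>) + g (X ?t \<omega>) *v u s \<omega>) - b s) \<le> (1 + Ku) * \<eta>" .
        qed
        finally have "norm (euler_drift T N k \<omega> - (LINT s:{?t..?t'}|lborel. b s)) \<le> T / N * ((1 + Ku) * \<eta>)"
          by (simp add: grid_pt_step mult.commute)
        moreover have "norm ((\<Sum>j<k. euler_drift T N j \<omega>) - (LINT s:{0..?t}|lborel. b s)) \<le> real k * (T / N * ((1 + Ku) * \<eta>))"
          using Suc by simp
        moreover have "(\<Sum>j<Suc k. euler_drift T N j \<omega>) - (LINT s:{0..?t'}|lborel. b s) =
          ((\<Sum>j<k. euler_drift T N j \<omega>) - (LINT s:{0..?t}|lborel. b s)) + (euler_drift T N k \<omega> - (LINT s:{?t..?t'}|lborel. b s))"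
          by (simp add: split)
        moreover have "real (Suc k) * (T / N * ((1 + Ku) * \<eta>)) = real k * (T / N * ((1 + Ku) * \<eta>)) + T / N * ((1 + Ku) * \<eta>)"
          by (simp only: of_nat_Suc distrib_right mult_1_left add.commute)
        ultimately show ?case
          using norm_triangle_ineq by (smt (verit))
      qed
      have "real k * (T / N * ((1 + Ku) * \<eta>)) \<le> real N * (T / N * ((1 + Ku) * \<eta>))"
        using k T Ku_nonneg eta by (intro mult_right_mono mult_nonneg_nonneg divide_nonneg_nonneg) auto
      also have "\<dots> = \<delta> / 2" using N eta(2) by simp
      finally have 1: "norm ((\<Sum>j<k. euler_drift T N j \<omega>) - (LINT s:{0..grid_pt T N k}|lborel. b s)) \<le> \<delta> / 2"
        using drift[OF k] by linarith
      have "euler T N k \<omega> - X (grid_pt T N k) \<omega> = ((\<Sum>j<k. euler_drift T N j \<omega>) - (LINT s:{0..grid_pt T N k}|lborel. b s)) +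
        ((\<Sum>j<k. \<sigma> (X (grid_pt T N j) \<omega>) *v (W (grid_pt T N (Suc j)) \<omega> - W (grid_pt T N j) \<omega>)) - I (grid_pt T N k) \<omega>)"
        using xk k x0 by (simp add: euler_def sum.distrib b_def)
      then show "norm (euler T N k \<omega> - X (grid_pt T N k) \<omega>) \<le> \<delta>"
        using 1 icl k norm_triangle_ineq[of "(\<Sum>j<k. euler_drift T N j \<omega>) - (LINT s:{0..grid_pt T N k}|lborel. b s)"
          "(\<Sum>j<k. \<sigma> (X (grid_pt T N j) \<omega>) *v (W (grid_pt T N (Suc j)) \<omega> - W (grid_pt T N j) \<omega>)) - I (grid_pt T N k) \<omega>"]
        by fastforce
    qed simp
  qed
qed

text \<open>A path over \<open>{0..T}\<close> has a compact range in the open set \<open>O'\<close>,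
  so it lies in all late members of an exhaustion of \<open>O'\<close> by compact sets. As
  \<open>S\<close> is arbitrary, the compact set is found in \<open>O'\<close> and not in
  \<open>S\<close>.\<close>

lemma compact_containment:
  assumes T: "0 < T" and e: "0 < e"
  obtains K where "compact K" "K \<subseteq> O'" "\<xi> \<in> K" "mostly e (\<lambda>\<omega>. \<forall>t\<in>{0..T}. X t \<omega> \<in> K)"
proof -
  \<comment> \<open>The points of norm at most \<open>m\<close> at distance at least
    \<open>1 / (m + 1)\<close> from the complement of \<open>O'\<close>; written as an intersection,
    this also covers an empty complement.\<close>
  define K where "K = (\<lambda>m::nat. cball 0 (real m) \<inter> (\<Inter>y\<in>-O'. {x::real^'n. inverse (real (Suc m)) \<le> dist x y}))"
  have cK: "compact (K m)" for m
    unfolding K_def by (intro compact_Int_closed compact_cball closed_INT ballI closed_Collect_le continuous_intros)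
  have ev: "eventually (\<lambda>m. Z \<subseteq> K m) sequentially" if Z: "compact Z" "Z \<subseteq> O'" for Z
  proof -
    obtain d where d: "0 < d" "\<forall>x\<in>Z. \<forall>y\<in>-O'. d \<le> dist x y"
      using separate_compact_closed[OF Z(1), of "- O'"] Z(2) nbhd(1) by auto
    obtain B where B: "\<forall>x\<in>Z. norm x \<le> B"
      using compact_imp_bounded[OF Z(1)] unfolding bounded_iff by auto
    have "eventually (\<lambda>m. inverse (real (Suc m)) < d) sequentially"
      using order_tendstoD(2)[OF LIMSEQ_inverse_real_of_nat d(1)] .
    moreover have "eventually (\<lambda>m. B \<le> real m) sequentially"
      using eventually_ge_at_top[of "nat \<lceil>B\<rceil>"] by (rule eventually_mono) linarith
    ultimately show ?thesis
    proof eventually_elim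
      case (elim m)
      show ?case
      proof
        fix x assume x: "x \<in> Z"
        then have "norm x \<le> real m" using B elim by force
        moreover have "inverse (real (Suc m)) \<le> dist x y" if "y \<in> -O'" for y
          using d(2) x that elim by force
        ultimately show "x \<in> K m" by (auto simp: K_def)
      qed
    qed
  qed
  have "eventually (\<lambda>m. mostly e (\<lambda>\<omega>. \<forall>t\<in>{0..T}. X t \<omega> \<in> K m)) sequentially"
  proof (rule mostly_eventually[OF _ _ e])
    show "{\<omega> \<in> space M. \<forall>t\<in>{0..T}. X t \<omega> \<in> K m} \<in> events" for m
    proof (rule closed_path_event)
      show "X s \<in> borel_measurable M" if "s \<in> {0..T}" for s
        using that by (intro measurable_F_M[OF _ X_adapted]) simp_all
      show "continuous_on {0..T} (\<lambda>s. X s \<omega>)" if "\<omega> \<in> space M" for \<omega>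
        by (rule continuous_on_subset[OF X_cont[OF that]]) auto
    qed (simp_all add: compact_imp_closed cK)
    fix \<omega> assume w: "\<omega> \<in> space M"
    have "compact ((\<lambda>t. X t \<omega>) ` {0..T})"
      by (intro compact_continuous_image continuous_on_subset[OF X_cont[OF w]]) auto
    moreover have "(\<lambda>t. X t \<omega>) ` {0..T} \<subseteq> O'" using X_in[OF _ w] nbhd(2) by auto
    ultimately have "eventually (\<lambda>m. (\<lambda>t. X t \<omega>) ` {0..T} \<subseteq> K m) sequentially" by (rule ev)
    then show "eventually (\<lambda>m. \<forall>t\<in>{0..T}. X t \<omega> \<in> K m) sequentially"
      by (rule eventually_mono) auto
  qed
  moreover have "eventually (\<lambda>m. {\<xi>} \<subseteq> K m) sequentially"
    using initial(1) nbhd(2) by (intro ev) auto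
  ultimately have "eventually (\<lambda>m. mostly e (\<lambda>\<omega>. \<forall>t\<in>{0..T}. X t \<omega> \<in> K m) \<and> {\<xi>} \<subseteq> K m) sequentially"
    by (rule eventually_conj)
  then obtain m where m: "mostly e (\<lambda>\<omega>. \<forall>t\<in>{0..T}. X t \<omega> \<in> K m)" "\<xi> \<in> K m"
    unfolding eventually_sequentially by auto
  moreover have "K m \<subseteq> O'"
  proof
    fix x assume "x \<in> K m"
    then have "\<forall>y\<in>-O'. inverse (real (Suc m)) \<le> dist x y" by (auto simp: K_def)
    then show "x \<in> O'" by (cases "x \<in> O'") force+
  qed
  ultimately show ?thesis using that cK by blast
qed

end

section \<open>The survival probability\<close>

text \<open>Forms in the increment of the state become forms in the noise \<open>v\<close>, to which
  \<open>centered_quadratic_form\<close> applies. The last equation identifies the trace that arises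
  there with the second-order part of the generator.\<close>

lemma quadratic_pullback:
  fixes a :: "real^'d::finite^'n::finite" and v :: "real^'d"
  shows "(\<Sum>i\<in>UNIV. p i * (a *v v) $ i) = (\<Sum>j\<in>UNIV. (\<Sum>i\<in>UNIV. p i * a $ i $ j) * v $ j)"
    and "(\<Sum>i\<in>UNIV. \<Sum>l\<in>UNIV. q i l * ((a *v v) $ i * (a *v v) $ l)) =
      (\<Sum>j\<in>UNIV. \<Sum>k\<in>UNIV. (\<Sum>i\<in>UNIV. \<Sum>l\<in>UNIV. q i l * (a $ i $ j * a $ l $ k)) * (v $ j * v $ k))"
    and "(\<Sum>j\<in>UNIV. \<Sum>i\<in>UNIV. \<Sum>l\<in>UNIV. q i l * (a $ i $ j * a $ l $ j)) =
      (\<Sum>i\<in>UNIV. \<Sum>l\<in>UNIV. (a ** transpose a) $ i $ l * q i l)"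
proof -
  have "(\<Sum>i\<in>UNIV. p i * (a *v v) $ i) = (\<Sum>i\<in>UNIV. \<Sum>j\<in>UNIV. p i * a $ i $ j * v $ j)"
    by (simp add: matrix_vector_mult_def sum_distrib_left mult.assoc)
  also have "\<dots> = (\<Sum>j\<in>UNIV. \<Sum>i\<in>UNIV. p i * a $ i $ j * v $ j)" by (rule sum.swap)
  finally show "(\<Sum>i\<in>UNIV. p i * (a *v v) $ i) = (\<Sum>j\<in>UNIV. (\<Sum>i\<in>UNIV. p i * a $ i $ j) * v $ j)"
    by (simp add: sum_distrib_right)
  define t where "t = (\<lambda>i l j k. q i l * (a $ i $ j * a $ l $ k) * (v $ j * v $ k))"
  have "(\<Sum>i\<in>UNIV. \<Sum>l\<in>UNIV. q i l * ((a *v v) $ i * (a *v v) $ l)) = (\<Sum>i\<in>UNIV. \<Sum>l\<in>UNIV. \<Sum>j\<in>UNIV. \<Sum>k\<in>UNIV. t i l j k)"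
  proof -
    have "(a *v v) $ i * (a *v v) $ l = (\<Sum>j\<in>UNIV. \<Sum>k\<in>UNIV. (a $ i $ j * v $ j) * (a $ l $ k * v $ k))" for i l
      by (simp add: matrix_vector_mult_def sum_product)
    then show ?thesis
      unfolding t_def by (simp only: sum_distrib_left) (intro sum.cong refl, simp add: mult_ac)
  qed
  also have "\<dots> = (\<Sum>i\<in>UNIV. \<Sum>j\<in>UNIV. \<Sum>l\<in>UNIV. \<Sum>k\<in>UNIV. t i l j k)" by (intro sum.cong refl sum.swap)
  also have "\<dots> = (\<Sum>i\<in>UNIV. \<Sum>j\<in>UNIV. \<Sum>k\<in>UNIV. \<Sum>l\<in>UNIV. t i l j k)" by (intro sum.cong refl sum.swap)
  also have "\<dots> = (\<Sum>j\<in>UNIV. \<Sum>i\<in>UNIV. \<Sum>k\<in>UNIV. \<Sum>l\<in>UNIV. t i l j k)" by (rule sum.swap)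
  also have "\<dots> = (\<Sum>j\<in>UNIV. \<Sum>k\<in>UNIV. \<Sum>i\<in>UNIV. \<Sum>l\<in>UNIV. t i l j k)" by (intro sum.cong refl sum.swap)
  finally show "(\<Sum>i\<in>UNIV. \<Sum>l\<in>UNIV. q i l * ((a *v v) $ i * (a *v v) $ l)) =
      (\<Sum>j\<in>UNIV. \<Sum>k\<in>UNIV. (\<Sum>i\<in>UNIV. \<Sum>l\<in>UNIV. q i l * (a $ i $ j * a $ l $ k)) * (v $ j * v $ k))"
    by (simp add: t_def sum_distrib_right)
  have "(\<Sum>j\<in>UNIV. \<Sum>i\<in>UNIV. \<Sum>l\<in>UNIV. q i l * (a $ i $ j * a $ l $ j)) = (\<Sum>i\<in>UNIV. \<Sum>j\<in>UNIV. \<Sum>l\<in>UNIV. q i l * (a $ i $ j * a $ l $ j))"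
    by (rule sum.swap)
  also have "\<dots> = (\<Sum>i\<in>UNIV. \<Sum>l\<in>UNIV. \<Sum>j\<in>UNIV. q i l * (a $ i $ j * a $ l $ j))" by (intro sum.cong refl sum.swap)
  finally show "(\<Sum>j\<in>UNIV. \<Sum>i\<in>UNIV. \<Sum>l\<in>UNIV. q i l * (a $ i $ j * a $ l $ j)) =
      (\<Sum>i\<in>UNIV. \<Sum>l\<in>UNIV. (a ** transpose a) $ i $ l * q i l)"
    by (simp add: matrix_matrix_mult_def transpose_def sum_distrib_left mult.commute)
qed

lemma mult_divide_self: "0 < x \<Longrightarrow> x * (y / x) = y" for x y :: real
  by simp

context controlled_diffusion
begin

text \<open>The Euler scheme has not been stopped before or at the \<open>k\<close>-th grid point; \<open>\<theta>\<close> is the level at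
  which \<open>h\<close> counts as small.\<close>

definition alive :: "real \<Rightarrow> nat \<Rightarrow> (real^'n) set \<Rightarrow> real \<Rightarrow> real \<Rightarrow> nat \<Rightarrow> 'w \<Rightarrow> bool"
  where "alive T N K \<delta> \<theta> k \<omega> \<longleftrightarrow> (\<forall>j\<in>{..k}. \<theta> < h (X (grid_pt T N j) \<omega>) \<and> X (grid_pt T N j) \<omega> \<in> K \<and>
    norm (euler T N j \<omega> - X (grid_pt T N j) \<omega>) \<le> \<delta>)"

lemma alive_measurable:
  assumes "0 < T" "0 < N" "closed K"
  shows "Measurable.pred (F (grid_pt T N k)) (alive T N K \<delta> \<theta> k)"
proof -
  note nn = grid_pt_nonneg[OF assms(1), of N]
  have "Measurable.pred (F (grid_pt T N k)) (\<lambda>\<omega>. \<theta> < h (X (grid_pt T N j) \<omega>) \<and> X (grid_pt T N j) \<omega> \<in> K \<and>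
    norm (euler T N j \<omega> - X (grid_pt T N j) \<omega>) \<le> \<delta>)" if "j \<in> {..k}" for j
  proof -
    have le: "grid_pt T N j \<le> grid_pt T N k" using that by (intro grid_pt_mono[OF assms(1)]) simp
    have Xm: "X (grid_pt T N j) \<in> borel_measurable (F (grid_pt T N k))"
      by (rule measurable_F_mono[OF nn le X_adapted[OF nn]])
    have Ym: "(\<lambda>\<omega>. norm (euler T N j \<omega> - X (grid_pt T N j) \<omega>)) \<in> borel_measurable (F (grid_pt T N k))"
      by (rule measurable_norm_comp[OF borel_measurable_diff[OF measurable_F_mono[OF nn le euler_adapted[OF assms(1,2)]] Xm]])
    have hm: "(\<lambda>\<omega>. h (X (grid_pt T N j) \<omega>)) \<in> borel_measurable (F (grid_pt T N k))"
      by (rule measurable_F_mono[OF nn le comp_adapted[OF h_cont nn]])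
    have 1: "Measurable.pred (F (grid_pt T N k)) (\<lambda>\<omega>. \<theta> < h (X (grid_pt T N j) \<omega>))"
      unfolding pred_def by (rule borel_measurable_less[OF borel_measurable_const hm])
    have 2: "Measurable.pred (F (grid_pt T N k)) (\<lambda>\<omega>. X (grid_pt T N j) \<omega> \<in> K)"
      using measurable_sets[OF Xm borel_closed[OF assms(3)]] unfolding pred_def by (simp add: vimage_def Int_def conj_commute)
    have 3: "Measurable.pred (F (grid_pt T N k)) (\<lambda>\<omega>. norm (euler T N j \<omega> - X (grid_pt T N j) \<omega>) \<le> \<delta>)"
      unfolding pred_def by (rule borel_measurable_le[OF Ym borel_measurable_const])
    show ?thesis by (rule pred_intros_logic(3)[OF 1 pred_intros_logic(3)[OF 2 3]])
  qed
  then have "Measurable.pred (F (grid_pt T N k)) (\<lambda>\<omega>. \<forall>j\<in>{..k}. \<theta> < h (X (grid_pt T N j) \<omega>) \<and> X (grid_pt T N j) \<omega> \<in> K \<and>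
    norm (euler T N j \<omega> - X (grid_pt T N j) \<omega>) \<le> \<delta>)"
    by (rule pred_intros_finite(3)[OF finite_atMost])
  then show ?thesis unfolding alive_def[abs_def] .
qed

text \<open>As long as the scheme is alive, its coefficients are bounded by \<open>C1\<close> and
  its point has a \<open>\<delta>\<close>-ball in \<open>K\<close>, so the step can be expanded.
  \<open>Z\<close> collects the errors minus the martingale increments; the latter have mean 0, and
  \<open>N\<close> steps of length \<open>T / N\<close> give the factors \<open>T\<close> in the
  bound.\<close>

lemma stopped_taylor_sum:
  fixes K K0 :: "(real^'n) set" and T :: real
  defines "\<phi> \<equiv> \<lambda>x. if x \<in> K then h x else 0"
  assumes T: "0 < T" and N: "0 < N" "T / N \<le> 1"
    and K: "compact K" "K \<subseteq> O'" and K0: "closed K0"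
    and coef: "\<And>x. x \<in> S \<Longrightarrow> x \<in> K0 \<Longrightarrow> norm (f x) + norm (g x) * Ku \<le> C1" "\<And>x. x \<in> S \<Longrightarrow> x \<in> K0 \<Longrightarrow> norm (\<sigma> x) \<le> C1"
    and C1: "0 \<le> C1" and L: "0 \<le> L" "\<And>x i. x \<in> K \<Longrightarrow> \<bar>partial_deriv i h x\<bar> \<le> L"
      "\<And>x i j. x \<in> K \<Longrightarrow> \<bar>partial_deriv i (partial_deriv j h) x\<bar> \<le> L"
    and \<delta>: "0 < \<delta>" and nb: "\<And>x y. x \<in> K0 \<Longrightarrow> norm (y - x) \<le> \<delta> \<Longrightarrow> cball y \<delta> \<subseteq> K"
    and w: "0 \<le> w" and C: "0 \<le> C"
    and taylor: "\<And>y z. cball y \<delta> \<subseteq> K \<Longrightarrow> \<bar>\<phi> (y + z) - h y - (\<Sum>i\<in>UNIV. partial_deriv i h y * z $ i)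
      - 1/2 * (\<Sum>i\<in>UNIV. \<Sum>j\<in>UNIV. partial_deriv i (partial_deriv j h) y * (z $ i * z $ j))\<bar> \<le> w * (norm z)\<^sup>2 + C * (norm z)^4"
  obtains Z where "integrable M Z"
    "expectation Z \<le> (2 * C1\<^sup>2 + 2 * (real CARD('n))\<^sup>2 * L * C1\<^sup>2) * (w + sqrt (T / N)) * ((1 + real CARD('d)) * T)
      + 8 * C * C1^4 * ((1 + 3 * (real CARD('d))\<^sup>2) * T * (T / N))"
    "\<And>\<omega>. \<omega> \<in> space M \<Longrightarrow> (\<Sum>k<N. if alive T N K0 \<delta> \<theta> k \<omega> then \<phi> (euler T N (Suc k) \<omega>) - \<phi> (euler T N k \<omega>) else 0)
      \<ge> (\<Sum>k<N. if alive T N K0 \<delta> \<theta> k \<omega> then (\<Sum>i\<in>UNIV. partial_deriv i h (euler T N k \<omega>) * euler_drift T N k \<omega> $ i) +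
        1/2 * (T / N) * (\<Sum>i\<in>UNIV. \<Sum>j\<in>UNIV. (\<sigma> (X (grid_pt T N k) \<omega>) ** transpose (\<sigma> (X (grid_pt T N k) \<omega>))) $ i $ j
          * partial_deriv i (partial_deriv j h) (euler T N k \<omega>)) else 0) - Z \<omega>"
proof -
  define dt where "dt = T / N"
  have dt: "0 < dt" "dt \<le> 1" using T N by (auto simp: dt_def)
  define n where "n = real CARD('n)"
  define d where "d = real CARD('d)"
  define A1 where "A1 = 2 * C1\<^sup>2 + 2 * n\<^sup>2 * L * C1\<^sup>2"
  have A1: "0 \<le> A1" unfolding A1_def using L C1 by simp
  define dW where "dW = (\<lambda>k \<omega>. W (grid_pt T N (Suc k)) \<omega> - W (grid_pt T N k) \<omega>)"
  define a where "a = (\<lambda>k \<omega>. \<sigma> (X (grid_pt T N k) \<omega>))"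
  define Y where "Y = euler T N"
  define P where "P = alive T N K0 \<delta> \<theta>"
  \<comment> \<open>Cutting the derivatives off outside \<open>K\<close> makes the coefficients of
    the noise Borel and bounded on the whole probability space; while the scheme is alive this
    changes nothing.\<close>
  define p where "p = (\<lambda>i x. indicator K x * partial_deriv i h x)"
  define q where "q = (\<lambda>i j x. indicator K x * partial_deriv i (partial_deriv j h) x)"
  \<comment> \<open>Whether the scheme is alive at step \<open>k\<close> is known when the step
    begins, so switching the coefficients off afterwards keeps the increments centred.\<close>
  define \<alpha> where "\<alpha> = (\<lambda>k j \<omega>. if P k \<omega> then \<Sum>i\<in>UNIV. p i (Y k \<omega>) * a k \<omega> $ i $ j else 0)"
  define B where "B = (\<lambda>k j l \<omega>. if P k \<omega> then \<Sum>i\<in>UNIV. \<Sum>m\<in>UNIV. q i m (Y k \<omega>) * (a k \<omega> $ i $ j * a k \<omega> $ m $ l) else 0)"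
  define Mt where "Mt = (\<lambda>k \<omega>. (\<Sum>j\<in>UNIV. \<alpha> k j \<omega> * dW k \<omega> $ j)
    + 1/2 * ((\<Sum>j\<in>UNIV. \<Sum>l\<in>UNIV. B k j l \<omega> * (dW k \<omega> $ j * dW k \<omega> $ l)) - dt * (\<Sum>j\<in>UNIV. B k j j \<omega>)))"
  \<comment> \<open>The error is charged for stopped steps too: it is nonnegative, and its
    expectation needs only the moments of the whole noise increment.\<close>
  define err where "err = (\<lambda>k \<omega>. A1 * (w + sqrt dt) * (dt + (norm (dW k \<omega>))\<^sup>2) + 8 * C * C1^4 * (dt\<^sup>2 + norm (dW k \<omega>)^4))"
  note nn = grid_pt_nonneg[OF T, of N] and st = grid_pt_strict[OF T N(1)]
  have bK: "K \<in> sets borel" using K(1) by (intro borel_compact)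
  have alive: "X (grid_pt T N k) \<omega> \<in> S" "X (grid_pt T N k) \<omega> \<in> K0" "Y k \<omega> \<in> K" "cball (Y k \<omega>) \<delta> \<subseteq> K" "norm (a k \<omega>) \<le> C1"
    "norm (euler_drift T N k \<omega>) \<le> C1 * dt"
    if "P k \<omega>" "\<omega> \<in> space M" for k \<omega>
  proof -
    have 1: "X (grid_pt T N k) \<omega> \<in> K0" "norm (Y k \<omega> - X (grid_pt T N k) \<omega>) \<le> \<delta>"
      using that(1) by (auto simp: P_def alive_def Y_def)
    have XS: "X (grid_pt T N k) \<omega> \<in> S" by (rule X_in[OF nn that(2)])
    show "X (grid_pt T N k) \<omega> \<in> S" by (rule XS)
    show "X (grid_pt T N k) \<omega> \<in> K0" by (rule 1)
    show "norm (a k \<omega>) \<le> C1" unfolding a_def by (rule coef(2)[OF XS 1(1)])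
    show "norm (euler_drift T N k \<omega>) \<le> C1 * dt"
      using euler_drift_bound[OF T N(1) that(2), of k] coef(1)[OF XS 1(1)] dt(1) mult_right_mono[OF coef(1)[OF XS 1(1)], of dt]
      unfolding dt_def by linarith
    show cb: "cball (Y k \<omega>) \<delta> \<subseteq> K" by (rule nb[OF 1])
    then show "Y k \<omega> \<in> K" using \<delta> by auto
  qed
  have aij: "\<bar>a k \<omega> $ i $ j\<bar> \<le> C1" if "P k \<omega>" "\<omega> \<in> space M" for k \<omega> i j
    using component_le_norm_cart[of "a k \<omega> $ i" j] Finite_Cartesian_Product.norm_nth_le[of "a k \<omega>" i] alive(5)[OF that] by linarith
  have Ym: "Y k \<in> borel_measurable (F (grid_pt T N k))" for k unfolding Y_def by (rule euler_adapted[OF T N(1)])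
  have am: "(\<lambda>\<omega>. a k \<omega> $ i $ j) \<in> borel_measurable (F (grid_pt T N k))" for k i j
    unfolding a_def by (intro measurable_vec_nth_comp comp_adapted[OF coef_cont(3) nn])
  have hat: "(\<lambda>x. indicator K x * \<psi> x) \<in> borel_measurable borel" if "continuous_on O' \<psi>" for \<psi> :: "real^'n \<Rightarrow> real"
    using borel_measurable_continuous_on_indicator[OF bK continuous_on_subset[OF that K(2)]] by simp
  have pm: "(\<lambda>\<omega>. p i (Y k \<omega>)) \<in> borel_measurable (F (grid_pt T N k))" for i k
    unfolding p_def by (rule measurable_compose[OF Ym hat[OF C2_open_continuous(2)[OF C2]]])
  have qm: "(\<lambda>\<omega>. q i j (Y k \<omega>)) \<in> borel_measurable (F (grid_pt T N k))" for i j k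
    unfolding q_def by (rule measurable_compose[OF Ym hat[OF C2_openD(3)[OF C2]]])
  have Pm: "{\<omega>\<in>space (F (grid_pt T N k)). P k \<omega>} \<in> sets (F (grid_pt T N k))" for k
    using alive_measurable[OF T N(1) K0] unfolding P_def pred_def .
  have \<alpha>m: "\<alpha> k j \<in> borel_measurable (F (grid_pt T N k))" for k j
    unfolding \<alpha>_def by (intro measurable_If borel_measurable_sum borel_measurable_times pm am borel_measurable_const Pm)
  have Bm: "B k j l \<in> borel_measurable (F (grid_pt T N k))" for k j l
    unfolding B_def by (intro measurable_If borel_measurable_sum borel_measurable_times qm am borel_measurable_const Pm)
  define Kb where "Kb = n * (L * C1) + n * (n * (L * (C1 * C1)))"
  have Kb: "0 \<le> n * (L * C1)" "0 \<le> n * (n * (L * (C1 * C1)))" using L C1 by (auto simp: n_def)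
  have pb: "\<bar>p i (Y k \<omega>)\<bar> \<le> L" for i k \<omega> using L by (auto simp: p_def indicator_def)
  have qb: "\<bar>q i j (Y k \<omega>)\<bar> \<le> L" for i j k \<omega> using L by (auto simp: q_def indicator_def)
  have \<alpha>b: "\<bar>\<alpha> k j \<omega>\<bar> \<le> Kb" if "\<omega> \<in> space M" for k j \<omega>
  proof (cases "P k \<omega>")
    case True
    have "\<bar>\<Sum>i\<in>UNIV. p i (Y k \<omega>) * a k \<omega> $ i $ j\<bar> \<le> (\<Sum>i\<in>(UNIV::'n set). L * C1)"
      using L(1) by (intro order_trans[OF sum_abs] sum_mono) (auto simp: abs_mult intro!: mult_mono pb aij[OF True that])
    then show ?thesis using True Kb by (simp add: \<alpha>_def Kb_def n_def)
  qed (use Kb in \<open>simp add: \<alpha>_def Kb_def\<close>)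
  have Bb: "\<bar>B k j l \<omega>\<bar> \<le> Kb" if "\<omega> \<in> space M" for k j l \<omega>
  proof (cases "P k \<omega>")
    case True
    have "\<bar>\<Sum>i\<in>UNIV. \<Sum>m\<in>UNIV. q i m (Y k \<omega>) * (a k \<omega> $ i $ j * a k \<omega> $ m $ l)\<bar> \<le> (\<Sum>i\<in>(UNIV::'n set). \<Sum>m\<in>(UNIV::'n set). L * (C1 * C1))"
      using L(1) C1 by (intro order_trans[OF sum_abs] sum_mono) (auto simp: abs_mult intro!: mult_mono qb aij[OF True that])
    then show ?thesis using True Kb by (simp add: B_def Kb_def n_def)
  qed (use Kb in \<open>simp add: B_def Kb_def\<close>)
  have dt_eq: "grid_pt T N (Suc k) - grid_pt T N k = dt" for k by (simp add: grid_pt_step dt_def)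
  have Mt: "has_bochner_integral M (Mt k) 0" for k
    using centered_quadratic_form[OF nn[of k] st[of k], of "\<alpha> k" Kb "B k", OF \<alpha>m \<alpha>b Bm Bb]
    unfolding Mt_def dW_def dt_eq .
  have errI: "integrable M (err k)" and errE: "expectation (err k) \<le> A1 * (w + sqrt dt) * ((1 + d) * dt) + 8 * C * C1^4 * ((1 + 3 * d\<^sup>2) * dt\<^sup>2)" for k
  proof -
    note m = increment_norm_moments[OF nn[of k] st[of k], unfolded dt_eq]
    have i2: "integrable M (\<lambda>\<omega>. (norm (dW k \<omega>))\<^sup>2)" "expectation (\<lambda>\<omega>. (norm (dW k \<omega>))\<^sup>2) = d * dt"
      using m(1) by (auto simp: has_bochner_integral_iff dW_def d_def)
    have i4: "integrable M (\<lambda>\<omega>. norm (dW k \<omega>)^4)" "expectation (\<lambda>\<omega>. norm (dW k \<omega>)^4) \<le> 3 * d\<^sup>2 * dt\<^sup>2"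
      using m(2,3) by (auto simp: dW_def d_def)
    have c: "integrable M (\<lambda>\<omega>. x)" for x :: real by simp
    have j2: "integrable M (\<lambda>\<omega>. dt + (norm (dW k \<omega>))\<^sup>2)" and j4: "integrable M (\<lambda>\<omega>. dt\<^sup>2 + norm (dW k \<omega>)^4)"
      using i2 i4 by (auto intro!: Bochner_Integration.integrable_add)
    show "integrable M (err k)"
      unfolding err_def by (intro Bochner_Integration.integrable_add integrable_mult_right j2 j4)
    have "expectation (err k) = A1 * (w + sqrt dt) * (dt + d * dt) + 8 * C * C1^4 * (dt\<^sup>2 + expectation (\<lambda>\<omega>. norm (dW k \<omega>)^4))"
      unfolding err_def using i2 i4 j2 j4 by (simp add: prob_space)
    also have "\<dots> \<le> A1 * (w + sqrt dt) * (dt + d * dt) + 8 * C * C1^4 * (dt\<^sup>2 + 3 * d\<^sup>2 * dt\<^sup>2)"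
      using i4 C C1 by (intro add_left_mono mult_left_mono) auto
    also have "\<dots> = A1 * (w + sqrt dt) * ((1 + d) * dt) + 8 * C * C1^4 * ((1 + 3 * d\<^sup>2) * dt\<^sup>2)"
      by (simp only: distrib_right mult_1_left)
    finally show "expectation (err k) \<le> A1 * (w + sqrt dt) * ((1 + d) * dt) + 8 * C * C1^4 * ((1 + 3 * d\<^sup>2) * dt\<^sup>2)" .
  qed
  define Z where "Z = (\<lambda>\<omega>. (\<Sum>k<N. err k \<omega>) - (\<Sum>k<N. Mt k \<omega>))"
  have MtI: "integrable M (Mt k)" "expectation (Mt k) = 0" for k using Mt by (auto simp: has_bochner_integral_iff)
  have Ndt: "real N * dt = T" using N by (simp add: dt_def)
  show ?thesis
  proof (rule that[of Z])
    show "integrable M Z"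
      unfolding Z_def by (intro Bochner_Integration.integrable_diff Bochner_Integration.integrable_sum errI MtI)
    have "expectation Z = (\<Sum>k<N. expectation (err k)) - (\<Sum>k<N. expectation (Mt k))"
      unfolding Z_def using errI MtI by simp
    also have "\<dots> \<le> (\<Sum>k<N. A1 * (w + sqrt dt) * ((1 + d) * dt) + 8 * C * C1^4 * ((1 + 3 * d\<^sup>2) * dt\<^sup>2))"
    proof -
      have "(\<Sum>k<N. expectation (err k)) \<le> (\<Sum>k<N. A1 * (w + sqrt dt) * ((1 + d) * dt) + 8 * C * C1^4 * ((1 + 3 * d\<^sup>2) * dt\<^sup>2))"
        by (intro sum_mono errE)
      then show ?thesis by (simp only: MtI(2) sum.neutral_const diff_zero)
    qed
    also have "\<dots> = A1 * (w + sqrt dt) * ((1 + d) * (real N * dt)) + 8 * C * C1^4 * ((1 + 3 * d\<^sup>2) * (real N * dt) * dt)"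
      by (simp add: algebra_simps power2_eq_square)
    finally show "expectation Z \<le> (2 * C1\<^sup>2 + 2 * (real CARD('n))\<^sup>2 * L * C1\<^sup>2) * (w + sqrt (T / N)) * ((1 + real CARD('d)) * T)
      + 8 * C * C1^4 * ((1 + 3 * (real CARD('d))\<^sup>2) * T * (T / N))"
      unfolding Ndt unfolding A1_def n_def d_def dt_def .
  next
    fix \<omega> assume \<omega>: "\<omega> \<in> space M"
    have step: "(if P k \<omega> then \<phi> (Y (Suc k) \<omega>) - \<phi> (Y k \<omega>) else 0) \<ge> (if P k \<omega> then (\<Sum>i\<in>UNIV. partial_deriv i h (Y k \<omega>) * euler_drift T N k \<omega> $ i) +
        1/2 * dt * (\<Sum>i\<in>UNIV. \<Sum>j\<in>UNIV. (a k \<omega> ** transpose (a k \<omega>)) $ i $ j * partial_deriv i (partial_deriv j h) (Y k \<omega>)) else 0) - (err k \<omega> - Mt k \<omega>)" for k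
    proof (cases "P k \<omega>")
      case False
      have "0 \<le> err k \<omega>" unfolding err_def using A1 w C dt C1 by (intro add_nonneg_nonneg mult_nonneg_nonneg) auto
      moreover have "Mt k \<omega> = 0" using False by (simp add: Mt_def \<alpha>_def B_def)
      ultimately show ?thesis using False by simp
    next
      case True
      note al = alive[OF True \<omega>]
      define y where "y = Y k \<omega>"
      define b where "b = euler_drift T N k \<omega>"
      define s where "s = a k \<omega>"
      define v where "v = dW k \<omega>"
      have yK: "y \<in> K" using al by (simp add: y_def)
      have Ys: "Y (Suc k) \<omega> = y + (b + s *v v)"
        by (simp add: y_def b_def s_def v_def Y_def euler_def a_def dW_def)
      have \<phi>y: "\<phi> y = h y" using yK by (simp add: \<phi>_def)
      have "\<phi> (y + (b + s *v v)) - h y \<ge> (\<Sum>i\<in>UNIV. partial_deriv i h y * b $ i) + (\<Sum>i\<in>UNIV. partial_deriv i h y * (s *v v) $ i)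
        + 1/2 * (\<Sum>i\<in>UNIV. \<Sum>j\<in>UNIV. partial_deriv i (partial_deriv j h) y * ((s *v v) $ i * (s *v v) $ j))
        - ((2 * C1\<^sup>2 + 2 * (real CARD('n))\<^sup>2 * L * C1\<^sup>2) * (w + sqrt dt) * (dt + (norm v)\<^sup>2) + 8 * C * C1^4 * (dt\<^sup>2 + (norm v)^4))"
        using al L(3)[OF yK] taylor[of y "b + s *v v"]
        by (intro euler_step_bound dt w C L(1)) (auto simp: y_def b_def s_def)
      moreover have "err k \<omega> = (2 * C1\<^sup>2 + 2 * (real CARD('n))\<^sup>2 * L * C1\<^sup>2) * (w + sqrt dt) * (dt + (norm v)\<^sup>2) + 8 * C * C1^4 * (dt\<^sup>2 + (norm v)^4)"
        by (simp add: err_def A1_def n_def v_def)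
      \<comment> \<open>The compensator of the quadratic term is \<open>dt\<close> times the
        second-order part of the generator; subtracted here, it reappears beside the drift in the
        claim.\<close>
      moreover have "Mt k \<omega> = (\<Sum>i\<in>UNIV. partial_deriv i h y * (s *v v) $ i)
        + 1/2 * ((\<Sum>i\<in>UNIV. \<Sum>j\<in>UNIV. partial_deriv i (partial_deriv j h) y * ((s *v v) $ i * (s *v v) $ j))
          - dt * (\<Sum>i\<in>UNIV. \<Sum>j\<in>UNIV. (s ** transpose s) $ i $ j * partial_deriv i (partial_deriv j h) y))"
        unfolding quadratic_pullback(1,2) quadratic_pullback(3)[symmetric]
        using True yK by (simp add: Mt_def \<alpha>_def B_def p_def q_def y_def s_def v_def)
      ultimately show ?thesis
        using True unfolding y_def[symmetric] b_def[symmetric] s_def[symmetric] Ys \<phi>y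
        by (simp add: right_diff_distrib)
    qed
    have "(\<Sum>k<N. if P k \<omega> then \<phi> (Y (Suc k) \<omega>) - \<phi> (Y k \<omega>) else 0) \<ge> (\<Sum>k<N. (if P k \<omega> then (\<Sum>i\<in>UNIV. partial_deriv i h (Y k \<omega>) * euler_drift T N k \<omega> $ i) +
        1/2 * dt * (\<Sum>i\<in>UNIV. \<Sum>j\<in>UNIV. (a k \<omega> ** transpose (a k \<omega>)) $ i $ j * partial_deriv i (partial_deriv j h) (Y k \<omega>)) else 0) - (err k \<omega> - Mt k \<omega>))"
      by (rule sum_mono) (rule step)
    then show "(\<Sum>k<N. if alive T N K0 \<delta> \<theta> k \<omega> then \<phi> (euler T N (Suc k) \<omega>) - \<phi> (euler T N k \<omega>) else 0)
      \<ge> (\<Sum>k<N. if alive T N K0 \<delta> \<theta> k \<omega> then (\<Sum>i\<in>UNIV. partial_deriv i h (euler T N k \<omega>) * euler_drift T N k \<omega> $ i) +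
        1/2 * (T / N) * (\<Sum>i\<in>UNIV. \<Sum>j\<in>UNIV. (\<sigma> (X (grid_pt T N k) \<omega>) ** transpose (\<sigma> (X (grid_pt T N k) \<omega>))) $ i $ j
          * partial_deriv i (partial_deriv j h) (euler T N k \<omega>)) else 0) - Z \<omega>"
      unfolding Z_def P_def Y_def a_def dt_def by (simp only: sum_subtractf)
  qed
qed

text \<open>Origin of \<open>(c + 8) * e\<close>: stopping at the level \<open>2 * e\<close> with an
  error \<open>e\<close> in \<open>h\<close> gives 3, the loss in the generator 1, the expectation
  of \<open>Z\<close> 3 and the event \<open>EB\<close> 1; the exit from \<open>K0\<close>
  contributes \<open>c * e\<close>.\<close>

lemma survival_bound_step:
  assumes T: "0 < T" and c: "0 < c" "\<And>x. x \<in> S \<Longrightarrow> h x \<le> c" and e: "0 < e" "e < 1" "2 * e < h \<xi>"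
    and Am: "{\<omega>\<in>space M. \<forall>t\<in>{0..T}. 0 < h (X t \<omega>)} \<in> events"
  shows "h \<xi> \<le> c * prob {\<omega>\<in>space M. \<forall>t\<in>{0..T}. 0 < h (X t \<omega>)} + (c + 8) * e"
proof -
  define n where "n = real CARD('n)"
  define d where "d = real CARD('d)"
  obtain K0 where K0: "compact K0" "K0 \<subseteq> O'" "\<xi> \<in> K0" and mK0: "mostly e (\<lambda>\<omega>. \<forall>t\<in>{0..T}. X t \<omega> \<in> K0)"
    using compact_containment[OF T e(1)] by blast
  obtain ER where ER: "ER \<in> events" "prob ER \<le> e" "\<And>\<omega>. \<omega> \<in> space M \<Longrightarrow> \<omega> \<notin> ER \<Longrightarrow> \<forall>t\<in>{0..T}. X t \<omega> \<in> K0"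
    using mostlyE[OF mK0] by blast
  have K0ne: "K0 \<noteq> {}" using K0(3) by auto
  \<comment> \<open>Euler points, and balls around them, are close to \<open>K0\<close> but need not
    lie in it; the neighbourhood \<open>K\<close> of width \<open>r0\<close> makes room for them
    inside \<open>O'\<close>.\<close>
  obtain r0 where r0: "0 < r0" "{x. infdist x K0 \<le> r0} \<subseteq> O'"
    using compact_in_open_separated[OF K0ne K0(1) nbhd(1) K0(2)] by blast
  define K where "K = {x. infdist x K0 \<le> r0}"
  have K: "compact K" "K \<subseteq> O'"
    unfolding K_def using compact_infdist_le[OF K0ne K0(1) r0(1)] r0(2) by auto
  have near: "y \<in> K" if "x \<in> K0" "norm (y - x) \<le> r0" for x y
    using infdist_le[OF that(1), of y] that(2) by (simp add: K_def dist_norm)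
  obtain R0 where R0: "\<And>x. x \<in> K0 \<Longrightarrow> norm x \<le> R0"
    using compact_imp_bounded[OF K0(1)] unfolding bounded_iff by auto
  obtain Kf where Kf: "0 \<le> Kf" "\<And>x. x \<in> S \<Longrightarrow> norm x \<le> R0 \<Longrightarrow> norm (f x) \<le> Kf" using linear_growth_bound[OF growth(1)] by blast
  obtain Kg where Kg: "0 \<le> Kg" "\<And>x. x \<in> S \<Longrightarrow> norm x \<le> R0 \<Longrightarrow> norm (g x) \<le> Kg" using linear_growth_bound[OF growth(2)] by blast
  obtain Ks where Ks: "0 \<le> Ks" "\<And>x. x \<in> S \<Longrightarrow> norm x \<le> R0 \<Longrightarrow> norm (\<sigma> x) \<le> Ks" using linear_growth_bound[OF growth(3)] by blast
  define C1 where "C1 = Kf + Kg * Ku + Ks"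
  have C1: "0 \<le> C1" unfolding C1_def using Kf Kg Ks Ku_nonneg by simp
  have coef: "norm (f x) + norm (g x) * Ku \<le> C1" "norm (\<sigma> x) \<le> C1" if "x \<in> S" "x \<in> K0" for x
  proof -
    have "norm (g x) * Ku \<le> Kg * Ku" using Kg(2)[OF that(1) R0[OF that(2)]] Ku_nonneg by (rule mult_right_mono)
    then show "norm (f x) + norm (g x) * Ku \<le> C1"
      using Kf(2)[OF that(1) R0[OF that(2)]] Ks(1) unfolding C1_def by linarith
    have "0 \<le> Kg * Ku" using Kg Ku_nonneg by simp
    then show "norm (\<sigma> x) \<le> C1"
      using Ks(2)[OF that(1) R0[OF that(2)]] Kf(1) unfolding C1_def by linarith
  qed
  obtain L where L: "0 \<le> L" "\<And>x. x \<in> K \<Longrightarrow> \<bar>h x\<bar> \<le> L" "\<And>x i. x \<in> K \<Longrightarrow> \<bar>partial_deriv i h x\<bar> \<le> L"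
    "\<And>x i j. x \<in> K \<Longrightarrow> \<bar>partial_deriv i (partial_deriv j h) x\<bar> \<le> L"
    using C2_bounded_on_compact[OF C2 K] by blast
  \<comment> \<open>Inside a cell the state may leave \<open>K0\<close>, where \<open>C1\<close> is
    a bound; oscillations of at most \<open>\<delta> \<le> 1\<close> in the coefficients change the
    drift by at most \<open>1 + Ku\<close> and the diffusion matrix by at most 1.\<close>
  define R where "R = C1 + 1 + Ku"
  obtain G where G: "0 < G" "\<And>b (s::real^'d^'n) y. norm b \<le> R \<Longrightarrow> norm s \<le> R \<Longrightarrow> y \<in> K \<Longrightarrow> \<bar>gen_at h b s y\<bar> \<le> G"
    using gen_at_bounded[OF C2 K] by blast
  have eT: "0 < e / T" using e T by simp
  obtain d1 where d1: "0 < d1" "\<And>b b' (s::real^'d^'n) s' y y'. norm b \<le> R \<Longrightarrow> norm s \<le> R \<Longrightarrow> y \<in> K \<Longrightarrow>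
    norm b' \<le> R \<Longrightarrow> norm s' \<le> R \<Longrightarrow> y' \<in> K \<Longrightarrow> norm (b - b') < d1 \<Longrightarrow> norm (s - s') < d1 \<Longrightarrow> norm (y - y') < d1 \<Longrightarrow>
    \<bar>gen_at h b s y - gen_at h b' s' y'\<bar> < e / T"
    using gen_at_uniform[OF C2 K eT] by blast
  have "uniformly_continuous_on K h"
    by (rule compact_uniformly_continuous[OF continuous_on_subset[OF C2_open_continuous(1)[OF C2] K(2)] K(1)])
  then obtain d2 where d2: "0 < d2" "\<And>x x'. x \<in> K \<Longrightarrow> x' \<in> K \<Longrightarrow> dist x' x < d2 \<Longrightarrow> dist (h x') (h x) < e"
    unfolding uniformly_continuous_on_def using e(1) by metis
  define A1 where "A1 = 2 * C1\<^sup>2 + 2 * n\<^sup>2 * L * C1\<^sup>2"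
  have A1: "0 \<le> A1" unfolding A1_def using L C1 by simp
  have dpos: "0 < (1 + d) * T" unfolding d_def using T by (intro mult_pos_pos) auto
  \<comment> \<open>The Taylor tolerance \<open>w\<close> accumulates to
    \<open>A1 * w * ((1 + d) * T)\<close>, which is to be at most \<open>e\<close>; adding 1 to
    \<open>A1\<close> avoids a division by 0.\<close>
  define w where "w = e / ((A1 + 1) * ((1 + d) * T))"
  have w: "0 < w" "A1 * w * ((1 + d) * T) \<le> e"
  proof -
    have p: "0 < (A1 + 1) * ((1 + d) * T)" using A1 by (intro mult_pos_pos[OF _ dpos]) simp
    show w0: "0 < w" unfolding w_def by (rule divide_pos_pos[OF e(1) p])
    have "A1 * w * ((1 + d) * T) \<le> (A1 + 1) * ((1 + d) * T) * w" using mult_pos_pos[OF dpos w0] by (simp add: algebra_simps)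
    also have "\<dots> = e" unfolding w_def by (rule mult_divide_self[OF p])
    finally show "A1 * w * ((1 + d) * T) \<le> e" .
  qed
  obtain \<delta>1 where \<delta>1: "0 < \<delta>1" "\<And>\<delta>. 0 < \<delta> \<Longrightarrow> \<delta> \<le> \<delta>1 \<Longrightarrow> \<exists>C\<ge>0. \<forall>y z. cball y \<delta> \<subseteq> K \<longrightarrow>
     \<bar>(if y + z \<in> K then h (y + z) else 0) - h y - (\<Sum>i\<in>UNIV. partial_deriv i h y * z $ i)
      - 1/2 * (\<Sum>i\<in>UNIV. \<Sum>j\<in>UNIV. partial_deriv i (partial_deriv j h) y * (z $ i * z $ j))\<bar> \<le> w * (norm z)\<^sup>2 + C * (norm z)^4"
    using taylor_cutoff[OF C2 K w(1)] by blast
  have Ku1: "0 < 3 * (1 + Ku)" using Ku_nonneg by simp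
  \<comment> \<open>Drifts at distance \<open>\<delta> * (1 + Ku)\<close> and points at distance
    \<open>2 * \<delta>\<close> have to be closer than \<open>d1\<close>; the factor 3 covers both
    strictly.\<close>
  define \<delta>2 where "\<delta>2 = d1 / (3 * (1 + Ku))"
  have \<delta>2: "0 < \<delta>2" unfolding \<delta>2_def by (rule divide_pos_pos[OF d1(1) Ku1])
  \<comment> \<open>The entry \<open>r0 / 2\<close> leaves room for two distances
    \<open>\<delta>\<close>: from the state to the Euler point, and on to the edge of the ball
    around it.\<close>
  define \<delta> where "\<delta> = Min {1, r0 / 2, \<delta>1, \<delta>2, d2 / 2}"
  have \<delta>: "0 < \<delta>" "\<delta> \<le> 1" "\<delta> \<le> r0 / 2" "\<delta> \<le> \<delta>1" "\<delta> \<le> \<delta>2" "\<delta> \<le> d2 / 2"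
    unfolding \<delta>_def using r0(1) \<delta>1(1) \<delta>2 d2(1) by simp_all
  have \<delta>K: "\<delta> * (1 + Ku) < d1" "2 * \<delta> < d1" "\<delta> < d2"
  proof -
    have 1: "\<delta> * (3 * (1 + Ku)) \<le> d1" using \<delta>(5) Ku1 unfolding \<delta>2_def by (simp only: pos_le_divide_eq)
    then show "\<delta> * (1 + Ku) < d1" using d1(1) by (simp add: algebra_simps)
    have "0 \<le> \<delta> * Ku" using \<delta>(1) Ku_nonneg by simp
    then show "2 * \<delta> < d1" using 1 \<delta>(1) by (simp add: algebra_simps)
    show "\<delta> < d2" using \<delta>(6) d2(1) by linarith
  qed
  obtain C where C: "0 \<le> C" and taylor: "\<And>y z. cball y \<delta> \<subseteq> K \<Longrightarrow>
     \<bar>(if y + z \<in> K then h (y + z) else 0) - h y - (\<Sum>i\<in>UNIV. partial_deriv i h y * z $ i)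
      - 1/2 * (\<Sum>i\<in>UNIV. \<Sum>j\<in>UNIV. partial_deriv i (partial_deriv j h) y * (z $ i * z $ j))\<bar> \<le> w * (norm z)\<^sup>2 + C * (norm z)^4"
    using \<delta>1(2)[OF \<delta>(1) \<delta>(4)] by blast
  \<comment> \<open>Six approximation events are united into \<open>EB\<close>, whose probability is
    multiplied by \<open>L + G * T\<close> in the end. \<open>eb\<close> can be chosen after these
    constants because only the mesh depends on it.\<close>
  define eb where "eb = e / (6 * (L + G * T + 1))"
  have LG: "0 < L + G * T + 1" using L(1) G(1) T by (intro add_nonneg_pos add_nonneg_nonneg) auto
  have eb: "0 < eb" "(L + G * T) * (6 * eb) \<le> e"
  proof -
    show eb0: "0 < eb" unfolding eb_def using LG e(1) by (intro divide_pos_pos) auto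
    have "(L + G * T) * (6 * eb) \<le> (L + G * T + 1) * (6 * eb)" using eb0 by (intro mult_right_mono) auto
    also have "\<dots> = (6 * (L + G * T + 1)) * eb" by (rule mult.left_commute[THEN trans, OF mult.assoc[symmetric]])
    also have "\<dots> = e" unfolding eb_def by (rule mult_divide_self) (use LG in simp)
    finally show "(L + G * T) * (6 * eb) \<le> e" .
  qed
  have osc: "eventually (\<lambda>N. mostly eb (\<lambda>\<omega>. small_oscillation T N \<eta> (\<lambda>s. \<psi> (X s \<omega>)))) sequentially"
    if "continuous_on S \<psi>" "0 < \<eta>" for \<psi> :: "real^'n \<Rightarrow> 'b::{second_countable_topology, real_normed_vector}" and \<eta>
  proof (rule oscillation_eventually_small[OF _ comp_path_cont[OF that(1)] T that(2) eb(1)])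
    show "(\<lambda>\<omega>. \<psi> (X s \<omega>)) \<in> borel_measurable M" if "s \<in> {0..T}" for s
      using that by (intro measurable_F_M[OF _ comp_adapted[OF \<open>continuous_on S \<psi>\<close>]]) simp_all
  qed
  have small1: "eventually (\<lambda>N. T / real N < 1) sequentially"
    by (rule order_tendstoD(2)[OF lim_const_over_n]) simp
  have small2: "eventually (\<lambda>N. A1 * sqrt (T / real N) * ((1 + d) * T) < e) sequentially"
  proof (rule order_tendstoD(2)[OF _ e(1)])
    have "(\<lambda>N. A1 * sqrt (T / real N) * ((1 + d) * T)) \<longlonglongrightarrow> A1 * sqrt 0 * ((1 + d) * T)"
      by (intro tendsto_intros lim_const_over_n)
    then show "(\<lambda>N. A1 * sqrt (T / real N) * ((1 + d) * T)) \<longlonglongrightarrow> 0" by simp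
  qed
  have small3: "eventually (\<lambda>N. 8 * C * C1^4 * ((1 + 3 * d\<^sup>2) * T * (T / real N)) < e) sequentially"
  proof (rule order_tendstoD(2)[OF _ e(1)])
    have "(\<lambda>N. 8 * C * C1^4 * ((1 + 3 * d\<^sup>2) * T * (T / real N))) \<longlonglongrightarrow> 8 * C * C1^4 * ((1 + 3 * d\<^sup>2) * T * 0)"
      by (intro tendsto_intros lim_const_over_n)
    then show "(\<lambda>N. 8 * C * C1^4 * ((1 + 3 * d\<^sup>2) * T * (T / real N))) \<longlonglongrightarrow> 0" by simp
  qed
  have "eventually (\<lambda>N. 0 < N \<and> T / real N < 1 \<and> A1 * sqrt (T / real N) * ((1 + d) * T) < e \<and>
      8 * C * C1^4 * ((1 + 3 * d\<^sup>2) * T * (T / real N)) < e \<and>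
      mostly eb (\<lambda>\<omega>. small_oscillation T N \<delta> (\<lambda>s. X s \<omega>)) \<and>
      mostly eb (\<lambda>\<omega>. small_oscillation T N \<delta> (\<lambda>s. f (X s \<omega>))) \<and>
      mostly eb (\<lambda>\<omega>. small_oscillation T N \<delta> (\<lambda>s. g (X s \<omega>))) \<and>
      mostly eb (\<lambda>\<omega>. small_oscillation T N \<delta> (\<lambda>s. \<sigma> (X s \<omega>))) \<and>
      mostly eb (\<lambda>\<omega>. small_oscillation T N e (\<lambda>s. h (X s \<omega>))) \<and>
      mostly eb (\<lambda>\<omega>. \<forall>k\<le>N. norm (euler T N k \<omega> - X (grid_pt T N k) \<omega>) \<le> \<delta>)) sequentially"
    by (intro eventually_conj eventually_gt_at_top small1 small2 small3 osc[OF continuous_on_id \<delta>(1)] osc[OF coef_cont(1) \<delta>(1)]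
        osc[OF coef_cont(2) \<delta>(1)] osc[OF coef_cont(3) \<delta>(1)] osc[OF h_cont e(1)] euler_uniform[OF T \<delta>(1) eb(1)])
  from eventually_happens'[OF sequentially_bot this] obtain N where N: "0 < N" "T / real N < 1" "A1 * sqrt (T / real N) * ((1 + d) * T) < e"
      "8 * C * C1^4 * ((1 + 3 * d\<^sup>2) * T * (T / real N)) < e" and
      mX: "mostly eb (\<lambda>\<omega>. small_oscillation T N \<delta> (\<lambda>s. X s \<omega>))" and
      mf: "mostly eb (\<lambda>\<omega>. small_oscillation T N \<delta> (\<lambda>s. f (X s \<omega>)))" and
      mg: "mostly eb (\<lambda>\<omega>. small_oscillation T N \<delta> (\<lambda>s. g (X s \<omega>)))" and
      ms: "mostly eb (\<lambda>\<omega>. small_oscillation T N \<delta> (\<lambda>s. \<sigma> (X s \<omega>)))" and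
      mh: "mostly eb (\<lambda>\<omega>. small_oscillation T N e (\<lambda>s. h (X s \<omega>)))" and
      mY: "mostly eb (\<lambda>\<omega>. \<forall>k\<le>N. norm (euler T N k \<omega> - X (grid_pt T N k) \<omega>) \<le> \<delta>)"
    by (elim exE conjE) (rule that; assumption)
  have mae: "mostly 0 (\<lambda>\<omega>. X 0 \<omega> = \<xi> \<and> (\<forall>t\<ge>0. 0 \<le> generator f g \<sigma> (u t \<omega>) h (X t \<omega>)))"
    by (rule mostly_AE[OF AE_conjI[OF X_start generator_nonneg]]) simp
  obtain EB where EB: "EB \<in> events" "prob EB \<le> eb + (eb + (eb + (eb + (eb + (eb + 0)))))" and
    good: "\<And>\<omega>. \<omega> \<in> space M \<Longrightarrow> \<omega> \<notin> EB \<Longrightarrow>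
      (small_oscillation T N \<delta> (\<lambda>s. X s \<omega>)) \<and>
      (small_oscillation T N \<delta> (\<lambda>s. f (X s \<omega>))) \<and>
      (small_oscillation T N \<delta> (\<lambda>s. g (X s \<omega>))) \<and>
      (small_oscillation T N \<delta> (\<lambda>s. \<sigma> (X s \<omega>))) \<and>
      (small_oscillation T N e (\<lambda>s. h (X s \<omega>))) \<and>
      (\<forall>k\<le>N. norm (euler T N k \<omega> - X (grid_pt T N k) \<omega>) \<le> \<delta>) \<and>
      X 0 \<omega> = \<xi> \<and> (\<forall>t\<ge>0. 0 \<le> generator f g \<sigma> (u t \<omega>) h (X t \<omega>))"
    by (rule mostlyE[OF mostly_conj[OF mX mostly_conj[OF mf mostly_conj[OF mg mostly_conj[OF ms mostly_conj[OF mh mostly_conj[OF mY mae]]]]]]]) (rule that)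
  have EBe: "(L + G * T) * prob EB \<le> e"
  proof -
    have "(L + G * T) * prob EB \<le> (L + G * T) * (6 * eb)" using EB(2) L(1) G(1) T by (intro mult_left_mono) auto
    then show ?thesis using eb(2) by linarith
  qed
  have nb: "cball y \<delta> \<subseteq> K" if "x \<in> K0" "norm (y - x) \<le> \<delta>" for x y
  proof
    fix z assume "z \<in> cball y \<delta>"
    then have "norm (z - y) \<le> \<delta>" by (simp add: dist_norm norm_minus_commute)
    then have "norm (z - x) \<le> r0" using norm_triangle_ineq[of "z - y" "y - x"] that(2) \<delta>(3) by simp
    then show "z \<in> K" by (rule near[OF that(1)])
  qed
  define \<phi> where "\<phi> = (\<lambda>x. if x \<in> K then h x else 0)"
  define P where "P = alive T N K0 \<delta> (2 * e)"
  define Dr where "Dr = (\<lambda>k \<omega>. (\<Sum>i\<in>UNIV. partial_deriv i h (euler T N k \<omega>) * euler_drift T N k \<omega> $ i) +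
        1/2 * (T / N) * (\<Sum>i\<in>UNIV. \<Sum>j\<in>UNIV. (\<sigma> (X (grid_pt T N k) \<omega>) ** transpose (\<sigma> (X (grid_pt T N k) \<omega>))) $ i $ j
          * partial_deriv i (partial_deriv j h) (euler T N k \<omega>)))"
  have "\<exists>Z. integrable M Z \<and>
    expectation Z \<le> A1 * (w + sqrt (T / N)) * ((1 + d) * T) + 8 * C * C1^4 * ((1 + 3 * d\<^sup>2) * T * (T / N)) \<and>
    (\<forall>\<omega>\<in>space M. (\<Sum>k<N. if P k \<omega> then \<phi> (euler T N (Suc k) \<omega>) - \<phi> (euler T N k \<omega>) else 0)
      \<ge> (\<Sum>k<N. if P k \<omega> then Dr k \<omega> else 0) - Z \<omega>)"
    unfolding \<phi>_def P_def Dr_def A1_def n_def d_def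
    by (rule stopped_taylor_sum[where \<theta>="2 * e", OF T N(1) less_imp_le[OF N(2)] K compact_imp_closed[OF K0(1)] coef C1
        L(1,3,4) \<delta>(1) nb less_imp_le[OF w(1)] C taylor];
      (assumption | (intro exI conjI ballI, assumption, assumption, drule meta_spec, erule meta_mp, assumption)))
  then obtain Z where Z: "integrable M Z"
    "expectation Z \<le> A1 * (w + sqrt (T / N)) * ((1 + d) * T) + 8 * C * C1^4 * ((1 + 3 * d\<^sup>2) * T * (T / N))"
    "\<And>\<omega>. \<omega> \<in> space M \<Longrightarrow> (\<Sum>k<N. if P k \<omega> then \<phi> (euler T N (Suc k) \<omega>) - \<phi> (euler T N k \<omega>) else 0)
      \<ge> (\<Sum>k<N. if P k \<omega> then Dr k \<omega> else 0) - Z \<omega>"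
    by (elim exE conjE) (rule that; (assumption | erule (1) bspec))
  have EZ: "expectation Z \<le> 3 * e"
  proof -
    have "A1 * (w + sqrt (T / N)) * ((1 + d) * T) = A1 * w * ((1 + d) * T) + A1 * sqrt (T / N) * ((1 + d) * T)"
      by (simp only: distrib_left distrib_right)
    then show ?thesis using Z(2) w(2) N(3,4) by linarith
  qed
  define A where "A = {\<omega>\<in>space M. \<forall>t\<in>{0..T}. 0 < h (X t \<omega>)}"
  note nn = grid_pt_nonneg[OF T, of N] and st = grid_pt_strict[OF T N(1)]
  have drift_low: "Dr k \<omega> \<ge> - (if \<omega> \<in> EB then G else e / T) * (T / N)" if \<omega>: "\<omega> \<in> space M" and k: "k < N" and Pk: "P k \<omega>" for k \<omega>
    unfolding Dr_def
  proof (rule generator_cell_bound[OF T N(1) \<omega>])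
    let ?t = "grid_pt T N k"
    fix s assume s: "s \<in> {?t..grid_pt T N (Suc k)}"
    have s0: "0 \<le> s" using s nn[of k] by simp
    have x: "X ?t \<omega> \<in> S" "X ?t \<omega> \<in> K0" "norm (euler T N k \<omega> - X ?t \<omega>) \<le> \<delta>"
      using X_in[OF nn \<omega>] Pk by (auto simp: P_def alive_def)
    have us: "norm (u s \<omega>) \<le> Ku" by (rule u_bound[OF s0 \<omega>])
    define b where "b = f (X ?t \<omega>) + g (X ?t \<omega>) *v u s \<omega>"
    have yK: "euler T N k \<omega> \<in> K" using nb[OF x(2,3)] \<delta>(1) by auto
    have bR: "norm b \<le> C1"
    proof -
      have "norm (g (X ?t \<omega>) *v u s \<omega>) \<le> norm (g (X ?t \<omega>)) * Ku"
        by (rule order_trans[OF norm_matrix_vector_le mult_left_mono[OF us]]) simp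
      then show ?thesis unfolding b_def using norm_triangle_ineq[of "f (X ?t \<omega>)" "g (X ?t \<omega>) *v u s \<omega>"] coef(1)[OF x(1,2)] by linarith
    qed
    have sR: "norm (\<sigma> (X ?t \<omega>)) \<le> C1" by (rule coef(2)[OF x(1,2)])
    have CR: "C1 \<le> R" unfolding R_def using Ku_nonneg by simp
    have gb: "\<bar>gen_at h b (\<sigma> (X ?t \<omega>)) (euler T N k \<omega>)\<bar> \<le> G"
      using bR sR CR by (intro G(2) yK) auto
    have "- (if \<omega> \<in> EB then G else e / T) \<le> gen_at h b (\<sigma> (X ?t \<omega>)) (euler T N k \<omega>)"
    proof (cases "\<omega> \<in> EB")
      case True
      then show ?thesis using gb by simp
    next
      case False
      note gd = good[OF \<omega> False]
      define b' where "b' = f (X s \<omega>) + g (X s \<omega>) *v u s \<omega>"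
      have dX: "norm (X s \<omega> - X ?t \<omega>) \<le> \<delta>" and df: "norm (f (X s \<omega>) - f (X ?t \<omega>)) \<le> \<delta>"
        and dg: "norm (g (X s \<omega>) - g (X ?t \<omega>)) \<le> \<delta>" and ds: "norm (\<sigma> (X s \<omega>) - \<sigma> (X ?t \<omega>)) \<le> \<delta>"
        by (rule small_oscillationD[OF gd[THEN conjunct1] k s], rule small_oscillationD[OF gd[THEN conjunct2, THEN conjunct1] k s], rule small_oscillationD[OF gd[THEN conjunct2, THEN conjunct2, THEN conjunct1] k s], rule small_oscillationD[OF gd[THEN conjunct2, THEN conjunct2, THEN conjunct2, THEN conjunct1] k s])
      have sK: "X s \<omega> \<in> K" using dX \<delta>(1,3) by (intro near[OF x(2)]) linarith
      have db: "norm (b - b') \<le> \<delta> * (1 + Ku)"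
      proof -
        have "b - b' = (f (X ?t \<omega>) - f (X s \<omega>)) + (g (X ?t \<omega>) - g (X s \<omega>)) *v u s \<omega>"
          by (simp add: b_def b'_def matrix_vector_mult_diff_rdistrib)
        also have "norm \<dots> \<le> norm (f (X ?t \<omega>) - f (X s \<omega>)) + norm (g (X ?t \<omega>) - g (X s \<omega>)) * norm (u s \<omega>)"
          by (rule order_trans[OF norm_triangle_ineq add_left_mono[OF norm_matrix_vector_le]])
        also have "\<dots> \<le> \<delta> + \<delta> * Ku"
          using df dg us \<delta>(1) by (intro add_mono mult_mono) (auto simp: norm_minus_commute)
        finally show ?thesis by (simp add: algebra_simps)
      qed
      have "\<delta> * (1 + Ku) \<le> 1 * (1 + Ku)" using \<delta>(2) Ku_nonneg by (intro mult_right_mono) auto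
      then have b'R: "norm b' \<le> R"
        using norm_triangle_ineq2[of b' b] db bR unfolding R_def by (simp add: norm_minus_commute)
      have s'R: "norm (\<sigma> (X s \<omega>)) \<le> R"
        using norm_triangle_ineq2[of "\<sigma> (X s \<omega>)" "\<sigma> (X ?t \<omega>)"] ds sR \<delta>(2) Ku_nonneg unfolding R_def by linarith
      have dY: "norm (euler T N k \<omega> - X s \<omega>) \<le> 2 * \<delta>"
        using norm_triangle_ineq4[of "euler T N k \<omega> - X ?t \<omega>" "X s \<omega> - X ?t \<omega>"] dX x(3) by simp
      have "\<bar>gen_at h b (\<sigma> (X ?t \<omega>)) (euler T N k \<omega>) - gen_at h b' (\<sigma> (X s \<omega>)) (X s \<omega>)\<bar> < e / T"
      proof (rule d1(2))
        show "norm b \<le> R" "norm (\<sigma> (X ?t \<omega>)) \<le> R" using bR sR CR by auto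
        show "norm (b - b') < d1" using db \<delta>K by linarith
        show "norm (\<sigma> (X ?t \<omega>) - \<sigma> (X s \<omega>)) < d1" using ds \<delta>K(2) \<delta>(1) by (simp add: norm_minus_commute)
        show "norm (euler T N k \<omega> - X s \<omega>) < d1" using dY \<delta>K by linarith
      qed (fact yK b'R s'R sK)+
      moreover have "0 \<le> gen_at h b' (\<sigma> (X s \<omega>)) (X s \<omega>)"
        using gd[THEN conjunct2, THEN conjunct2, THEN conjunct2, THEN conjunct2, THEN conjunct2, THEN conjunct2, THEN conjunct2, rule_format, OF s0] unfolding b'_def generator_eq_gen_at .
      ultimately show ?thesis using False by simp
    qed
    then show "- (if \<omega> \<in> EB then G else e / T) \<le> gen_at h (f (X ?t \<omega>) + g (X ?t \<omega>) *v u s \<omega>) (\<sigma> (X ?t \<omega>)) (euler T N k \<omega>)"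
      unfolding b_def .
  qed
  \<comment> \<open>The scheme ends because \<open>h\<close> is small, because the path has left
    \<open>K0\<close> (then \<open>ER\<close>), or at time \<open>T\<close> (then \<open>A\<close>);
    a distance above \<open>\<delta>\<close> between the scheme and \<open>X\<close> occurs only on
    \<open>EB\<close>, where the cut-off gives the bound \<open>L\<close>.\<close>
  have stopped_value: "h \<xi> + (\<Sum>k<N. if P k \<omega> then \<phi> (euler T N (Suc k) \<omega>) - \<phi> (euler T N k \<omega>) else 0)
      \<le> 3 * e + c * (indicator A \<omega> + indicator ER \<omega>) + L * indicator EB \<omega>" if \<omega>: "\<omega> \<in> space M" for \<omega>
  proof -
    have "P k \<omega>" if "P (Suc k) \<omega>" for k using that by (auto simp: P_def alive_def)
    from stopped_telescope[of "\<lambda>k. P k \<omega>" N "\<lambda>k. \<phi> (euler T N k \<omega>)", OF this]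
    obtain \<nu> where \<nu>: "\<nu> \<le> N" "\<forall>k<\<nu>. P k \<omega>" "\<nu> < N \<longrightarrow> \<not> P \<nu> \<omega>"
      and tel: "(\<Sum>k<N. if P k \<omega> then \<phi> (euler T N (Suc k) \<omega>) - \<phi> (euler T N k \<omega>) else 0) = \<phi> (euler T N \<nu> \<omega>) - \<phi> (euler T N 0 \<omega>)"
      by auto
    have \<xi>K: "\<xi> \<in> K" using near[OF K0(3), of \<xi>] r0(1) by simp
    have e0: "euler T N 0 \<omega> = \<xi>" by (simp add: euler_def)
    have eq: "h \<xi> + (\<Sum>k<N. if P k \<omega> then \<phi> (euler T N (Suc k) \<omega>) - \<phi> (euler T N k \<omega>) else 0) = \<phi> (euler T N \<nu> \<omega>)"
      unfolding tel e0 using \<xi>K by (simp add: \<phi>_def)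
    have i01: "0 \<le> c * (indicator A \<omega> + indicator ER \<omega>)" using c(1) by simp
    show ?thesis
    proof (cases "\<omega> \<in> EB")
      case True
      have "\<phi> (euler T N \<nu> \<omega>) \<le> L" using L(1) L(2)[of "euler T N \<nu> \<omega>"] by (auto simp: \<phi>_def)
      then show ?thesis unfolding eq using True i01 e(1) by simp
    next
      case False
      note gd = good[OF \<omega> False]
      have cl: "norm (euler T N k \<omega> - X (grid_pt T N k) \<omega>) \<le> \<delta>" if "k \<le> N" for k by (rule gd[THEN conjunct2, THEN conjunct2, THEN conjunct2, THEN conjunct2, THEN conjunct2, THEN conjunct1, rule_format, OF that])
      have oX: "norm (X s \<omega> - X (grid_pt T N k) \<omega>) \<le> \<delta>" if "k < N" "s \<in> {grid_pt T N k..grid_pt T N (Suc k)}" for k s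
        by (rule small_oscillationD[OF gd[THEN conjunct1] that])
      have oh: "norm (h (X s \<omega>) - h (X (grid_pt T N k) \<omega>)) \<le> e" if "k < N" "s \<in> {grid_pt T N k..grid_pt T N (Suc k)}" for k s
        by (rule small_oscillationD[OF gd[THEN conjunct2, THEN conjunct2, THEN conjunct2, THEN conjunct2, THEN conjunct1] that])
      have x0: "X 0 \<omega> = \<xi>" by (rule gd[THEN conjunct2, THEN conjunct2, THEN conjunct2, THEN conjunct2, THEN conjunct2, THEN conjunct2, THEN conjunct1])
      have P0: "P 0 \<omega>" using x0 e(3) K0(3) \<delta>(1) by (simp add: P_def alive_def e0)
      have "0 < \<nu>" using \<nu>(3) P0 N(1) by (cases "\<nu> = 0") auto
      \<comment> \<open>The scheme was alive one step earlier, so at the stopping index both the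
        state and the Euler point are within \<open>2 * \<delta>\<close> of \<open>K0\<close>. Thus
        the last step stays in \<open>K\<close>, where the cut-off function is
        \<open>h\<close>.\<close>
      then obtain k where k: "\<nu> = Suc k" "k < N" "P k \<omega>" using \<nu>(1,2) by (cases \<nu>) auto
      have xk: "X (grid_pt T N k) \<omega> \<in> K0" using k(3) by (auto simp: P_def alive_def)
      have dx: "norm (X (grid_pt T N \<nu>) \<omega> - X (grid_pt T N k) \<omega>) \<le> \<delta>"
        using oX[OF k(2), of "grid_pt T N \<nu>"] st[of k] k(1) by simp
      have XK: "X (grid_pt T N \<nu>) \<omega> \<in> K" using dx \<delta>(1,3) by (intro near[OF xk]) linarith
      have YK: "euler T N \<nu> \<omega> \<in> K"
        using dx cl[OF \<nu>(1)] \<delta>(3) norm_triangle_ineq[of "euler T N \<nu> \<omega> - X (grid_pt T N \<nu>) \<omega>" "X (grid_pt T N \<nu>) \<omega> - X (grid_pt T N k) \<omega>"]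
        by (intro near[OF xk]) simp
      have "dist (h (euler T N \<nu> \<omega>)) (h (X (grid_pt T N \<nu>) \<omega>)) < e"
        using cl[OF \<nu>(1)] \<delta>K(3) by (intro d2(2) XK YK) (simp add: dist_norm)
      then have hv: "\<phi> (euler T N \<nu> \<omega>) \<le> h (X (grid_pt T N \<nu>) \<omega>) + e"
        using YK by (simp add: \<phi>_def dist_real_def)
      have hc: "h (X (grid_pt T N \<nu>) \<omega>) \<le> c" by (rule c(2)[OF X_in[OF nn \<omega>]])
      show ?thesis
      proof (cases "h (X (grid_pt T N \<nu>) \<omega>) \<le> 2 * e")
        case True
        then show ?thesis unfolding eq using hv i01 L(1) by (simp add: indicator_def)
      next
        case big: False
        have "\<omega> \<in> A \<or> \<omega> \<in> ER"
        proof (cases "\<nu> < N")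
          case True
          then have "\<not> P \<nu> \<omega>" using \<nu>(3) by simp
          then have "X (grid_pt T N \<nu>) \<omega> \<notin> K0"
            using k(3) big cl[OF \<nu>(1)] unfolding P_def alive_def k(1) by (auto simp: le_Suc_eq)
          moreover have "grid_pt T N \<nu> \<in> {0..T}" by (rule grid_pt_range[OF T \<nu>(1)])
          ultimately show ?thesis using ER(3)[OF \<omega>] by blast
        next
          case False
          have hk: "2 * e < h (X (grid_pt T N j) \<omega>)" if "j < N" for j
          proof -
            have "P j \<omega>" using \<nu>(1,2) False that by simp
            then show ?thesis by (simp add: P_def alive_def)
          qed
          \<comment> \<open>The level \<open>2 * e\<close> exceeds the oscillation \<open>e\<close>
            within a cell, so \<open>h\<close> stays positive between grid points. Time 0 is treated
            separately because cells are open on the left.\<close>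
          have "0 < h (X t \<omega>)" if t: "t \<in> {0..T}" for t
          proof (cases "t = 0")
            case True
            then show ?thesis using x0 initial(2) by simp
          next
            case False
            then obtain j where j: "j < N" "grid_pt T N j < t" "t \<le> grid_pt T N (Suc j)"
              using grid_cell_exists[of "grid_pt T N" t N] t grid_pt_last[OF N(1)] by auto
            have "norm (h (X t \<omega>) - h (X (grid_pt T N j) \<omega>)) \<le> e" using j by (intro oh) auto
            then show ?thesis using hk[OF j(1)] e(1) by (simp add: abs_le_iff)
          qed
          then show ?thesis using \<omega> by (simp add: A_def)
        qed
        then have "c \<le> c * (indicator A \<omega> + indicator ER \<omega>)" using c(1) by (auto simp: indicator_def)
        then show ?thesis unfolding eq using hv hc L(1) e(1) False by simp
      qed
    qed
  qed
  \<comment> \<open>On \<open>ER\<close> the path leaves \<open>K0\<close>, and only \<open>h \<le> c\<close> can be used; on the much smaller event \<open>EB\<close> the grid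
    approximation fails, and the bounds \<open>L\<close> and \<open>G\<close>, which depend on \<open>K0\<close>, are affordable.\<close>
  have pointwise: "h \<xi> \<le> 4 * e + c * (indicator A \<omega> + indicator ER \<omega>) + (L + G * T) * indicator EB \<omega> + Z \<omega>" if \<omega>: "\<omega> \<in> space M" for \<omega>
  proof -
    define m where "m = (if \<omega> \<in> EB then G else e / T)"
    have m0: "0 \<le> m" using G(1) eT by (simp add: m_def)
    have "- m * (T / N) \<le> (if P k \<omega> then Dr k \<omega> else 0)" if "k < N" for k
      using drift_low[OF \<omega> that] m0 T unfolding m_def[symmetric] by auto
    then have "(\<Sum>k<N. - m * (T / N)) \<le> (\<Sum>k<N. if P k \<omega> then Dr k \<omega> else 0)"
      by (intro sum_mono) simp
    moreover have "(\<Sum>k<N. - m * (T / N)) = - (m * T)" using N(1) by simp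
    moreover have "m * T \<le> e + G * T * indicator EB \<omega>" using T e(1) by (auto simp: m_def)
    ultimately have "- (e + G * T * indicator EB \<omega>) - Z \<omega> \<le> (\<Sum>k<N. if P k \<omega> then \<phi> (euler T N (Suc k) \<omega>) - \<phi> (euler T N k \<omega>) else 0)"
      using Z(3)[OF \<omega>] by linarith
    then show ?thesis using stopped_value[OF \<omega>] by (simp add: distrib_right)
  qed
  have AM: "A \<in> events" using Am by (simp add: A_def)
  have iA: "integrable M (indicator A :: 'w \<Rightarrow> real)" and iR: "integrable M (indicator ER :: 'w \<Rightarrow> real)" and iB: "integrable M (indicator EB :: 'w \<Rightarrow> real)"
    using AM ER(1) EB(1) by (auto simp: integrable_indicator_iff less_top[symmetric])
  have int: "integrable M (\<lambda>\<omega>. 4 * e + c * (indicator A \<omega> + indicator ER \<omega>) + (L + G * T) * indicator EB \<omega> + Z \<omega>)"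
    by (intro Bochner_Integration.integrable_add integrable_mult_right iA iR iB Z(1)) simp_all
  have "expectation (\<lambda>\<omega>. h \<xi>) \<le> expectation (\<lambda>\<omega>. 4 * e + c * (indicator A \<omega> + indicator ER \<omega>) + (L + G * T) * indicator EB \<omega> + Z \<omega>)"
    using pointwise by (intro integral_mono int) simp_all
  also have "\<dots> = 4 * e + c * (prob A + prob ER) + (L + G * T) * prob EB + expectation Z"
    using iA iR iB Z(1) AM ER(1) EB(1) by (simp add: prob_space)
  finally have "h \<xi> \<le> 4 * e + c * (prob A + prob ER) + (L + G * T) * prob EB + expectation Z"
    by (simp add: prob_space)
  moreover have "c * prob ER \<le> c * e" using ER(2) c(1) by (intro mult_left_mono) auto
  moreover have "c * (prob A + prob ER) = c * prob A + c * prob ER" "(c + 8) * e = c * e + 8 * e"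
    by (rule distrib_left, rule distrib_right)
  ultimately have "h \<xi> \<le> c * prob A + (c + 8) * e"
    using EBe EZ by linarith
  then show ?thesis by (simp add: A_def)
qed

text \<open>Positivity is an open condition, but a continuous path on a compact interval attains its
  minimum; so the event is a countable union of events with the closed condition that
  \<open>h\<close> is at least \<open>1 / (m + 1)\<close>.\<close>

lemma positive_path_event:
  assumes T: "0 \<le> T"
  shows "{\<omega>\<in>space M. \<forall>t\<in>{0..T}. 0 < h (X t \<omega>)} \<in> events"
proof -
  have "{\<omega>\<in>space M. \<forall>t\<in>{0..T}. h (X t \<omega>) \<in> {inverse (real (Suc m))..}} \<in> events" for m
  proof (rule closed_path_event)
    show "(\<lambda>\<omega>. h (X s \<omega>)) \<in> borel_measurable M" if "s \<in> {0..T}" for s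
      using that by (intro measurable_F_M[OF _ comp_adapted[OF h_cont]]) simp_all
  qed (simp_all add: comp_path_cont[OF h_cont])
  then have "(\<Union>m. {\<omega>\<in>space M. \<forall>t\<in>{0..T}. h (X t \<omega>) \<in> {inverse (real (Suc m))..}}) \<in> events"
    by (intro sets.countable_UN) auto
  also have "(\<Union>m. {\<omega>\<in>space M. \<forall>t\<in>{0..T}. h (X t \<omega>) \<in> {inverse (real (Suc m))..}}) = {\<omega>\<in>space M. \<forall>t\<in>{0..T}. 0 < h (X t \<omega>)}"
  proof (intro equalityI subsetI)
    fix \<omega> assume "\<omega> \<in> (\<Union>m. {\<omega>\<in>space M. \<forall>t\<in>{0..T}. h (X t \<omega>) \<in> {inverse (real (Suc m))..}})"
    then obtain m where m: "\<omega> \<in> space M" "\<forall>t\<in>{0..T}. inverse (real (Suc m)) \<le> h (X t \<omega>)" by auto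
    have "0 < inverse (real (Suc m))" by simp
    then have "\<forall>t\<in>{0..T}. 0 < h (X t \<omega>)" using m(2) less_le_trans by blast
    with m(1) show "\<omega> \<in> {\<omega>\<in>space M. \<forall>t\<in>{0..T}. 0 < h (X t \<omega>)}" by simp
  next
    fix \<omega> assume w: "\<omega> \<in> {\<omega>\<in>space M. \<forall>t\<in>{0..T}. 0 < h (X t \<omega>)}"
    then have "continuous_on {0..T} (\<lambda>t. h (X t \<omega>))" by (intro comp_path_cont[OF h_cont]) simp
    then obtain t where t: "t \<in> {0..T}" "\<And>s. s \<in> {0..T} \<Longrightarrow> h (X t \<omega>) \<le> h (X s \<omega>)"
      using continuous_attains_inf[of "{0..T}" "\<lambda>t. h (X t \<omega>)"] T by auto
    have "0 < h (X t \<omega>)" using w t(1) by simp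
    then obtain m where "inverse (real (Suc m)) < h (X t \<omega>)" using reals_Archimedean by blast
    then have "\<forall>s\<in>{0..T}. h (X s \<omega>) \<in> {inverse (real (Suc m))..}" using t(2) by fastforce
    then show "\<omega> \<in> (\<Union>m. {\<omega>\<in>space M. \<forall>t\<in>{0..T}. h (X t \<omega>) \<in> {inverse (real (Suc m))..}})" using w by blast
  qed
  finally show ?thesis .
qed

section \<open>Letting the tolerance vanish and the horizon grow\<close>

lemma survival_bound_finite_horizon:
  assumes T: "0 < T" and c: "0 < c" "\<And>x. x \<in> S \<Longrightarrow> h x \<le> c"
  shows "h \<xi> \<le> c * prob {\<omega>\<in>space M. \<forall>t\<in>{0..T}. 0 < h (X t \<omega>)}"
proof (rule field_le_epsilon)
  fix \<epsilon> :: real assume \<epsilon>: "0 < \<epsilon>"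
  \<comment> \<open>The first two entries ensure \<open>e < 1\<close> and
    \<open>2 * e < h \<xi>\<close>; the third makes the total loss at most
    \<open>\<epsilon>\<close>.\<close>
  define e where "e = Min {1/2, h \<xi> / 3, \<epsilon> / (c + 8)}"
  have e: "0 < e" "e \<le> 1/2" "e \<le> h \<xi> / 3" "e \<le> \<epsilon> / (c + 8)"
  proof -
    show "0 < e" using initial(2) \<epsilon> c(1) by (simp add: e_def)
    show "e \<le> 1/2" "e \<le> h \<xi> / 3" "e \<le> \<epsilon> / (c + 8)"
      unfolding e_def by (rule Min_le; simp)+
  qed
  have "h \<xi> \<le> c * prob {\<omega>\<in>space M. \<forall>t\<in>{0..T}. 0 < h (X t \<omega>)} + (c + 8) * e"
    using e initial(2) by (intro survival_bound_step T c positive_path_event[OF less_imp_le[OF T]]) auto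
  moreover have "(c + 8) * e \<le> \<epsilon>"
    using e(4) c(1) by (simp add: pos_le_divide_eq mult.commute)
  ultimately show "h \<xi> \<le> c * prob {\<omega>\<in>space M. \<forall>t\<in>{0..T}. 0 < h (X t \<omega>)} + \<epsilon>" by linarith
qed

lemma survival_bound:
  assumes c: "0 < c" "\<And>x. x \<in> S \<Longrightarrow> h x \<le> c"
  shows "h \<xi> \<le> c * prob {\<omega>\<in>space M. \<forall>t\<ge>0. 0 < h (X t \<omega>)}"
proof -
  \<comment> \<open>Horizons \<open>Suc m\<close> rather than \<open>m\<close>, as the bound for a
    finite horizon asks for \<open>0 < T\<close>.\<close>
  define A where "A = (\<lambda>m::nat. {\<omega>\<in>space M. \<forall>t\<in>{0..real (Suc m)}. 0 < h (X t \<omega>)})"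
  have "decseq A" unfolding A_def decseq_def by force
  moreover have "range A \<subseteq> events" unfolding A_def using positive_path_event by auto
  ultimately have "(\<lambda>m. prob (A m)) \<longlonglongrightarrow> prob (\<Inter>m. A m)"
    by (intro finite_Lim_measure_decseq)
  moreover have "(\<Inter>m. A m) = {\<omega>\<in>space M. \<forall>t\<ge>0. 0 < h (X t \<omega>)}"
  proof (intro equalityI subsetI)
    fix \<omega> assume w: "\<omega> \<in> (\<Inter>m. A m)"
    have "0 < h (X t \<omega>)" if "0 \<le> t" for t
    proof -
      obtain m :: nat where "t \<le> real m" using real_arch_simple by blast
      then have "t \<in> {0..real (Suc m)}" using that by auto
      moreover have "\<omega> \<in> A m" using w by blast
      ultimately show ?thesis unfolding A_def by blast
    qed
    moreover have "\<omega> \<in> space M" using w by (auto simp: A_def)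
    ultimately show "\<omega> \<in> {\<omega>\<in>space M. \<forall>t\<ge>0. 0 < h (X t \<omega>)}" by simp
  qed (auto simp: A_def)
  ultimately have "(\<lambda>m. c * prob (A m)) \<longlonglongrightarrow> c * prob {\<omega>\<in>space M. \<forall>t\<ge>0. 0 < h (X t \<omega>)}"
    by (intro tendsto_mult_left) simp
  then show ?thesis
  proof (rule LIMSEQ_le_const)
    show "\<exists>N. \<forall>m\<ge>N. h \<xi> \<le> c * prob (A m)"
      unfolding A_def using survival_bound_finite_horizon[OF _ c] by auto
  qed
qed

end

theorem mainTheorem2:
  fixes M :: "'w measure"
    and F :: "real \<Rightarrow> 'w measure"
    and W :: "real \<Rightarrow> 'w \<Rightarrow> real^'d::finite"
    and S :: "(real^'n::finite) set"
    and U :: "(real^'p::finite) set"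
    and f :: "real^'n \<Rightarrow> real^'n"
    and g :: "real^'n \<Rightarrow> real^'p^'n"
    and \<sigma> :: "real^'n \<Rightarrow> real^'d^'n"
    and h :: "real^'n \<Rightarrow> real"
    and \<xi> :: "real^'n"
    and c :: ereal
    and u :: "real \<Rightarrow> 'w \<Rightarrow> real^'p"
    and X :: "real \<Rightarrow> 'w \<Rightarrow> real^'n"
  assumes "prob_space M"
    and "filtration_of M F"
    and "brownian_motion M F W"
    and "compact U"
    and "smooth_on g S" and "smooth_on \<sigma> S"
    and "locally_lipschitz_on f S" and "locally_lipschitz_on g S" and "locally_lipschitz_on \<sigma> S"
    and "linear_growth_on f S" and "linear_growth_on g S" and "linear_growth_on \<sigma> S"
    and "C_k_on 2 h S"
    and "scbf S U f g \<sigma> (safe_set S h) h"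
    and "c = (SUP x\<in>safe_set S h. ereal (h x))"
    and "\<xi> \<in> safe_interior S h"
    and "control_signal M F U u"
    and "strong_solution M F W S f g \<sigma> u \<xi> X"
    and "conforms_to M (scbf_strategy U f g \<sigma> h) u X"
  shows "ereal (measure M {\<omega>\<in>space M. \<forall>t\<ge>0. X t \<omega> \<in> safe_interior S h}) \<ge> ereal (h \<xi>) / c"
proof (cases "c = \<infinity>")
  \<comment> \<open>Division by infinity is 0 in \<open>ereal\<close>, which is the convention for
    the quotient.\<close>
  case True
  then show ?thesis by simp
next
  case False
  obtain O' where O': "open O'" "S \<subseteq> O'" "C_k_open 2 h O'"
    using \<open>C_k_on 2 h S\<close> unfolding C_k_on_def by blast
  obtain Ku where Ku: "\<forall>t\<ge>0. \<forall>\<omega>\<in>space M. norm (u t \<omega>) \<le> Ku" and up: "progressively_measurable F u"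
    using \<open>control_signal M F U u\<close> unfolding control_signal_def by blast
  have \<xi>: "\<xi> \<in> S" "0 < h \<xi>"
    using \<open>\<xi> \<in> safe_interior S h\<close> by (auto simp: safe_interior_def)
  have gen: "AE \<omega> in M. \<forall>t\<ge>0. 0 \<le> generator f g \<sigma> (u t \<omega>) h (X t \<omega>)"
    using \<open>conforms_to M (scbf_strategy U f g \<sigma> h) u X\<close> unfolding conforms_to_def scbf_strategy_def
    by (rule AE_mp) (rule AE_I2, simp)
  interpret prob_space M by (rule \<open>prob_space M\<close>)
  interpret controlled_diffusion M F W S O' f g \<sigma> h \<xi> u X Ku
  proof (unfold_locales)
    show "filtration_of M F" "brownian_motion M F W" by fact+
    show "continuous_on S f" "continuous_on S g" "continuous_on S \<sigma>"
      using assms by (auto intro: locally_lipschitz_on_continuous_on)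
    show "norm (u t \<omega>) \<le> Ku" if "0 \<le> t" "\<omega> \<in> space M" for t \<omega> using Ku that by blast
  qed (fact assms O' \<xi> up gen)+
  have le: "ereal (h x) \<le> c" if "x \<in> safe_set S h" for x
    unfolding \<open>c = _\<close> using that by (rule SUP_upper)
  have \<xi>c: "ereal (h \<xi>) \<le> c" using \<xi> by (intro le) (simp add: safe_set_def)
  obtain c' where c': "c = ereal c'" using False \<xi>c by (cases c) auto
  have c0: "0 < c'" using \<xi>c \<xi>(2) unfolding c' by simp
  \<comment> \<open>Outside the safe set \<open>h\<close> is negative, hence below the positive
    \<open>c'\<close> as well; so the supremum over the safe set bounds \<open>h\<close> on all of
    \<open>S\<close>.\<close>
  have hc: "h x \<le> c'" if "x \<in> S" for x
    using le[of x] that c0 unfolding c' by (cases "0 \<le> h x") (auto simp: safe_set_def)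
  have ev: "{\<omega>\<in>space M. \<forall>t\<ge>0. X t \<omega> \<in> safe_interior S h} = {\<omega>\<in>space M. \<forall>t\<ge>0. 0 < h (X t \<omega>)}"
    using X_in by (auto simp: safe_interior_def)
  have "h \<xi> / c' \<le> measure M {\<omega>\<in>space M. \<forall>t\<ge>0. X t \<omega> \<in> safe_interior S h}"
    unfolding ev using survival_bound[OF c0 hc] c0 by (simp add: pos_divide_le_eq mult.commute)
  moreover have "ereal (h \<xi>) / c = ereal (h \<xi> / c')" using c0 by (simp add: c')
  ultimately show ?thesis by simp
qed

end
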